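(* Let $n\ge 1$ be an integer, $\sigma\ge 1$, $0<\delta_1<\sigma/2$, $j\in\{0,1\}$ and $s\ge 0$. Assume $n>4\delta_1$ and $$(u_0,u_1)\in \big(L^1(\mathbb{R}^n)\cap H^{s+j\sigma}(\mathbb{R}^n)\big)\times\big(L^1(\mathbb{R}^n)\cap H^{[s+(j-1)\sigma]^+}(\mathbb{R}^n)\big).$$ Let $u$ be the Sobolev solution of $$u_{tt}+(-\Delta)^\sigma u+(-\Delta)^{\delta_1}u_t=0,\qquad u(0,x)=u_0(x),\quad u_t(0,x)=u_1(x),$$ and let $P_1=\int_{\mathbb{R}^n}u_1(x)\,dx$. Then, as $t\to\infty$, $$\Big\|\partial_t^j |D|^s \Big(u(t,\cdot)- P_1\,\mathfrak{F}^{-1}\Big(\frac{e^{-t|\xi|^{2(\sigma-\delta_1)}}}{|\xi|^{2\delta_1}}\Big)(t,\cdot)\Big)\Big\|_{L^2}= o\Big(t^{-\frac{n}{4(\sigma-\delta_1)}-\frac{s}{2(\sigma-\delta_1)}-j+ \frac{\delta_1}{\sigma-\delta_1}}\Big).$$ Moreover, if $P_1\neq 0$, then there are positive constants $C_1,C_2$ (independent of $t$) such that for all sufficiently large $t\ge 1$ $$C_1\,t^{-\frac{n}{4(\sigma-\delta_1)}-\frac{s}{2(\sigma-\delta_1)}-j+ \frac{\delta_1}{\sigma-\delta_1}}\le \big\|\partial_t^j |D|^s u(t,\cdot)\big\|_{L^2}\le C_2\,t^{-\frac{n}{4(\sigma-\delta_1)}-\frac{s}{2(\sigma-\delta_1)}-j+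 \frac{\delta_1}{\sigma-\delta_1}}.$$
   Context: $H^a$ ($a\ge0$) is the $L^2$-based Bessel potential (Sobolev) space on $\mathbb{R}^n$; $[r]^+=\max\{r,0\}$. $\widehat{w}=\mathfrak{F}(w)$ is the Fourier transform in $x$, normalized so that $\widehat w(\xi)=\int_{\mathbb{R}^n}e^{-ix\cdot\xi}w(x)\,dx$ for $w \in L^1$, and $\mathfrak{F}^{-1}$ is its inverse. $|D|^s$ and $(-\Delta)^{\alpha}$ are the Fourier multipliers with symbols $|\xi|^s$ and $|\xi|^{2\alpha}$. The Sobolev solution $u$ is the one whose partial Fourier transform solves, for a.e. $\xi$, the ODE $\widehat u_{tt}+|\xi|^{2\delta_1}\widehat u_t+|\xi|^{2\sigma}\widehat u=0$ with $\widehat u(0,\xi)=\widehat{u_0}(\xi)$, $\widehat u_t(0,\xi)=\widehat{u_1}(\xi)$. *)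

theory Defs
  imports "HOL-Analysis.Analysis" "HOL-Library.Landau_Symbols"
begin

(* Elements of L^1, L^2 and H^a are represented by Borel measurable complex-valued functions;
   every class modulo equality a.e. contains such a function.  Operators whose values are only
   determined a.e. (the L^2 Fourier transform and its inverse, |D|^s, d/dt) pick a representative
   with SOME. *)

definition square_integrable :: "(real ^ 'n \<Rightarrow> complex) \<Rightarrow> bool" where
  "square_integrable f \<longleftrightarrow>
     f \<in> borel_measurable lborel \<and> integrable lborel (\<lambda>x. (norm (f x))\<^sup>2)"

(* Meaningful for square integrable f only. *)
definition L2_norm :: "(real ^ 'n \<Rightarrow> complex) \<Rightarrow> real" where
  "L2_norm f = sqrt (\<integral>x. (norm (f x))\<^sup>2 \<partial>lborel)"

definition fourier_integral :: "(real ^ 'n \<Rightarrow> complex) \<Rightarrow> real ^ 'n \<Rightarrow> complex" where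
  "fourier_integral w \<xi> = (\<integral>x. exp (- \<i> * complex_of_real (x \<bullet> \<xi>)) * w x \<partial>lborel)"

(* g is the L^2 Fourier transform of f: (f, g) lies in the L^2 closure of the graph of the
   Fourier integral on the intersection of L^1 and L^2, i.e. the transform is extended by
   continuity. *)
definition is_L2_fourier ::
    "(real ^ 'n \<Rightarrow> complex) \<Rightarrow> (real ^ 'n \<Rightarrow> complex) \<Rightarrow> bool" where
  "is_L2_fourier f g \<longleftrightarrow> square_integrable f \<and> square_integrable g \<and>
     (\<exists>\<phi> :: nat \<Rightarrow> real ^ 'n \<Rightarrow> complex.
        (\<forall>k. integrable lborel (\<phi> k) \<and> square_integrable (\<phi> k) \<and>
             square_integrable (fourier_integral (\<phi> k))) \<and>
        (\<lambda>k. L2_norm (\<lambda>x. \<phi> k x - f x)) \<longlonglongrightarrow> 0 \<and>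
        (\<lambda>k. L2_norm (\<lambda>\<xi>. fourier_integral (\<phi> k) \<xi> - g \<xi>)) \<longlonglongrightarrow> 0)"

(* The Fourier transform on the union of L^1 and L^2. *)
definition fourier :: "(real ^ 'n \<Rightarrow> complex) \<Rightarrow> real ^ 'n \<Rightarrow> complex" where
  "fourier w = (if integrable lborel w then fourier_integral w else (SOME g. is_L2_fourier w g))"

(* The inverse transform on L^2. *)
definition inv_fourier :: "(real ^ 'n \<Rightarrow> complex) \<Rightarrow> real ^ 'n \<Rightarrow> complex" where
  "inv_fourier g = (SOME f. square_integrable f \<and> (AE \<xi> in lborel. fourier f \<xi> = g \<xi>))"

(* The Bessel potential space H^a, a \<ge> 0. *)
definition sobolev_space :: "real \<Rightarrow> (real ^ 'n \<Rightarrow> complex) set" where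
  "sobolev_space a = {f. square_integrable f \<and>
     square_integrable (\<lambda>\<xi>. complex_of_real ((1 + (norm \<xi>)\<^sup>2) powr (a / 2)) * fourier f \<xi>)}"

(* |D|^s on H^s.  For s = 0 the symbol is 1 except at the origin, where 0 powr 0 = 0; the origin
   is a null set. *)
definition abs_D :: "real \<Rightarrow> (real ^ 'n \<Rightarrow> complex) \<Rightarrow> real ^ 'n \<Rightarrow> complex" where
  "abs_D s f = inv_fourier (\<lambda>\<xi>. complex_of_real (norm \<xi> powr s) * fourier f \<xi>)"

(* v is the derivative at time t of the L^2-valued curve w. *)
definition has_L2_time_derivative ::
    "(real \<Rightarrow> real ^ 'n \<Rightarrow> complex) \<Rightarrow> (real ^ 'n \<Rightarrow> complex) \<Rightarrow> real \<Rightarrow> bool" where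
  "has_L2_time_derivative w v t \<longleftrightarrow> square_integrable v \<and>
     (\<forall>\<^sub>F h in nhds 0. square_integrable (w (t + h))) \<and>
     ((\<lambda>h. L2_norm (\<lambda>x. (w (t + h) x - w t x) /\<^sub>R h - v x)) \<longlongrightarrow> 0) (at 0)"

definition L2_time_deriv ::
    "(real \<Rightarrow> real ^ 'n \<Rightarrow> complex) \<Rightarrow> real \<Rightarrow> real ^ 'n \<Rightarrow> complex" where
  "L2_time_deriv w t = (SOME v. has_L2_time_derivative w v t)"

(* u(t) is the L^2 function u t for t \<ge> 0.  U is a version of the partial Fourier transform of u,
   chosen so that for a.e. \<xi> the function U(., \<xi>) solves the ODE on all of [0, \<infinity>) (one-sided
   derivatives at 0); V is its time derivative. *)
definition sobolev_solution ::
    "real \<Rightarrow> real \<Rightarrow> (real ^ 'n \<Rightarrow> complex) \<Rightarrow> (real ^ 'n \<Rightarrow> complex) \<Rightarrow>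
     (real \<Rightarrow> real ^ 'n \<Rightarrow> complex) \<Rightarrow> bool" where
  "sobolev_solution \<sigma> \<delta> u\<^sub>0 u\<^sub>1 u \<longleftrightarrow>
     (\<forall>t\<ge>0. square_integrable (u t)) \<and>
     (\<exists>U V :: real \<Rightarrow> real ^ 'n \<Rightarrow> complex.
        (\<forall>t\<ge>0. AE \<xi> in lborel. U t \<xi> = fourier (u t) \<xi>) \<and>
        (AE \<xi> in lborel.
           U 0 \<xi> = fourier u\<^sub>0 \<xi> \<and> V 0 \<xi> = fourier u\<^sub>1 \<xi> \<and>
           (\<forall>t\<ge>0.
              ((\<lambda>\<tau>. U \<tau> \<xi>) has_vector_derivative V t \<xi>) (at t within {0..}) \<and>
              (\<exists>A. ((\<lambda>\<tau>. V \<tau> \<xi>) has_vector_derivative A) (at t within {0..}) \<and>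
                   A + complex_of_real (norm \<xi> powr (2 * \<delta>)) * V t \<xi>
                     + complex_of_real (norm \<xi> powr (2 * \<sigma>)) * U t \<xi> = 0))))"

definition profile :: "real \<Rightarrow> real \<Rightarrow> real \<Rightarrow> real ^ 'n \<Rightarrow> complex" where
  "profile \<sigma> \<delta> t = inv_fourier (\<lambda>\<xi>. complex_of_real
     (exp (- t * norm \<xi> powr (2 * (\<sigma> - \<delta>))) / norm \<xi> powr (2 * \<delta>)))"

end

theory Submission
  imports Defs "HOL-Probability.Characteristic_Functions"
begin

text \<open>At a fixed frequency \<open>\<xi>\<close> with \<open>r = \<bar>\<xi>\<bar>\<close> the equation is a damped oscillator with damping
  \<open>r\<^bsup>2\<delta>\<^esup>\<close> and stiffness \<open>r\<^bsup>2\<sigma>\<^esup>\<close>. Since \<open>\<delta> < \<sigma>/2\<close>, small \<open>r\<close> means overdamping: the characteristic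
  roots are real, the slow one close to \<open>- r\<^bsup>2(\<sigma>-\<delta>)\<^esup>\<close> and the fast one close to \<open>- r\<^bsup>2\<delta>\<^esup>\<close>. After the
  fast mode has died out, the solution is the slow mode with amplitude about
  \<open>F u\<^sub>1(\<xi>) / r\<^bsup>2\<delta>\<^esup>\<close>, and \<open>F u\<^sub>1(\<xi>)\<close> is close to \<open>F u\<^sub>1(0) = P\<^sub>1\<close>. This is the profile.

  The comparison is made rigorous by the parabolic scaling \<open>\<xi> = t\<^bsup>-1/q\<^esup> \<eta>\<close> with
  \<open>q = 2(\<sigma>-\<delta>)\<close>, which keeps \<open>t r\<^sup>q\<close> fixed. In the variable \<open>\<eta>\<close> the profile no longer depends on
  time, up to the power of \<open>t\<close> in the theorem (\<open>L2_norm_prof\<close>), while the explicit low-frequency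
  solution converges to it pointwise (\<open>low_scaled_limit\<close>) under a square integrable dominator
  (\<open>low_scaled_bound\<close>); the condition \<open>n > 4\<delta>\<close> is what makes \<open>r\<^bsup>-2\<delta>\<^esup>\<close> square integrable at the
  origin. Dominated convergence gives \<open>low_asymptotics\<close>. Away from the origin a Lyapunov
  functional (\<open>energy_decay\<close>) yields exponential decay with exactly the Sobolev regularity assumed
  of the data (\<open>high_decay\<close>). Together these prove \<open>frequency_asymptotics\<close>.

  The rest transfers this to physical space. Plancherel's theorem is proved by testing
  \<open>\<bar>F f\<bar>\<^sup>2\<close> against wide Gaussians (\<open>plancherel_integrable\<close>), extended to all square integrable
  functions by completeness, and complemented by surjectivity of the transform
  (\<open>is_L2_fourier_surj\<close>). The time derivative in the mean is computed on the Fourier side in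
  \<open>has_L2_time_derivative_fourier\<close>. The lower and upper bounds then follow from the triangle
  inequality, because the norm of the profile is exactly a positive constant times \<open>t\<^sup>\<kappa>\<close>.\<close>

section \<open>The space of square integrable functions\<close>

lemma square_integrable_measurable [measurable_dest]:
  "square_integrable f \<Longrightarrow> f \<in> borel_measurable borel"
  by (simp add: square_integrable_def)

lemma square_integrable_integrable:
  "square_integrable f \<Longrightarrow> integrable lborel (\<lambda>x. (norm (f x))\<^sup>2)"
  by (simp add: square_integrable_def)

lemma square_integrable_bound:
  fixes f g :: "real ^ 'n \<Rightarrow> complex"
  assumes "square_integrable f" "g \<in> borel_measurable borel" "AE x in lborel. norm (g x) \<le> norm (f x)"
  shows "square_integrable g"
  unfolding square_integrable_def
proof
  show "integrable lborel (\<lambda>x. (norm (g x))\<^sup>2)"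
    using square_integrable_integrable[OF assms(1)]
  proof (rule Bochner_Integration.integrable_bound)
    show "(\<lambda>x. (norm (g x))\<^sup>2) \<in> borel_measurable lborel"
      using assms(2) by measurable
    show "AE x in lborel. norm ((norm (g x))\<^sup>2) \<le> norm ((norm (f x))\<^sup>2)"
      using assms(3) by eventually_elim (simp add: power_mono)
  qed
qed (use assms(2) in simp)

lemma square_integrable_add:
  fixes f g :: "real ^ 'n \<Rightarrow> complex"
  assumes f: "square_integrable f" and g: "square_integrable g"
  shows "square_integrable (\<lambda>x. f x + g x)"
  unfolding square_integrable_def
proof
  note [measurable] = square_integrable_measurable[OF f] square_integrable_measurable[OF g]
  show "(\<lambda>x. f x + g x) \<in> borel_measurable lborel" by measurable
  have "integrable lborel (\<lambda>x. 2 * (norm (f x))\<^sup>2 + 2 * (norm (g x))\<^sup>2)"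
    using assms by (auto simp: square_integrable_def)
  then show "integrable lborel (\<lambda>x. (norm (f x + g x))\<^sup>2)"
  proof (rule Bochner_Integration.integrable_bound)
    have "(norm (f x + g x))\<^sup>2 \<le> 2 * (norm (f x))\<^sup>2 + 2 * (norm (g x))\<^sup>2" for x
    proof -
      have "(norm (f x + g x))\<^sup>2 \<le> (norm (f x) + norm (g x))\<^sup>2"
        by (intro power_mono norm_triangle_ineq) auto
      also have "\<dots> \<le> 2 * (norm (f x))\<^sup>2 + 2 * (norm (g x))\<^sup>2"
        using zero_le_power2[of "norm (f x) - norm (g x)"] by (simp add: power2_eq_square algebra_simps)
      finally show ?thesis .
    qed
    then show "AE x in lborel. norm ((norm (f x + g x))\<^sup>2) \<le> norm (2 * (norm (f x))\<^sup>2 + 2 * (norm (g x))\<^sup>2)"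
      by simp
  qed measurable
qed

lemma square_integrable_cmult:
  fixes f :: "real ^ 'n \<Rightarrow> complex"
  assumes "square_integrable f"
  shows "square_integrable (\<lambda>x. c * f x)"
  using assms by (auto simp: square_integrable_def norm_mult power_mult_distrib)

lemma square_integrable_diff:
  fixes f g :: "real ^ 'n \<Rightarrow> complex"
  assumes "square_integrable f" "square_integrable g"
  shows "square_integrable (\<lambda>x. f x - g x)"
  using square_integrable_add[OF assms(1) square_integrable_cmult[OF assms(2), of "-1"]] by simp

lemma measurable_cnj [measurable (raw)]:
  assumes "f \<in> borel_measurable N"
  shows "(\<lambda>x. cnj (f x)) \<in> borel_measurable N"
proof -
  have "cnj \<in> borel_measurable borel"
    by (intro borel_measurable_continuous_onI continuous_intros)
  from measurable_compose[OF assms this] show ?thesis .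
qed

lemma square_integrable_cnj:
  "square_integrable f \<Longrightarrow> square_integrable (\<lambda>x. cnj (f x))"
  by (simp add: square_integrable_def measurable_cnj)

lemma square_integrable_0: "square_integrable (\<lambda>x. 0)"
  by (simp add: square_integrable_def)

lemma L2_norm_nonneg: "0 \<le> L2_norm f"
  by (simp add: L2_norm_def)

lemma L2_norm_power2: "(L2_norm f)\<^sup>2 = (\<integral>x. (norm (f x))\<^sup>2 \<partial>lborel)"
  by (simp add: L2_norm_def)

lemma L2_norm_mono_AE:
  fixes f g :: "real ^ 'n \<Rightarrow> complex"
  assumes "square_integrable g" "AE x in lborel. norm (f x) \<le> norm (g x)"
  shows "L2_norm f \<le> L2_norm g"
  unfolding L2_norm_def
proof (intro real_sqrt_le_mono integral_mono_AE')
  show "integrable lborel (\<lambda>x. (norm (g x))\<^sup>2)"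
    using assms by (simp add: square_integrable_def)
  show "AE x in lborel. (norm (f x))\<^sup>2 \<le> (norm (g x))\<^sup>2"
    using assms(2) by eventually_elim (simp add: power_mono)
qed simp

lemma L2_norm_cong_AE:
  fixes f g :: "real ^ 'n \<Rightarrow> complex"
  assumes [measurable]: "f \<in> borel_measurable borel" "g \<in> borel_measurable borel"
    and "AE x in lborel. norm (f x) = norm (g x)"
  shows "L2_norm f = L2_norm g"
  unfolding L2_norm_def
  by (intro arg_cong[where f=sqrt] integral_cong_AE) (use assms(3) in auto)

lemma L2_norm_cmult: "L2_norm (\<lambda>x. c * f x) = norm c * L2_norm f"
  by (simp add: L2_norm_def norm_mult power_mult_distrib real_sqrt_mult)

lemma L2_norm_cnj: "L2_norm (\<lambda>x. cnj (f x)) = L2_norm f"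
  by (simp add: L2_norm_def)

lemma L2_norm_minus_commute: "L2_norm (\<lambda>x. f x - g x) = L2_norm (\<lambda>x. g x - f x)"
  by (simp add: L2_norm_def norm_minus_commute)

lemma nn_integral_norm_power2:
  assumes "square_integrable f"
  shows "(\<integral>\<^sup>+x. ennreal ((norm (f x))\<^sup>2) \<partial>lborel) = ennreal ((L2_norm f)\<^sup>2)"
  using assms by (simp add: L2_norm_power2 square_integrable_def nn_integral_eq_integral)

lemma square_integrableI_nn_integral:
  assumes f[measurable]: "f \<in> borel_measurable borel" and "B \<ge> 0"
    and le: "(\<integral>\<^sup>+x. ennreal ((norm (f x))\<^sup>2) \<partial>lborel) \<le> ennreal (B\<^sup>2)"
  shows "square_integrable f" "L2_norm f \<le> B"
proof -
  show f: "square_integrable f"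
    unfolding square_integrable_def
  proof
    show "integrable lborel (\<lambda>x. (norm (f x))\<^sup>2)"
      using le by (intro integrableI_bounded) (auto intro: le_less_trans)
  qed simp
  have "(L2_norm f)\<^sup>2 \<le> B\<^sup>2"
    using le unfolding nn_integral_norm_power2[OF f] by (simp add: ennreal_le_iff)
  then show "L2_norm f \<le> B"
    using \<open>B \<ge> 0\<close> power2_le_imp_le by blast
qed

lemma L2_norm_zero_AE:
  assumes f: "square_integrable f" and "L2_norm f = 0"
  shows "AE x in lborel. f x = 0"
proof -
  have "(\<integral>x. (norm (f x))\<^sup>2 \<partial>lborel) = 0"
    using assms(2) by (simp add: L2_norm_def)
  then show ?thesis
    using square_integrable_integrable[OF f] by (subst (asm) integral_nonneg_eq_0_iff_AE) auto
qed

lemma square_integrable_mult_integrable: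
  fixes f g :: "real ^ 'n \<Rightarrow> complex"
  assumes f: "square_integrable f" and g: "square_integrable g"
  shows "integrable lborel (\<lambda>x. f x * g x)"
proof (rule Bochner_Integration.integrable_bound)
  note [measurable] = square_integrable_measurable[OF f] square_integrable_measurable[OF g]
  show "integrable lborel (\<lambda>x. (norm (f x))\<^sup>2 + (norm (g x))\<^sup>2)"
    using assms by (auto simp: square_integrable_def)
  have "norm (f x) * norm (g x) \<le> (norm (f x))\<^sup>2 + (norm (g x))\<^sup>2" for x
    using zero_le_power2[of "norm (f x) - norm (g x)"] mult_nonneg_nonneg[OF norm_ge_zero norm_ge_zero, of "f x" "g x"]
    unfolding power2_diff by linarith
  then show "AE x in lborel. norm (f x * g x) \<le> norm ((norm (f x))\<^sup>2 + (norm (g x))\<^sup>2)"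
    by (simp add: norm_mult)
  show "(\<lambda>x. f x * g x) \<in> borel_measurable lborel" by measurable
qed

text \<open>The quadratic \<open>c \<mapsto> \<integral> (c \<bar>f\<bar> - \<bar>g\<bar>)\<^sup>2\<close> is nonnegative, so its discriminant is not positive; it
  degenerates to an affine function of \<open>c\<close> when the norm of \<open>f\<close> vanishes.\<close>

lemma L2_Cauchy_Schwarz:
  fixes f g :: "real ^ 'n \<Rightarrow> complex"
  assumes f: "square_integrable f" and g: "square_integrable g"
  shows "(\<integral>x. norm (f x) * norm (g x) \<partial>lborel) \<le> L2_norm f * L2_norm g"
proof -
  define A B C where "A = L2_norm f" and "B = L2_norm g"
    and "C = (\<integral>x. norm (f x) * norm (g x) \<partial>lborel)"
  have int: "integrable lborel (\<lambda>x. norm (f x) * norm (g x))"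
    using integrable_norm[OF square_integrable_mult_integrable[OF f g]] by (simp add: norm_mult)
  have intf: "integrable lborel (\<lambda>x. (norm (f x))\<^sup>2)" and intg: "integrable lborel (\<lambda>x. (norm (g x))\<^sup>2)"
    using f g by (auto simp: square_integrable_def)
  have quad: "0 \<le> A\<^sup>2 * c\<^sup>2 - 2 * c * C + B\<^sup>2" for c :: real
  proof -
    have "0 \<le> (\<integral>x. (c * norm (f x) - norm (g x))\<^sup>2 \<partial>lborel)" by simp
    also have "\<dots> = (\<integral>x. c\<^sup>2 * (norm (f x))\<^sup>2 - 2 * c * (norm (f x) * norm (g x)) + (norm (g x))\<^sup>2 \<partial>lborel)"
      by (intro Bochner_Integration.integral_cong refl) (simp add: power2_eq_square algebra_simps)
    also have "\<dots> = A\<^sup>2 * c\<^sup>2 - 2 * c * C + B\<^sup>2"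
      unfolding A_def B_def C_def L2_norm_power2 using int intf intg by simp
    finally show ?thesis .
  qed
  have "C\<^sup>2 \<le> (A * B)\<^sup>2"
  proof (cases "A = 0")
    case True
    have "C = 0"
    proof (rule ccontr)
      assume "C \<noteq> 0"
      then have "2 * ((B\<^sup>2 + 1) / (2 * C)) * C = B\<^sup>2 + 1" by (simp add: field_simps)
      then show False using quad[of "(B\<^sup>2 + 1) / (2 * C)"] True by simp
    qed
    then show ?thesis by simp
  next
    case False
    then have "A\<^sup>2 * (C / A\<^sup>2)\<^sup>2 - 2 * (C / A\<^sup>2) * C = - (C\<^sup>2 / A\<^sup>2)"
      by (simp add: power2_eq_square field_simps)
    with quad[of "C / A\<^sup>2"] have "C\<^sup>2 / A\<^sup>2 \<le> B\<^sup>2" by simp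
    then show ?thesis using False by (simp add: field_simps power_mult_distrib)
  qed
  then show ?thesis
    unfolding A_def B_def C_def
    by (rule power2_le_imp_le) (simp add: L2_norm_nonneg)
qed

lemma L2_inner_bound:
  fixes f g :: "real ^ 'n \<Rightarrow> complex"
  assumes f: "square_integrable f" and g: "square_integrable g"
  shows "norm (\<integral>x. f x * g x \<partial>lborel) \<le> L2_norm f * L2_norm g"
proof -
  have "norm (\<integral>x. f x * g x \<partial>lborel) \<le> (\<integral>x. norm (f x) * norm (g x) \<partial>lborel)"
    unfolding norm_mult[symmetric] by (rule integral_norm_bound)
  also note L2_Cauchy_Schwarz[OF f g]
  finally show ?thesis .
qed

lemma L2_norm_triangle:
  fixes f g :: "real ^ 'n \<Rightarrow> complex"
  assumes f: "square_integrable f" and g: "square_integrable g"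
  shows "L2_norm (\<lambda>x. f x + g x) \<le> L2_norm f + L2_norm g"
proof (rule power2_le_imp_le)
  have int: "integrable lborel (\<lambda>x. norm (f x) * norm (g x))"
    using integrable_norm[OF square_integrable_mult_integrable[OF f g]] by (simp add: norm_mult)
  have intf: "integrable lborel (\<lambda>x. (norm (f x))\<^sup>2)" and intg: "integrable lborel (\<lambda>x. (norm (g x))\<^sup>2)"
    using f g by (auto simp: square_integrable_def)
  have "(L2_norm (\<lambda>x. f x + g x))\<^sup>2 \<le> (\<integral>x. (norm (f x))\<^sup>2 + 2 * (norm (f x) * norm (g x)) + (norm (g x))\<^sup>2 \<partial>lborel)"
    unfolding L2_norm_power2
  proof (rule integral_mono)
    show "integrable lborel (\<lambda>x. (norm (f x + g x))\<^sup>2)"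
      using square_integrable_integrable[OF square_integrable_add[OF f g]] .
    show "(norm (f x + g x))\<^sup>2 \<le> (norm (f x))\<^sup>2 + 2 * (norm (f x) * norm (g x)) + (norm (g x))\<^sup>2" for x
      using power_mono[OF norm_triangle_ineq[of "f x" "g x"], of 2] by (simp add: power2_sum)
  qed (use int intf intg in auto)
  also have "\<dots> = (L2_norm f)\<^sup>2 + 2 * (\<integral>x. norm (f x) * norm (g x) \<partial>lborel) + (L2_norm g)\<^sup>2"
    unfolding L2_norm_power2 using int intf intg by simp
  also have "\<dots> \<le> (L2_norm f + L2_norm g)\<^sup>2"
    using L2_Cauchy_Schwarz[OF f g] by (simp add: power2_sum)
  finally show "(L2_norm (\<lambda>x. f x + g x))\<^sup>2 \<le> (L2_norm f + L2_norm g)\<^sup>2" .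
qed (simp add: L2_norm_nonneg)

lemma L2_norm_triangle_diff:
  fixes f g h :: "real ^ 'n \<Rightarrow> complex"
  assumes "square_integrable f" "square_integrable g" "square_integrable h"
  shows "L2_norm (\<lambda>x. f x - h x) \<le> L2_norm (\<lambda>x. f x - g x) + L2_norm (\<lambda>x. g x - h x)"
proof -
  have "(\<lambda>x. f x - h x) = (\<lambda>x. (f x - g x) + (g x - h x))" by auto
  then show ?thesis
    using L2_norm_triangle[OF square_integrable_diff[OF assms(1,2)] square_integrable_diff[OF assms(2,3)]]
    by metis
qed

lemma L2_norm_diff_bound:
  fixes f g :: "real ^ 'n \<Rightarrow> complex"
  assumes f: "square_integrable f" and g: "square_integrable g"
  shows "\<bar>L2_norm f - L2_norm g\<bar> \<le> L2_norm (\<lambda>x. f x - g x)"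
proof -
  have "L2_norm f \<le> L2_norm (\<lambda>x. f x - g x) + L2_norm g"
    using L2_norm_triangle_diff[OF f g square_integrable_0] by simp
  moreover have "L2_norm g \<le> L2_norm (\<lambda>x. g x - f x) + L2_norm f"
    using L2_norm_triangle_diff[OF g f square_integrable_0] by simp
  ultimately show ?thesis
    unfolding L2_norm_minus_commute[of g f] by linarith
qed

lemma L2_norm_tendsto:
  fixes f :: "real ^ 'n \<Rightarrow> complex"
  assumes g: "\<And>k. square_integrable (g k)" and f: "square_integrable f"
    and lim: "(\<lambda>k. L2_norm (\<lambda>x. g k x - f x)) \<longlonglongrightarrow> 0"
  shows "(\<lambda>k. L2_norm (g k)) \<longlonglongrightarrow> L2_norm f"
proof (rule LIM_zero_cancel, rule Lim_null_comparison[OF _ lim])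
  show "\<forall>\<^sub>F k in sequentially. norm (L2_norm (g k) - L2_norm f) \<le> L2_norm (\<lambda>x. g k x - f x)"
    using L2_norm_diff_bound[OF g f] unfolding real_norm_def by (intro always_eventually allI)
qed

lemma L2_norm_dominated_convergence:
  fixes F :: "nat \<Rightarrow> real ^ 'n \<Rightarrow> complex"
  assumes [measurable]: "\<And>k. F k \<in> borel_measurable borel" and D: "square_integrable D"
    and lim: "AE x in lborel. (\<lambda>k. F k x) \<longlonglongrightarrow> 0"
    and bound: "\<And>k. AE x in lborel. norm (F k x) \<le> norm (D x)"
  shows "(\<lambda>k. L2_norm (F k)) \<longlonglongrightarrow> 0"
proof -
  have "(\<lambda>k. \<integral>x. (norm (F k x))\<^sup>2 \<partial>lborel) \<longlonglongrightarrow> integral\<^sup>L lborel (\<lambda>x::real ^ 'n. 0)"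
  proof (rule integral_dominated_convergence[where w="\<lambda>x. (norm (D x))\<^sup>2"])
    show "integrable lborel (\<lambda>x. (norm (D x))\<^sup>2)" using D by (simp add: square_integrable_def)
    show "AE x in lborel. (\<lambda>k. (norm (F k x))\<^sup>2) \<longlonglongrightarrow> 0"
      using lim by eventually_elim (auto intro: tendsto_eq_intros)
    show "AE x in lborel. norm ((norm (F k x))\<^sup>2) \<le> (norm (D x))\<^sup>2" for k
      using bound[of k] by eventually_elim (simp add: power_mono)
  qed auto
  then have "(\<lambda>k. sqrt (\<integral>x. (norm (F k x))\<^sup>2 \<partial>lborel)) \<longlonglongrightarrow> sqrt 0"
    by (intro tendsto_real_sqrt) simp
  then show ?thesis by (simp add: L2_norm_def)
qed

section \<open>Affine changes of variables\<close>

lemma nn_integral_lborel_affine: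
  fixes t :: "'a::euclidean_space"
  assumes [measurable]: "f \<in> borel_measurable borel" and c: "c \<noteq> 0"
  shows "(\<integral>\<^sup>+x. f x \<partial>lborel) = ennreal (\<bar>c\<bar> ^ DIM('a)) * (\<integral>\<^sup>+x. f (t + c *\<^sub>R x) \<partial>lborel)"
  by (subst lborel_affine[OF c, of t])
     (simp add: nn_integral_density nn_integral_distr nn_integral_cmult)

lemma lborel_integrable_affine:
  fixes f :: "'a::euclidean_space \<Rightarrow> 'b :: {banach, second_countable_topology}"
  assumes f: "integrable lborel f" and c: "c \<noteq> 0"
  shows "integrable lborel (\<lambda>x. f (t + c *\<^sub>R x))"
  using f f[THEN borel_measurable_integrable] c unfolding integrable_iff_bounded
  by (subst (asm) nn_integral_lborel_affine[where c=c and t=t]) (auto simp: ennreal_mult_less_top)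

lemma lborel_integrable_affine_iff:
  fixes f :: "'a::euclidean_space \<Rightarrow> 'b :: {banach, second_countable_topology}"
  assumes "c \<noteq> 0"
  shows "integrable lborel (\<lambda>x. f (t + c *\<^sub>R x)) \<longleftrightarrow> integrable lborel f"
  using assms lborel_integrable_affine[of f c t]
    lborel_integrable_affine[of "\<lambda>x. f (t + c *\<^sub>R x)" "1/c" "- t /\<^sub>R c"]
  by (auto simp: algebra_simps divide_inverse_commute)

lemma lborel_integral_affine:
  fixes f :: "'a::euclidean_space \<Rightarrow> 'b :: {banach, second_countable_topology}"
  assumes c: "c \<noteq> 0"
  shows "(\<integral>x. f x \<partial>lborel) = \<bar>c\<bar> ^ DIM('a) *\<^sub>R (\<integral>x. f (t + c *\<^sub>R x) \<partial>lborel)"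
proof cases
  assume f[measurable]: "integrable lborel f" then show ?thesis
    using c f f[THEN borel_measurable_integrable] lborel_integrable_affine[OF f c, of t]
    by (subst lborel_affine[OF c, of t]) (simp add: integral_density integral_distr)
next
  assume "\<not> integrable lborel f" with c show ?thesis
    by (simp add: lborel_integrable_affine_iff not_integrable_integral_eq)
qed

lemma square_integrable_affine:
  fixes f :: "real ^ 'n \<Rightarrow> complex"
  assumes f: "square_integrable f" and c: "c \<noteq> 0"
  shows "square_integrable (\<lambda>x. f (t + c *\<^sub>R x))"
proof -
  note [measurable] = square_integrable_measurable[OF f]
  show ?thesis
    using lborel_integrable_affine[OF square_integrable_integrable[OF f] c, of t]
    by (simp add: square_integrable_def)
qed

lemma L2_norm_affine:
  fixes f :: "real ^ 'n \<Rightarrow> complex"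
  assumes c: "c \<noteq> 0"
  shows "L2_norm f = sqrt (\<bar>c\<bar> ^ CARD('n)) * L2_norm (\<lambda>x. f (t + c *\<^sub>R x))"
  unfolding L2_norm_def
  using lborel_integral_affine[OF c, of "\<lambda>x. (norm (f x))\<^sup>2" t]
  by (simp add: real_sqrt_mult)

lemma square_integrable_translation:
  fixes f :: "real ^ 'n \<Rightarrow> complex"
  shows "square_integrable f \<Longrightarrow> square_integrable (\<lambda>x. f (x + h))"
  using square_integrable_affine[of f 1 h] by (simp add: add.commute)

lemma L2_norm_translation:
  fixes f :: "real ^ 'n \<Rightarrow> complex"
  shows "L2_norm (\<lambda>x. f (x + h)) = L2_norm f"
  using L2_norm_affine[of 1 f h] by (simp add: add.commute)

section \<open>Completeness of the space of square integrable functions\<close>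

text \<open>A sequence whose successive differences satisfy a summable bound converges almost
  everywhere, because the integral of \<open>\<Sum>k. 2 ^ k * \<bar>d k\<bar>\<^sup>2\<close> is finite.\<close>

lemma fast_Cauchy_convergent_AE:
  fixes g :: "nat \<Rightarrow> real ^ 'n \<Rightarrow> complex"
  assumes g: "\<And>k. square_integrable (g k)"
    and fast: "\<And>k. L2_norm (\<lambda>x. g (Suc k) x - g k x) \<le> (1/2) ^ k"
  shows "AE x in lborel. convergent (\<lambda>k. g k x)"
proof -
  note [measurable] = square_integrable_measurable[OF g]
  define d where "d k x = g (Suc k) x - g k x" for k x
  have d: "square_integrable (d k)" for k
    unfolding d_def by (intro square_integrable_diff g)
  note [measurable] = square_integrable_measurable[OF d]
  have "(\<integral>\<^sup>+x. (\<Sum>k. ennreal (2 ^ k * (norm (d k x))\<^sup>2)) \<partial>lborel) =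
      (\<Sum>k. \<integral>\<^sup>+x. ennreal (2 ^ k * (norm (d k x))\<^sup>2) \<partial>lborel)"
    by (rule nn_integral_suminf) measurable
  also have "\<dots> \<le> (\<Sum>k. ennreal ((1/2) ^ k))"
  proof (intro suminf_le summableI)
    fix k
    have "(\<integral>\<^sup>+x. ennreal (2 ^ k * (norm (d k x))\<^sup>2) \<partial>lborel) = ennreal (2 ^ k) * ennreal ((L2_norm (d k))\<^sup>2)"
      by (simp add: ennreal_mult nn_integral_cmult nn_integral_norm_power2[OF d])
    also have "\<dots> = ennreal (2 ^ k * (L2_norm (d k))\<^sup>2)"
      by (simp add: ennreal_mult)
    also have "\<dots> \<le> ennreal (2 ^ k * ((1/2) ^ k)\<^sup>2)"
      using fast[of k] unfolding d_def[symmetric]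
      by (intro ennreal_leI mult_left_mono power_mono L2_norm_nonneg) auto
    also have "2 ^ k * ((1/2) ^ k)\<^sup>2 = (1/2 :: real) ^ k"
      by (simp add: power2_eq_square power_one_over)
    finally show "(\<integral>\<^sup>+x. ennreal (2 ^ k * (norm (d k x))\<^sup>2) \<partial>lborel) \<le> ennreal ((1/2) ^ k)" .
  qed
  also have "\<dots> = ennreal (\<Sum>k. (1/2) ^ k)"
    by (intro suminf_ennreal_eq summable_sums summable_geometric) auto
  finally have "(\<integral>\<^sup>+x. (\<Sum>k. ennreal (2 ^ k * (norm (d k x))\<^sup>2)) \<partial>lborel) \<noteq> \<infinity>"
    by (metis ennreal_less_top infinity_ennreal_def less_le_trans not_le)
  then have "AE x in lborel. (\<Sum>k. ennreal (2 ^ k * (norm (d k x))\<^sup>2)) \<noteq> \<infinity>"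
    by (intro nn_integral_PInf_AE) auto
  then show ?thesis
  proof eventually_elim
    fix x assume fin: "(\<Sum>k. ennreal (2 ^ k * (norm (d k x))\<^sup>2)) \<noteq> \<infinity>"
    define S where "S = (\<Sum>k. ennreal (2 ^ k * (norm (d k x))\<^sup>2))"
    have "S \<noteq> \<infinity>" using fin by (simp only: S_def not_False_eq_True)
    then obtain C where C: "C \<ge> 0" "S = ennreal C" by (cases S) auto
    have bd: "norm (d k x) \<le> sqrt C * sqrt (1/2) ^ k" for k
    proof -
      have "ennreal (2 ^ k * (norm (d k x))\<^sup>2) = (\<Sum>k\<in>{k}. ennreal (2 ^ k * (norm (d k x))\<^sup>2))" by simp
      also have "\<dots> \<le> S"
        unfolding S_def by (intro sum_le_suminf) auto
      finally have "2 ^ k * (norm (d k x))\<^sup>2 \<le> C"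
        using C by (simp add: ennreal_le_iff)
      then have "(norm (d k x))\<^sup>2 \<le> C * (1/2) ^ k"
        by (simp add: field_simps power_one_over)
      then have "norm (d k x) \<le> sqrt (C * (1/2) ^ k)"
        using real_le_rsqrt by blast
      then show ?thesis by (simp add: real_sqrt_mult real_sqrt_power)
    qed
    have "summable (\<lambda>k. d k x)"
    proof (rule summable_comparison_test)
      show "\<exists>N. \<forall>k\<ge>N. norm (d k x) \<le> sqrt C * sqrt (1/2) ^ k" using bd by blast
      have "sqrt (1/2) < (1::real)" by (simp add: real_sqrt_lt_1_iff)
      then show "summable (\<lambda>k. sqrt C * sqrt (1/2) ^ k)"
        by (intro summable_mult summable_geometric) (auto simp: abs_of_nonneg)
    qed
    then have "convergent (\<lambda>n. (\<Sum>k<n. d k x))"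
      by (simp add: summable_iff_convergent)
    moreover have "(\<lambda>n. (\<Sum>k<n. d k x)) = (\<lambda>n. g n x - g 0 x)"
      unfolding d_def by (subst sum_lessThan_telescope) simp
    ultimately show "convergent (\<lambda>k. g k x)"
      by (simp add: convergent_diff_const_right_iff)
  qed
qed

text \<open>The Riesz-Fischer theorem: a rapidly Cauchy subsequence converges almost everywhere, and Fatou's
  lemma turns the Cauchy estimate of the whole sequence into an estimate for the limit.\<close>

lemma square_integrable_complete:
  fixes g :: "nat \<Rightarrow> real ^ 'n \<Rightarrow> complex"
  assumes g: "\<And>k. square_integrable (g k)"
    and Cauchy: "\<And>e. e > 0 \<Longrightarrow> \<exists>N. \<forall>m\<ge>N. \<forall>k\<ge>N. L2_norm (\<lambda>x. g m x - g k x) < e"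
  shows "\<exists>G. square_integrable G \<and> (\<lambda>k. L2_norm (\<lambda>x. g k x - G x)) \<longlonglongrightarrow> 0"
proof -
  note [measurable] = square_integrable_measurable[OF g]
  have "\<exists>N. \<forall>m\<ge>N. \<forall>k\<ge>N. L2_norm (\<lambda>x. g m x - g k x) < (1/2) ^ i" for i :: nat
    by (rule Cauchy) simp
  then obtain N where N: "\<And>i m k. m \<ge> N i \<Longrightarrow> k \<ge> N i \<Longrightarrow> L2_norm (\<lambda>x. g m x - g k x) < (1/2) ^ i"
    by metis
  \<comment> \<open>Summing the thresholds makes \<open>r k\<close> at least as large as each of \<open>N 0, \<dots>, N k\<close>.\<close>
  define r where "r k = (\<Sum>i\<le>k. N i)" for k
  have rN: "r k \<ge> N i" if "i \<le> k" for i k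
    unfolding r_def by (rule member_le_sum) (use that in auto)
  define G where "G x = lim (\<lambda>k. g (r k) x)" for x
  have [measurable]: "G \<in> borel_measurable borel"
    unfolding G_def by measurable
  have "AE x in lborel. convergent (\<lambda>k. g (r k) x)"
  proof (rule fast_Cauchy_convergent_AE)
    show "L2_norm (\<lambda>x. g (r (Suc k)) x - g (r k) x) \<le> (1/2) ^ k" for k
      by (rule less_imp_le, rule N) (auto intro: rN)
  qed (rule g)
  then have lim: "AE x in lborel. (\<lambda>k. g (r k) x) \<longlonglongrightarrow> G x"
    by eventually_elim (simp add: G_def convergent_LIMSEQ_iff)
  have close: "square_integrable (\<lambda>x. g k x - G x) \<and> L2_norm (\<lambda>x. g k x - G x) \<le> (1/2) ^ i" if "k \<ge> N i" for k i
  proof -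
    have "(\<integral>\<^sup>+x. ennreal ((norm (g k x - G x))\<^sup>2) \<partial>lborel) =
        (\<integral>\<^sup>+x. liminf (\<lambda>m. ennreal ((norm (g k x - g (r m) x))\<^sup>2)) \<partial>lborel)"
    proof (rule nn_integral_cong_AE, use lim in eventually_elim)
      fix x assume "(\<lambda>m. g (r m) x) \<longlonglongrightarrow> G x"
      then have "(\<lambda>m. ennreal ((norm (g k x - g (r m) x))\<^sup>2)) \<longlonglongrightarrow> ennreal ((norm (g k x - G x))\<^sup>2)"
        by (intro tendsto_intros)
      then show "ennreal ((norm (g k x - G x))\<^sup>2) = liminf (\<lambda>m. ennreal ((norm (g k x - g (r m) x))\<^sup>2))"
        by (intro lim_imp_Liminf[symmetric]) auto
    qed
    also have "\<dots> \<le> liminf (\<lambda>m. \<integral>\<^sup>+x. ennreal ((norm (g k x - g (r m) x))\<^sup>2) \<partial>lborel)"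
      by (rule nn_integral_liminf) measurable
    also have "\<dots> \<le> liminf (\<lambda>m. ennreal (((1/2) ^ i)\<^sup>2))"
    proof (rule Liminf_mono)
      show "\<forall>\<^sub>F m in sequentially. (\<integral>\<^sup>+x. ennreal ((norm (g k x - g (r m) x))\<^sup>2) \<partial>lborel) \<le> ennreal (((1/2) ^ i)\<^sup>2)"
        using eventually_ge_at_top[of i]
      proof eventually_elim
        fix m assume "m \<ge> i"
        have "L2_norm (\<lambda>x. g k x - g (r m) x) \<le> (1/2) ^ i"
          using N[OF that rN[OF \<open>m \<ge> i\<close>]] by simp
        then show "(\<integral>\<^sup>+x. ennreal ((norm (g k x - g (r m) x))\<^sup>2) \<partial>lborel) \<le> ennreal (((1/2) ^ i)\<^sup>2)"
          unfolding nn_integral_norm_power2[OF square_integrable_diff[OF g g]]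
          by (intro ennreal_leI power_mono L2_norm_nonneg)
      qed
    qed
    also have "\<dots> = ennreal (((1/2) ^ i)\<^sup>2)"
      by (simp add: Liminf_const)
    finally show ?thesis
      using square_integrableI_nn_integral[of "\<lambda>x. g k x - G x" "(1/2) ^ i"] by simp
  qed
  have "square_integrable (\<lambda>x. g (N 0) x - (g (N 0) x - G x))"
    by (intro square_integrable_diff[OF g] conjunct1[OF close[of 0]]) simp
  then have "square_integrable G" by simp
  moreover have "(\<lambda>k. L2_norm (\<lambda>x. g k x - G x)) \<longlonglongrightarrow> 0"
  proof (rule LIMSEQ_I)
    fix e :: real assume "e > 0"
    then obtain i where "(1/2) ^ i < e"
      using real_arch_pow_inv[of e "1/2"] by auto
    then show "\<exists>no. \<forall>k\<ge>no. norm (L2_norm (\<lambda>x. g k x - G x) - 0) < e"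
      using close[of i] by (intro exI[of _ "N i"]) (auto simp: L2_norm_nonneg abs_of_nonneg intro: le_less_trans)
  qed
  ultimately show ?thesis by blast
qed

section \<open>Approximation in the space of square integrable functions\<close>

lemma square_integrable_ball:
  "square_integrable (\<lambda>x::real ^ 'n. if norm x \<le> r then c else 0)"
proof -
  have "integrable lborel (\<lambda>x::real ^ 'n. (norm c)\<^sup>2 * indicator (cball 0 r) x)"
    by (intro integrable_mult_right integrable_real_indicator emeasure_lborel_cball_finite) auto
  moreover have "(\<lambda>x::real ^ 'n. (norm c)\<^sup>2 * indicator (cball 0 r) x) = (\<lambda>x. (norm (if norm x \<le> r then c else 0))\<^sup>2)"
    by (auto simp: indicator_def)
  ultimately show ?thesis
    by (simp add: square_integrable_def)
qed

lemma integrable_square_integrable_cutoff: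
  fixes f :: "real ^ 'n \<Rightarrow> complex"
  assumes f: "square_integrable f"
  shows "integrable lborel (\<lambda>x. if norm x \<le> r then f x else 0)"
    and "square_integrable (\<lambda>x. if norm x \<le> r then f x else 0)"
proof -
  note [measurable] = square_integrable_measurable[OF f]
  have "(\<lambda>x. if norm x \<le> r then f x else 0) = (\<lambda>x. (if norm x \<le> r then 1 else 0) * f x)"
    by auto
  then show "integrable lborel (\<lambda>x. if norm x \<le> r then f x else 0)"
    using square_integrable_mult_integrable[OF square_integrable_ball[of r 1] f] by simp
  show "square_integrable (\<lambda>x. if norm x \<le> r then f x else 0)"
    by (rule square_integrable_bound[OF f]) auto
qed

lemma L2_norm_cutoff_tendsto:
  fixes f :: "real ^ 'n \<Rightarrow> complex"
  assumes f: "square_integrable f"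
  shows "(\<lambda>k. L2_norm (\<lambda>x. (if norm x \<le> real k then f x else 0) - f x)) \<longlonglongrightarrow> 0"
proof (rule L2_norm_dominated_convergence[OF _ f])
  note [measurable] = square_integrable_measurable[OF f]
  show "(\<lambda>x. (if norm x \<le> real k then f x else 0) - f x) \<in> borel_measurable borel" for k
    by measurable
  show "AE x in lborel. (\<lambda>k. (if norm x \<le> real k then f x else 0) - f x) \<longlonglongrightarrow> 0"
  proof (intro AE_I2 tendsto_eventually)
    fix x :: "real ^ 'n"
    show "\<forall>\<^sub>F k in sequentially. (if norm x \<le> real k then f x else 0) - f x = 0"
      using eventually_ge_at_top[of "nat \<lceil>norm x\<rceil>"] by eventually_elim (auto simp: nat_ceiling_le_eq)
  qed
qed auto

text \<open>A measurable function is almost everywhere a limit of continuous ones; a retraction onto a disc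
  and a cut-off make these inherit the bound and, up to a margin, the support of the limit, so that
  dominated convergence becomes applicable.\<close>

lemma continuous_approximation_bounded:
  fixes f :: "real ^ 'n \<Rightarrow> complex"
  assumes [measurable]: "f \<in> borel_measurable borel"
    and bd: "\<And>x. norm (f x) \<le> M" and supp: "\<And>x. norm x > M \<Longrightarrow> f x = 0" and "M > 0"
  shows "\<exists>h :: nat \<Rightarrow> real ^ 'n \<Rightarrow> complex. (\<forall>k. continuous_on UNIV (h k) \<and> (\<forall>x. norm (h k x) \<le> M) \<and>
    (\<forall>x. norm x > M + 1 \<longrightarrow> h k x = 0)) \<and> (AE x in lborel. (\<lambda>k. h k x) \<longlonglongrightarrow> f x)"
proof -
  have "f \<in> borel_measurable lebesgue"
    using measurable_completion[of f lborel borel] by simp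
  then have "f measurable_on UNIV"
    by (rule lebesgue_measurable_imp_measurable_on) simp
  then obtain N g where N: "negligible N" and g: "\<And>n. continuous_on UNIV (g n)"
    and lim: "\<And>x. x \<notin> N \<Longrightarrow> (\<lambda>n. g n x) \<longlonglongrightarrow> f x"
    unfolding measurable_on_def by auto
  define c :: "real ^ 'n \<Rightarrow> real" where "c x = max 0 (min 1 (M + 1 - norm x))" for x
  \<comment> \<open>\<open>p\<close> is the retraction of the plane onto the disc of radius \<open>M\<close>.\<close>
  define p :: "complex \<Rightarrow> complex" where "p z = (M / max M (norm z)) *\<^sub>R z" for z
  have c: "0 \<le> c x" "c x \<le> 1" "continuous_on UNIV c" for x
    unfolding c_def by (auto intro!: continuous_intros)
  have pnorm: "norm (p z) \<le> M" for z
    using \<open>M > 0\<close> unfolding p_def by (cases "norm z \<le> M") (auto simp: field_simps)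
  have pcont: "continuous_on UNIV p"
    using \<open>M > 0\<close> unfolding p_def by (intro continuous_intros) auto
  have pid: "p z = z" if "norm z \<le> M" for z
    using that \<open>M > 0\<close> unfolding p_def by simp
  have cf: "c x *\<^sub>R f x = f x" for x
    using supp[of x] by (cases "norm x > M") (auto simp: c_def)
  define h where "h n x = c x *\<^sub>R p (g n x)" for n x
  show ?thesis
  proof (intro exI[of _ h] conjI allI impI)
    fix k
    show "continuous_on UNIV (h k)"
      unfolding h_def by (intro continuous_on_scaleR c continuous_on_compose2[OF pcont g]) auto
    show "norm (h k x) \<le> M" for x
    proof -
      have "norm (h k x) = c x * norm (p (g k x))" using c by (simp add: h_def)
      also have "\<dots> \<le> 1 * M" by (intro mult_mono c pnorm) auto
      finally show ?thesis by simp
    qed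
    show "h k x = 0" if "norm x > M + 1" for x
      using that by (simp add: h_def c_def)
  next
    have "AE x in lebesgue. x \<notin> N"
      using N by (intro AE_not_in) (simp add: negligible_iff_null_sets)
    then have "AE x in lborel. x \<notin> N"
      by (simp add: AE_completion_iff)
    then show "AE x in lborel. (\<lambda>k. h k x) \<longlonglongrightarrow> f x"
    proof eventually_elim
      fix x assume "x \<notin> N"
      have "(\<lambda>k. p (g k x)) \<longlonglongrightarrow> p (f x)"
        by (rule continuous_on_tendsto_compose[OF pcont lim[OF \<open>x \<notin> N\<close>]]) auto
      then have "(\<lambda>k. c x *\<^sub>R p (g k x)) \<longlonglongrightarrow> c x *\<^sub>R p (f x)"
        by (intro tendsto_intros)
      then show "(\<lambda>k. h k x) \<longlonglongrightarrow> f x"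
        unfolding h_def pid[OF bd] cf .
    qed
  qed
qed

text \<open>The function is first truncated in both its argument and its values; the truncation is then
  approximated by continuous functions. Both steps converge by domination.\<close>

lemma continuous_bounded_support_dense:
  fixes f :: "real ^ 'n \<Rightarrow> complex"
  assumes f: "square_integrable f" and "e > 0"
  shows "\<exists>h M. continuous_on UNIV h \<and> (\<forall>x. norm (h x) \<le> M) \<and> (\<forall>x. norm x > M \<longrightarrow> h x = 0) \<and>
    square_integrable h \<and> L2_norm (\<lambda>x. h x - f x) < e"
proof -
  note [measurable] = square_integrable_measurable[OF f]
  define F where "F k x = (if norm x \<le> real k \<and> norm (f x) \<le> real k then f x else 0)" for k x
  have [measurable]: "F k \<in> borel_measurable borel" for k
    unfolding F_def by measurable
  have F: "square_integrable (F k)" for k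
    by (rule square_integrable_bound[OF f]) (auto simp: F_def)
  have "(\<lambda>k. L2_norm (\<lambda>x. F k x - f x)) \<longlonglongrightarrow> 0"
  proof (rule L2_norm_dominated_convergence[OF _ f])
    show "AE x in lborel. (\<lambda>k. F k x - f x) \<longlonglongrightarrow> 0"
    proof (intro AE_I2 tendsto_eventually)
      fix x :: "real ^ 'n"
      show "\<forall>\<^sub>F k in sequentially. F k x - f x = 0"
        using eventually_ge_at_top[of "nat \<lceil>norm x\<rceil>"] eventually_ge_at_top[of "nat \<lceil>norm (f x)\<rceil>"]
        by eventually_elim (auto simp: nat_ceiling_le_eq F_def)
    qed
  qed (auto simp: F_def)
  then have "\<forall>\<^sub>F k in sequentially. L2_norm (\<lambda>x. F k x - f x) < e / 2"
    using \<open>e > 0\<close> by (intro order_tendstoD) auto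
  then have "\<forall>\<^sub>F k in sequentially. k > 0 \<and> L2_norm (\<lambda>x. F k x - f x) < e / 2"
    using eventually_gt_at_top[of 0] by eventually_elim auto
  then obtain k where k: "k > 0" "L2_norm (\<lambda>x. F k x - f x) < e / 2"
    using eventually_happens' sequentially_bot by blast
  have "norm (F k x) \<le> real k" "norm x > real k \<Longrightarrow> F k x = 0" for x
    by (auto simp: F_def)
  then obtain h where "\<forall>n. continuous_on UNIV (h n) \<and> (\<forall>x. norm (h n x) \<le> real k) \<and>
      (\<forall>x. norm x > real k + 1 \<longrightarrow> h n x = 0)"
    and lim: "AE x in lborel. (\<lambda>n. h n x) \<longlonglongrightarrow> F k x"
    using continuous_approximation_bounded[of "F k" "real k"] k(1) by auto
  then have h: "\<And>n. continuous_on UNIV (h n)" "\<And>n x. norm (h n x) \<le> real k"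
      "\<And>n x. norm x > real k + 1 \<Longrightarrow> h n x = 0" by auto
  have [measurable]: "h n \<in> borel_measurable borel" for n
    by (rule borel_measurable_continuous_onI) (rule h)
  have ball: "square_integrable (\<lambda>x::real ^ 'n. if norm x \<le> real k + 1 then complex_of_real (2 * real k) else 0)"
    by (rule square_integrable_ball)
  have hsq: "square_integrable (h n)" for n
  proof (rule square_integrable_bound[OF ball])
    show "AE x in lborel. norm (h n x) \<le> norm (if norm x \<le> real k + 1 then complex_of_real (2 * real k) else 0)"
      using order_trans[OF h(2)[of n], of "2 * real k"] h(3)[of _ n] by (intro AE_I2) (auto simp: norm_mult not_le)
  qed measurable
  have "(\<lambda>n. L2_norm (\<lambda>x. h n x - F k x)) \<longlonglongrightarrow> 0"
  proof (rule L2_norm_dominated_convergence[OF _ ball])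
    show "AE x in lborel. (\<lambda>n. h n x - F k x) \<longlonglongrightarrow> 0"
      using lim by eventually_elim (rule LIM_zero)
    show "AE x in lborel. norm (h n x - F k x) \<le> norm (if norm x \<le> real k + 1 then complex_of_real (2 * real k) else 0)" for n
    proof (rule AE_I2)
      fix x
      have "norm (F k x) \<le> real k" by (simp add: F_def)
      then have "norm (h n x - F k x) \<le> 2 * real k"
        using h(2)[of n x] norm_triangle_ineq4[of "h n x" "F k x"] by linarith
      then show "norm (h n x - F k x) \<le> norm (if norm x \<le> real k + 1 then complex_of_real (2 * real k) else 0)"
        using h(3)[of x n] by (auto simp: F_def norm_mult)
    qed
  qed measurable
  then have "\<forall>\<^sub>F n in sequentially. L2_norm (\<lambda>x. h n x - F k x) < e / 2"
    using \<open>e > 0\<close> by (intro order_tendstoD) auto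
  then obtain n where n: "L2_norm (\<lambda>x. h n x - F k x) < e / 2"
    using eventually_happens' sequentially_bot by blast
  have "L2_norm (\<lambda>x. h n x - f x) < e"
    using L2_norm_triangle_diff[OF hsq F f, of n k] n k by linarith
  moreover have "norm (h n x) \<le> real k + 1" for x
    using h(2)[of n x] by linarith
  ultimately show ?thesis
    using h(1)[of n] h(3)[of _ n] hsq[of n] by (intro exI[of _ "h n"] exI[of _ "real k + 1"]) auto
qed

text \<open>For a continuous function of bounded support this is dominated convergence. The general case
  follows by density, since translations do not change the norm.\<close>

lemma L2_norm_translation_tendsto:
  fixes f :: "real ^ 'n \<Rightarrow> complex"
  assumes f: "square_integrable f" and a: "a \<longlonglongrightarrow> 0"
  shows "(\<lambda>k. L2_norm (\<lambda>x. f (x + a k) - f x)) \<longlonglongrightarrow> 0"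
proof (rule LIMSEQ_I)
  fix e :: real assume "e > 0"
  obtain h M where h: "continuous_on UNIV h" "\<And>x. norm (h x) \<le> M" "\<And>x. norm x > M \<Longrightarrow> h x = 0"
    "square_integrable h" and close: "L2_norm (\<lambda>x. h x - f x) < e / 3"
    using continuous_bounded_support_dense[OF f, of "e/3"] \<open>e > 0\<close> by auto
  note [measurable] = square_integrable_measurable[OF f] square_integrable_measurable[OF h(4)]
  obtain B where B: "\<And>k. norm (a k) \<le> B"
    using Bseq_eq_bounded convergent_imp_Bseq[of a] a unfolding Bseq_def convergent_def by auto
  have "(\<lambda>k. L2_norm (\<lambda>x. h (x + a k) - h x)) \<longlonglongrightarrow> 0"
  proof (rule L2_norm_dominated_convergence[OF _ square_integrable_ball[of "M + B" "2 * complex_of_real M"]])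
    show "AE x in lborel. (\<lambda>k. h (x + a k) - h x) \<longlonglongrightarrow> 0"
    proof (intro AE_I2 LIM_zero)
      fix x
      show "(\<lambda>k. h (x + a k)) \<longlonglongrightarrow> h x"
        by (rule continuous_on_tendsto_compose[OF h(1)]) (auto intro!: tendsto_eq_intros a)
    qed
    show "AE x in lborel. norm (h (x + a k) - h x) \<le> norm (if norm x \<le> M + B then 2 * complex_of_real M else 0)" for k
    proof (rule AE_I2)
      fix x
      have "M \<ge> 0" using h(2)[of 0] norm_ge_zero order_trans by blast
      have B0: "B \<ge> 0" using B[of 0] norm_ge_zero order_trans by blast
      show "norm (h (x + a k) - h x) \<le> norm (if norm x \<le> M + B then 2 * complex_of_real M else 0)"
      proof (cases "norm x \<le> M + B")
        case True
        have "norm (h (x + a k) - h x) \<le> M + M"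
          using norm_triangle_ineq4[of "h (x + a k)" "h x"] h(2)[of x] h(2)[of "x + a k"] by linarith
        then show ?thesis using True \<open>M \<ge> 0\<close> by (simp add: norm_mult)
      next
        case False
        have "norm x \<le> norm (x + a k) + norm (a k)"
          using norm_triangle_ineq4[of "x + a k" "a k"] by simp
        then have "norm (x + a k) > M" using B[of k] False by linarith
        moreover have "norm x > M" using False B0 by linarith
        ultimately show ?thesis using h(3) by simp
      qed
    qed
  qed measurable
  then have "\<forall>\<^sub>F k in sequentially. L2_norm (\<lambda>x. h (x + a k) - h x) < e / 3"
    using \<open>e > 0\<close> by (intro order_tendstoD) auto
  then show "\<exists>no. \<forall>k\<ge>no. norm (L2_norm (\<lambda>x. f (x + a k) - f x) - 0) < e"
    unfolding eventually_sequentially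
  proof (elim exE, intro exI allI impI)
    fix no k assume no: "\<forall>k\<ge>no. L2_norm (\<lambda>x. h (x + a k) - h x) < e / 3" and k: "k \<ge> no"
    have "L2_norm (\<lambda>x. f (x + a k) - h (x + a k)) = L2_norm (\<lambda>x. f x - h x)"
      by (rule L2_norm_translation[of "\<lambda>x. f x - h x"])
    also have "\<dots> < e / 3" using close by (simp add: L2_norm_minus_commute[of f h])
    finally have "L2_norm (\<lambda>x. f (x + a k) - h (x + a k)) < e / 3" .
    moreover have "L2_norm (\<lambda>x. h (x + a k) - h x) < e / 3" using no k by blast
    moreover note close
    moreover have "L2_norm (\<lambda>x. f (x + a k) - f x) \<le>
        L2_norm (\<lambda>x. f (x + a k) - h (x + a k)) + L2_norm (\<lambda>x. h (x + a k) - f x)"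
      by (intro L2_norm_triangle_diff square_integrable_translation f h)
    moreover have "L2_norm (\<lambda>x. h (x + a k) - f x) \<le> L2_norm (\<lambda>x. h (x + a k) - h x) + L2_norm (\<lambda>x. h x - f x)"
      by (intro L2_norm_triangle_diff square_integrable_translation f h)
    ultimately show "norm (L2_norm (\<lambda>x. f (x + a k) - f x) - 0) < e"
      by (simp add: L2_norm_nonneg)
  qed
qed

section \<open>The Fourier transform of Gaussians\<close>

text \<open>This is the characteristic function of the standard normal distribution without the
  normalising factor of its density.\<close>

lemma integral_gaussian_exp_real:
  "integrable lborel (\<lambda>x::real. exp (- \<i> * complex_of_real (x * t)) * complex_of_real (exp (- x\<^sup>2 / 2)))"
  "(\<integral>x. exp (- \<i> * complex_of_real (x * t)) * complex_of_real (exp (- x\<^sup>2 / 2)) \<partial>lborel) =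
    complex_of_real (sqrt (2 * pi) * exp (- t\<^sup>2 / 2))"
proof -
  have eq: "exp (- \<i> * complex_of_real (x * t)) * complex_of_real (exp (- x\<^sup>2 / 2)) =
      complex_of_real (sqrt (2 * pi)) * (std_normal_density x *\<^sub>R iexp (- t * x))" for x
    by (simp add: std_normal_density_def scaleR_conv_of_real mult_ac)
  interpret prob_space std_normal_distribution
    by (rule prob_space_normal_density) simp
  have "integrable std_normal_distribution (\<lambda>x. iexp (- t * x))"
    by (intro integrable_const_bound[where B=1] AE_I2) (auto simp: norm_exp_i_times)
  then have int: "integrable lborel (\<lambda>x. std_normal_density x *\<^sub>R iexp (- t * x))"
    by (subst (asm) integrable_density) auto
  then show "integrable lborel (\<lambda>x::real. exp (- \<i> * complex_of_real (x * t)) * complex_of_real (exp (- x\<^sup>2 / 2)))"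
    unfolding eq by (rule integrable_mult_right)
  have "(\<integral>x. std_normal_density x *\<^sub>R iexp (- t * x) \<partial>lborel) = char std_normal_distribution (- t)"
    unfolding char_def by (subst integral_density) auto
  then show "(\<integral>x. exp (- \<i> * complex_of_real (x * t)) * complex_of_real (exp (- x\<^sup>2 / 2)) \<partial>lborel) =
    complex_of_real (sqrt (2 * pi) * exp (- t\<^sup>2 / 2))"
    unfolding eq integral_mult_right_zero char_std_normal_distribution by simp
qed

lemma lborel_prod_Basis:
  fixes h :: "'a::euclidean_space \<Rightarrow> real \<Rightarrow> complex"
  assumes h: "\<And>b. b \<in> Basis \<Longrightarrow> integrable lborel (h b)"
  shows "integrable lborel (\<lambda>x. \<Prod>b\<in>Basis. h b (x \<bullet> b))"
    and "(\<integral>x. (\<Prod>b\<in>Basis. h b (x \<bullet> b)) \<partial>lborel) = (\<Prod>b\<in>Basis. \<integral>x. h b x \<partial>lborel)"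
proof -
  interpret product_sigma_finite "\<lambda>_::'a. lborel :: real measure" ..
  have [measurable]: "b \<in> Basis \<Longrightarrow> h b \<in> borel_measurable borel" for b
    using borel_measurable_integrable[OF h[of b]] by simp
  show "integrable lborel (\<lambda>x. \<Prod>b\<in>Basis. h b (x \<bullet> b))"
    unfolding lborel_eq[where 'a='a]
  proof (subst integrable_distr_eq)
    have "integrable (Pi\<^sub>M Basis (\<lambda>_. lborel)) (\<lambda>x. \<Prod>b\<in>Basis. h b (x b))"
      by (intro product_integrable_prod h) auto
    then show "integrable (Pi\<^sub>M Basis (\<lambda>_. lborel)) (\<lambda>x. \<Prod>b\<in>Basis. h b ((\<Sum>b\<in>Basis. x b *\<^sub>R b) \<bullet> b))"
      by (simp cong: prod.cong)
  qed auto
  have "(\<integral>x. (\<Prod>b\<in>Basis. h b (x \<bullet> b)) \<partial>lborel) =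
      (\<integral>x. (\<Prod>b\<in>Basis. h b ((\<Sum>b\<in>Basis. x b *\<^sub>R b) \<bullet> b)) \<partial>(Pi\<^sub>M Basis (\<lambda>_. lborel)))"
    unfolding lborel_eq[where 'a='a] by (subst integral_distr) auto
  also have "\<dots> = (\<integral>x. (\<Prod>b\<in>Basis. h b (x b)) \<partial>(Pi\<^sub>M Basis (\<lambda>_. lborel)))"
    by (simp cong: prod.cong)
  also have "\<dots> = (\<Prod>b\<in>Basis. \<integral>x. h b x \<partial>lborel)"
    by (intro product_integral_prod h) auto
  finally show "(\<integral>x. (\<Prod>b\<in>Basis. h b (x \<bullet> b)) \<partial>lborel) = (\<Prod>b\<in>Basis. \<integral>x. h b x \<partial>lborel)" .
qed

definition gaussian :: "real ^ 'n \<Rightarrow> real" where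
  "gaussian x = exp (- (norm x)\<^sup>2 / 2)"

lemma gaussian_prod: "gaussian x = (\<Prod>b\<in>Basis. exp (- (x \<bullet> b)\<^sup>2 / 2))"
  unfolding gaussian_def exp_sum[OF finite_Basis, symmetric]
  by (subst norm_eq_sqrt_inner, subst euclidean_inner)
     (simp add: power2_eq_square sum_negf sum_divide_distrib sum_nonneg)

lemma borel_measurable_gaussian [measurable]: "gaussian \<in> borel_measurable borel"
  unfolding gaussian_def by measurable

lemma fourier_integral_gaussian:
  fixes \<xi> :: "real ^ 'n"
  shows "integrable lborel (\<lambda>x. complex_of_real (gaussian (x :: real ^ 'n)))"
    and "fourier_integral (\<lambda>x. complex_of_real (gaussian x)) \<xi> = complex_of_real (sqrt (2 * pi) ^ CARD('n) * gaussian \<xi>)"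
proof -
  have eq: "exp (- \<i> * complex_of_real (x \<bullet> \<zeta>)) * complex_of_real (gaussian x) =
      (\<Prod>b\<in>Basis. exp (- \<i> * complex_of_real ((x \<bullet> b) * (\<zeta> \<bullet> b))) * complex_of_real (exp (- (x \<bullet> b)\<^sup>2 / 2)))"
    for x \<zeta> :: "real ^ 'n"
  proof -
    have "exp (- \<i> * complex_of_real (x \<bullet> \<zeta>)) = (\<Prod>b\<in>Basis. exp (- \<i> * complex_of_real ((x \<bullet> b) * (\<zeta> \<bullet> b))))"
      by (subst euclidean_inner) (simp add: exp_sum[symmetric] sum_distrib_left sum_negf)
    then show ?thesis
      by (simp only: gaussian_prod prod.distrib of_real_prod)
  qed
  have "integrable lborel (\<lambda>x::real ^ 'n. exp (- \<i> * complex_of_real (x \<bullet> 0)) * complex_of_real (gaussian x))"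
    unfolding eq by (intro lborel_prod_Basis integral_gaussian_exp_real)
  then show "integrable lborel (\<lambda>x::real ^ 'n. complex_of_real (gaussian x))" by simp
  have "fourier_integral (\<lambda>x. complex_of_real (gaussian x)) \<xi> =
      (\<Prod>b\<in>(Basis :: (real ^ 'n) set). complex_of_real (sqrt (2 * pi) * exp (- (\<xi> \<bullet> b)\<^sup>2 / 2)))"
    unfolding fourier_integral_def eq
    by (subst lborel_prod_Basis(2)) (intro integral_gaussian_exp_real, simp only: integral_gaussian_exp_real)
  also have "\<dots> = complex_of_real (sqrt (2 * pi) ^ CARD('n) * gaussian \<xi>)"
    unfolding of_real_prod[symmetric] prod.distrib gaussian_prod by simp
  finally show "fourier_integral (\<lambda>x. complex_of_real (gaussian x)) \<xi> = complex_of_real (sqrt (2 * pi) ^ CARD('n) * gaussian \<xi>)" .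
qed

lemma integral_gaussian:
  "integrable lborel (gaussian :: real ^ 'n \<Rightarrow> real)"
  "(\<integral>x. gaussian (x :: real ^ 'n) \<partial>lborel) = sqrt (2 * pi) ^ CARD('n)"
proof -
  show "integrable lborel (gaussian :: real ^ 'n \<Rightarrow> real)"
    using fourier_integral_gaussian(1) by (simp add: complex_of_real_integrable_eq)
  have "complex_of_real (\<integral>x. gaussian (x :: real ^ 'n) \<partial>lborel) = complex_of_real (sqrt (2 * pi) ^ CARD('n))"
    using fourier_integral_gaussian(2)[of "0 :: real ^ 'n"]
    by (simp add: fourier_integral_def gaussian_def flip: integral_complex_of_real)
  then show "(\<integral>x. gaussian (x :: real ^ 'n) \<partial>lborel) = sqrt (2 * pi) ^ CARD('n)"
    using of_real_eq_iff by blast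
qed

section \<open>Plancherel's theorem for integrable functions\<close>

lemma fourier_integrand_integrable:
  fixes w :: "real ^ 'n \<Rightarrow> complex"
  assumes w: "integrable lborel w"
  shows "integrable lborel (\<lambda>x. exp (- \<i> * complex_of_real (x \<bullet> \<xi>)) * w x)"
  using w
proof (rule Bochner_Integration.integrable_bound)
  note [measurable] = borel_measurable_integrable[OF w]
  show "(\<lambda>x. exp (- \<i> * complex_of_real (x \<bullet> \<xi>)) * w x) \<in> borel_measurable lborel"
    by measurable
qed (simp add: norm_mult)

lemma fourier_integral_bound:
  "norm (fourier_integral w \<xi>) \<le> (\<integral>x. norm (w x) \<partial>lborel)"
proof -
  have "norm (fourier_integral w \<xi>) \<le> (\<integral>x. norm (exp (- \<i> * complex_of_real (x \<bullet> \<xi>)) * w x) \<partial>lborel)"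
    unfolding fourier_integral_def by (rule integral_norm_bound)
  then show ?thesis by (simp add: norm_mult)
qed

lemma continuous_on_fourier_integral:
  fixes w :: "real ^ 'n \<Rightarrow> complex"
  assumes w: "integrable lborel w"
  shows "continuous_on UNIV (fourier_integral w)"
  unfolding continuous_on_sequentially
proof (intro allI ballI impI)
  fix x :: "nat \<Rightarrow> real ^ 'n" and a assume "(\<forall>n. x n \<in> UNIV) \<and> x \<longlonglongrightarrow> a"
  then have x: "x \<longlonglongrightarrow> a" by simp
  note [measurable] = borel_measurable_integrable[OF w]
  show "(fourier_integral w \<circ> x) \<longlonglongrightarrow> fourier_integral w a"
    unfolding comp_def fourier_integral_def
    by (rule integral_dominated_convergence[where w="\<lambda>x. norm (w x)"])
       (auto simp: norm_mult intro!: AE_I2 tendsto_intros x integrable_norm w)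
qed

lemma borel_measurable_fourier_integral:
  "integrable lborel w \<Longrightarrow> fourier_integral w \<in> borel_measurable borel"
  by (intro borel_measurable_continuous_onI continuous_on_fourier_integral)

lemma fourier_integral_add:
  assumes "integrable lborel v" "integrable lborel w"
  shows "fourier_integral (\<lambda>x. v x + w x) \<xi> = fourier_integral v \<xi> + fourier_integral w \<xi>"
  using fourier_integrand_integrable[OF assms(1)] fourier_integrand_integrable[OF assms(2)]
  by (simp add: fourier_integral_def algebra_simps)

lemma fourier_integral_cmult:
  "fourier_integral (\<lambda>x. c * w x) \<xi> = c * fourier_integral w \<xi>"
proof -
  have "(\<lambda>x. exp (- \<i> * complex_of_real (x \<bullet> \<xi>)) * (c * w x)) =
      (\<lambda>x. c * (exp (- \<i> * complex_of_real (x \<bullet> \<xi>)) * w x))" by (simp add: mult_ac)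
  then show ?thesis unfolding fourier_integral_def by simp
qed

lemma cnj_fourier_integral:
  "cnj (fourier_integral w \<xi>) = (\<integral>x. exp (\<i> * complex_of_real (x \<bullet> \<xi>)) * cnj (w x) \<partial>lborel)"
  unfolding fourier_integral_def
  by (subst Bochner_Integration.integral_cnj[symmetric]) (simp add: exp_cnj)

text \<open>This form of Fubini's theorem serves twice below: with the kernel \<open>exp (- \<i> x \<bullet> y)\<close> it is the
  multiplication formula, and with the conjugate kernel it evaluates the inner integral in the
  regularised Plancherel identity.\<close>

lemma integral_kernel_swap:
  fixes f g :: "real ^ 'n \<Rightarrow> complex" and k :: "real ^ 'n \<Rightarrow> real ^ 'n \<Rightarrow> complex"
  assumes f: "integrable lborel f" and g: "integrable lborel g"
    and k[measurable]: "(\<lambda>(x, y). k x y) \<in> borel_measurable (borel \<Otimes>\<^sub>M borel)"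
    and bound: "\<And>x y. norm (k x y) \<le> 1"
  shows "(\<integral>y. (\<integral>x. k x y * f x \<partial>lborel) * g y \<partial>lborel) = (\<integral>x. f x * (\<integral>y. k x y * g y \<partial>lborel) \<partial>lborel)"
proof -
  note [measurable] = borel_measurable_integrable[OF f] borel_measurable_integrable[OF g]
  have nb: "norm (k x y * f x * g y) \<le> norm (f x) * norm (g y)" for x y
    unfolding norm_mult by (intro mult_right_mono) (use bound[of x y] in \<open>auto intro: mult_left_le_one_le\<close>)
  have int_y: "integrable lborel (\<lambda>y. k x y * f x * g y)" for x
  proof (rule Bochner_Integration.integrable_bound)
    show "integrable lborel (\<lambda>y. norm (f x) * norm (g y))" using g by auto
    show "AE y in lborel. norm (k x y * f x * g y) \<le> norm (norm (f x) * norm (g y))"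
      using nb by simp
  qed measurable
  have "integrable (lborel \<Otimes>\<^sub>M lborel) (\<lambda>(x, y). k x y * f x * g y)"
  proof (rule lborel_pair.Fubini_integrable)
    show "integrable lborel (\<lambda>x. \<integral>y. norm (case (x, y) of (x, y) \<Rightarrow> k x y * f x * g y) \<partial>lborel)"
    proof (rule Bochner_Integration.integrable_bound)
      show "integrable lborel (\<lambda>x. norm (f x) * (\<integral>y. norm (g y) \<partial>lborel))" using f by auto
      show "AE x in lborel. norm (\<integral>y. norm (case (x, y) of (x, y) \<Rightarrow> k x y * f x * g y) \<partial>lborel)
          \<le> norm (norm (f x) * (\<integral>y. norm (g y) \<partial>lborel))"
      proof (rule AE_I2)
        fix x
        have "(\<integral>y. norm (k x y * f x * g y) \<partial>lborel) \<le> (\<integral>y. norm (f x) * norm (g y) \<partial>lborel)"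
          by (rule integral_mono) (use nb int_y[of x] g in auto)
        then show "norm (\<integral>y. norm (case (x, y) of (x, y) \<Rightarrow> k x y * f x * g y) \<partial>lborel)
          \<le> norm (norm (f x) * (\<integral>y. norm (g y) \<partial>lborel))"
          by simp
      qed
    qed measurable
    show "AE x in lborel. integrable lborel (\<lambda>y. case (x, y) of (x, y) \<Rightarrow> k x y * f x * g y)"
      using int_y by simp
  qed measurable
  from lborel_pair.Fubini_integral[OF this]
  have "(\<integral>y. (\<integral>x. k x y * f x * g y \<partial>lborel) \<partial>lborel) = (\<integral>x. (\<integral>y. k x y * f x * g y \<partial>lborel) \<partial>lborel)" .
  moreover have "(\<integral>y. k x y * f x * g y \<partial>lborel) = f x * (\<integral>y. k x y * g y \<partial>lborel)" for x
  proof -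
    have "(\<lambda>y. k x y * f x * g y) = (\<lambda>y. f x * (k x y * g y))" by (simp add: mult_ac)
    then show ?thesis by simp
  qed
  ultimately show ?thesis by simp
qed

lemma fourier_integral_multiplication_formula:
  fixes f g :: "real ^ 'n \<Rightarrow> complex"
  assumes "integrable lborel f" "integrable lborel g"
  shows "(\<integral>y. fourier_integral f y * g y \<partial>lborel) = (\<integral>x. f x * fourier_integral g x \<partial>lborel)"
  using integral_kernel_swap[OF assms, of "\<lambda>x y. exp (- \<i> * complex_of_real (x \<bullet> y))"]
  by (simp add: fourier_integral_def inner_commute)

lemma fourier_integral_gaussian_scaled:
  fixes z :: "real ^ 'n"
  assumes e: "e > 0"
  shows "integrable lborel (\<lambda>\<xi>::real ^ 'n. complex_of_real (gaussian (e *\<^sub>R \<xi>)))"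
    and "e ^ CARD('n) *\<^sub>R fourier_integral (\<lambda>\<xi>. complex_of_real (gaussian (e *\<^sub>R \<xi>))) (e *\<^sub>R z) =
      complex_of_real (sqrt (2 * pi) ^ CARD('n) * gaussian z)"
proof -
  show "integrable lborel (\<lambda>\<xi>::real ^ 'n. complex_of_real (gaussian (e *\<^sub>R \<xi>)))"
    using lborel_integrable_affine[OF fourier_integral_gaussian(1), of e 0] e by simp
  have "complex_of_real (sqrt (2 * pi) ^ CARD('n) * gaussian z) =
      fourier_integral (\<lambda>x. complex_of_real (gaussian x)) z"
    by (simp add: fourier_integral_gaussian)
  also have "\<dots> = e ^ CARD('n) *\<^sub>R (\<integral>\<xi>. exp (- \<i> * complex_of_real ((e *\<^sub>R \<xi>) \<bullet> z)) * complex_of_real (gaussian (e *\<^sub>R \<xi>)) \<partial>lborel)"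
    unfolding fourier_integral_def
    by (subst lborel_integral_affine[of e _ 0]) (use e in auto)
  finally show "e ^ CARD('n) *\<^sub>R fourier_integral (\<lambda>\<xi>. complex_of_real (gaussian (e *\<^sub>R \<xi>))) (e *\<^sub>R z) =
      complex_of_real (sqrt (2 * pi) ^ CARD('n) * gaussian z)"
    by (simp add: fourier_integral_def)
qed

lemma gaussian_le_1: "gaussian x \<le> 1"
  by (simp add: gaussian_def)

lemma gaussian_nonneg: "0 \<le> gaussian x"
  by (simp add: gaussian_def)

text \<open>Integrating \<open>\<bar>F f\<bar>\<^sup>2\<close> against a wide Gaussian gives an average of the autocorrelation
  \<open>h \<mapsto> \<integral> f(x) cnj (f(x+h)) dx\<close> over \<open>h\<close> of size \<open>e\<close>.\<close>

lemma plancherel_regularized: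
  fixes f :: "real ^ 'n \<Rightarrow> complex"
  assumes f1: "integrable lborel f" and f2: "square_integrable f" and e: "e > 0"
  shows "(\<integral>\<xi>. fourier_integral f \<xi> * (cnj (fourier_integral f \<xi>) * complex_of_real (gaussian (e *\<^sub>R \<xi>))) \<partial>lborel) =
    complex_of_real (sqrt (2 * pi) ^ CARD('n)) *
      (\<integral>z. complex_of_real (gaussian z) * (\<integral>x. f x * cnj (f (x + e *\<^sub>R z)) \<partial>lborel) \<partial>lborel)"
proof -
  note [measurable] = borel_measurable_integrable[OF f1] borel_measurable_fourier_integral[OF f1]
  define c where "c = sqrt (2 * pi) ^ CARD('n)"
  define G where "G \<xi> = complex_of_real (gaussian (e *\<^sub>R \<xi>))" for \<xi> :: "real ^ 'n"
  have G: "integrable lborel G"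
    unfolding G_def by (rule fourier_integral_gaussian_scaled[OF e])
  note [measurable] = borel_measurable_integrable[OF G]
  have cf1: "integrable lborel (\<lambda>x. cnj (f x))" using f1 by simp
  have g: "integrable lborel (\<lambda>\<xi>. cnj (fourier_integral f \<xi>) * G \<xi>)"
  proof (rule Bochner_Integration.integrable_bound)
    show "integrable lborel (\<lambda>\<xi>. (\<integral>x. norm (f x) \<partial>lborel) * norm (G \<xi>))"
      using G by (intro integrable_mult_right integrable_norm)
    show "AE \<xi> in lborel. norm (cnj (fourier_integral f \<xi>) * G \<xi>) \<le> norm ((\<integral>x. norm (f x) \<partial>lborel) * norm (G \<xi>))"
      using fourier_integral_bound[of f] by (auto simp: norm_mult intro!: mult_right_mono)
  qed measurable
  have inner: "fourier_integral (\<lambda>\<xi>. cnj (fourier_integral f \<xi>) * G \<xi>) x =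
      complex_of_real c * (\<integral>z. cnj (f (x + e *\<^sub>R z)) * complex_of_real (gaussian z) \<partial>lborel)" for x
  proof -
    have Gx: "integrable lborel (\<lambda>\<xi>. exp (- \<i> * complex_of_real (\<xi> \<bullet> x)) * G \<xi>)"
      by (rule fourier_integrand_integrable[OF G])
    have "fourier_integral (\<lambda>\<xi>. cnj (fourier_integral f \<xi>) * G \<xi>) x =
        (\<integral>\<xi>. (\<integral>y. exp (\<i> * complex_of_real (y \<bullet> \<xi>)) * cnj (f y) \<partial>lborel) * (exp (- \<i> * complex_of_real (\<xi> \<bullet> x)) * G \<xi>) \<partial>lborel)"
      unfolding fourier_integral_def[of "\<lambda>\<xi>. cnj (fourier_integral f \<xi>) * G \<xi>"] cnj_fourier_integral[symmetric]
      by (simp add: mult_ac)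
    also have "\<dots> = (\<integral>y. cnj (f y) * (\<integral>\<xi>. exp (\<i> * complex_of_real (y \<bullet> \<xi>)) * (exp (- \<i> * complex_of_real (\<xi> \<bullet> x)) * G \<xi>) \<partial>lborel) \<partial>lborel)"
      by (rule integral_kernel_swap[OF cf1 Gx]) (simp_all add: norm_exp_i_times)
    also have "\<dots> = (\<integral>y. cnj (f y) * fourier_integral G (x - y) \<partial>lborel)"
    proof -
      have "exp (\<i> * complex_of_real (y \<bullet> \<xi>)) * (exp (- \<i> * complex_of_real (\<xi> \<bullet> x)) * G \<xi>) =
          exp (- \<i> * complex_of_real (\<xi> \<bullet> (x - y))) * G \<xi>" for y \<xi>
        unfolding mult.assoc[symmetric] exp_add[symmetric]
        by (simp add: inner_diff_right inner_commute[of y] algebra_simps)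
      then show ?thesis
        by (simp only: fourier_integral_def)
    qed
    also have "\<dots> = e ^ CARD('n) *\<^sub>R (\<integral>z. cnj (f (x + e *\<^sub>R z)) * fourier_integral G (- (e *\<^sub>R z)) \<partial>lborel)"
      by (subst lborel_integral_affine[of e _ x]) (use e in auto)
    also have "\<dots> = (\<integral>z. cnj (f (x + e *\<^sub>R z)) * (e ^ CARD('n) *\<^sub>R fourier_integral G (e *\<^sub>R (- z))) \<partial>lborel)"
      by (subst integral_scaleR_right[symmetric]) (simp add: mult_ac)
    also have "\<dots> = (\<integral>z. complex_of_real c * (cnj (f (x + e *\<^sub>R z)) * complex_of_real (gaussian z)) \<partial>lborel)"
      unfolding G_def fourier_integral_gaussian_scaled(2)[OF e] c_def
      by (simp add: gaussian_def mult_ac)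
    finally show ?thesis by simp
  qed
  define H where "H = (\<lambda>(z, x). complex_of_real (gaussian z) * (f x * cnj (f (x + e *\<^sub>R z))))"
  have H[measurable]: "H \<in> borel_measurable (lborel \<Otimes>\<^sub>M lborel)"
    unfolding H_def by measurable
  note trans = square_integrable_translation[OF f2]
  have int_x: "integrable lborel (\<lambda>x. f x * cnj (f (x + h)))" for h
    by (intro square_integrable_mult_integrable f2 square_integrable_cnj trans)
  have autocorr: "(\<integral>x. norm (f x * cnj (f (x + h))) \<partial>lborel) \<le> (L2_norm f)\<^sup>2" for h
    using L2_Cauchy_Schwarz[OF f2 trans[of h]] by (simp add: norm_mult power2_eq_square L2_norm_translation)
  have "integrable (lborel \<Otimes>\<^sub>M lborel) H"
  proof (rule lborel_pair.Fubini_integrable[OF H])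
    show "integrable lborel (\<lambda>z. \<integral>x. norm (H (z, x)) \<partial>lborel)"
    proof (rule Bochner_Integration.integrable_bound)
      show "integrable lborel (\<lambda>z :: real ^ 'n. gaussian z * (L2_norm f)\<^sup>2)"
        by (intro integrable_mult_left integral_gaussian)
      show "AE z in lborel. norm (\<integral>x. norm (H (z, x)) \<partial>lborel) \<le> norm (gaussian z * (L2_norm f)\<^sup>2)"
      proof (rule AE_I2)
        fix z
        have "(\<integral>x. norm (H (z, x)) \<partial>lborel) = gaussian z * (\<integral>x. norm (f x * cnj (f (x + e *\<^sub>R z))) \<partial>lborel)"
          by (simp add: H_def norm_mult gaussian_nonneg)
        also have "\<dots> \<le> gaussian z * (L2_norm f)\<^sup>2"
          by (intro mult_left_mono autocorr gaussian_nonneg)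
        finally show "norm (\<integral>x. norm (H (z, x)) \<partial>lborel) \<le> norm (gaussian z * (L2_norm f)\<^sup>2)"
          by simp
      qed
    qed measurable
    show "AE z in lborel. integrable lborel (\<lambda>x. H (z, x))"
      unfolding H_def using int_x by simp
  qed
  then have swap: "(\<integral>x. (\<integral>z. H (z, x) \<partial>lborel) \<partial>lborel) = (\<integral>z. (\<integral>x. H (z, x) \<partial>lborel) \<partial>lborel)"
    using lborel_pair.Fubini_integral[of "\<lambda>z x. H (z, x)"] by simp
  have "(\<integral>\<xi>. fourier_integral f \<xi> * (cnj (fourier_integral f \<xi>) * G \<xi>) \<partial>lborel) =
      (\<integral>x. f x * fourier_integral (\<lambda>\<xi>. cnj (fourier_integral f \<xi>) * G \<xi>) x \<partial>lborel)"
    by (rule fourier_integral_multiplication_formula[OF f1 g])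
  also have "\<dots> = (\<integral>x. complex_of_real c * (\<integral>z. H (z, x) \<partial>lborel) \<partial>lborel)"
  proof (intro Bochner_Integration.integral_cong refl)
    fix x
    have "(\<lambda>z. H (z, x)) = (\<lambda>z. f x * (cnj (f (x + e *\<^sub>R z)) * complex_of_real (gaussian z)))"
      by (simp add: H_def mult_ac)
    then show "f x * fourier_integral (\<lambda>\<xi>. cnj (fourier_integral f \<xi>) * G \<xi>) x =
        complex_of_real c * (\<integral>z. H (z, x) \<partial>lborel)"
      unfolding inner by simp
  qed
  also have "\<dots> = complex_of_real c * (\<integral>z. (\<integral>x. H (z, x) \<partial>lborel) \<partial>lborel)"
    by (simp add: swap)
  finally show ?thesis
    by (simp add: G_def c_def H_def)
qed

text \<open>As \<open>e\<close> tends to \<open>0\<close>, the average of the autocorrelation in \<open>plancherel_regularized\<close> tends to its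
  value \<open>\<parallel>f\<parallel>\<^sup>2\<close> at \<open>0\<close> by continuity of translations. On the Fourier side Fatou's lemma first shows
  that \<open>\<bar>F f\<bar>\<^sup>2\<close> is integrable; it can then dominate its own regularisations.\<close>

theorem plancherel_integrable:
  fixes f :: "real ^ 'n \<Rightarrow> complex"
  assumes f1: "integrable lborel f" and f2: "square_integrable f"
  shows "square_integrable (fourier_integral f)"
    and "L2_norm (fourier_integral f) = sqrt (2 * pi) ^ CARD('n) * L2_norm f"
proof -
  note [measurable] = borel_measurable_integrable[OF f1] borel_measurable_fourier_integral[OF f1]
  define c where "c = sqrt (2 * pi) ^ CARD('n)"
  have c: "c > 0" by (simp add: c_def)
  define e where "e k = 1 / real (Suc k)" for k
  have e: "e k > 0" "e \<longlonglongrightarrow> 0" for k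
    unfolding e_def using LIMSEQ_inverse_real_of_nat by (auto simp: inverse_eq_divide)
  define A where "A h = (\<integral>x. f x * cnj (f (x + h)) \<partial>lborel)" for h
  have [measurable]: "A \<in> borel_measurable borel"
    unfolding A_def by measurable
  note trans = square_integrable_translation[OF f2]
  have A_bound: "norm (A h) \<le> (L2_norm f)\<^sup>2" for h
    using L2_inner_bound[OF f2 square_integrable_cnj[OF trans[of h]]]
    unfolding A_def L2_norm_cnj L2_norm_translation by (simp add: power2_eq_square)
  have A_lim: "(\<lambda>k. A (h k)) \<longlonglongrightarrow> complex_of_real ((L2_norm f)\<^sup>2)" if h: "h \<longlonglongrightarrow> 0" for h
  proof -
    have A0: "A 0 = complex_of_real ((L2_norm f)\<^sup>2)"
      unfolding A_def L2_norm_power2 add_0_right complex_norm_square[symmetric] by (rule integral_complex_of_real)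
    have "norm (A (h k) - A 0) \<le> L2_norm f * L2_norm (\<lambda>x. f (x + h k) - f x)" for k
    proof -
      have d: "square_integrable (\<lambda>x. f (x + h k) - f x)"
        by (intro square_integrable_diff trans f2)
      have "A (h k) - A 0 = (\<integral>x. f x * cnj (f (x + h k)) - f x * cnj (f x) \<partial>lborel)"
        unfolding A_def add_0_right
        by (intro Bochner_Integration.integral_diff[symmetric] square_integrable_mult_integrable f2 square_integrable_cnj trans)
      also have "\<dots> = (\<integral>x. f x * cnj (f (x + h k) - f x) \<partial>lborel)"
        by (simp add: algebra_simps)
      finally show ?thesis
        using L2_inner_bound[OF f2 square_integrable_cnj[OF d]] by (simp only: L2_norm_cnj)
    qed
    then have "(\<lambda>k. A (h k) - A 0) \<longlonglongrightarrow> 0"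
      by (intro Lim_null_comparison[OF always_eventually tendsto_mult_right_zero[OF L2_norm_translation_tendsto[OF f2 h]]] allI)
    then show ?thesis unfolding A0 by (rule LIM_zero_cancel)
  qed
  define I where "I k = (\<integral>\<xi>. (norm (fourier_integral f \<xi>))\<^sup>2 * gaussian (e k *\<^sub>R \<xi>) \<partial>lborel)" for k
  have int_I: "integrable lborel (\<lambda>\<xi>. (norm (fourier_integral f \<xi>))\<^sup>2 * gaussian (e k *\<^sub>R \<xi>))" for k
  proof (rule Bochner_Integration.integrable_bound)
    have "integrable lborel (\<lambda>\<xi>::real ^ 'n. gaussian (e k *\<^sub>R \<xi>))"
      using fourier_integral_gaussian_scaled(1)[OF e(1)[of k]] by (simp add: complex_of_real_integrable_eq)
    then show "integrable lborel (\<lambda>\<xi>::real ^ 'n. (\<integral>x. norm (f x) \<partial>lborel)\<^sup>2 * gaussian (e k *\<^sub>R \<xi>))"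
      by simp
    show "AE \<xi> in lborel. norm ((norm (fourier_integral f \<xi>))\<^sup>2 * gaussian (e k *\<^sub>R \<xi>))
        \<le> norm ((\<integral>x. norm (f x) \<partial>lborel)\<^sup>2 * gaussian (e k *\<^sub>R \<xi>))"
      by (intro AE_I2) (auto simp: abs_mult gaussian_nonneg intro!: mult_right_mono power_mono fourier_integral_bound)
  qed measurable
  have I_eq: "complex_of_real (I k) = complex_of_real c * (\<integral>z. complex_of_real (gaussian z) * A (e k *\<^sub>R z) \<partial>lborel)" for k
  proof -
    have "complex_of_real (I k) =
        (\<integral>\<xi>. fourier_integral f \<xi> * (cnj (fourier_integral f \<xi>) * complex_of_real (gaussian (e k *\<^sub>R \<xi>))) \<partial>lborel)"
      unfolding I_def integral_complex_of_real[symmetric] mult.assoc[symmetric] complex_norm_square[symmetric] by simp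
    then show ?thesis
      by (simp add: plancherel_regularized[OF f1 f2 e(1)] c_def A_def)
  qed
  have avg_lim: "(\<lambda>k. \<integral>z. complex_of_real (gaussian z) * A (e k *\<^sub>R z) \<partial>lborel) \<longlonglongrightarrow>
      (\<integral>z. complex_of_real (gaussian (z :: real ^ 'n)) * complex_of_real ((L2_norm f)\<^sup>2) \<partial>lborel)"
  proof (rule integral_dominated_convergence[where w="\<lambda>z. gaussian z * (L2_norm f)\<^sup>2"])
    show "integrable lborel (\<lambda>z :: real ^ 'n. gaussian z * (L2_norm f)\<^sup>2)"
      by (intro integrable_mult_left integral_gaussian)
    show "AE z in lborel. (\<lambda>k. complex_of_real (gaussian z) * A (e k *\<^sub>R z)) \<longlonglongrightarrow> complex_of_real (gaussian z) * complex_of_real ((L2_norm f)\<^sup>2)"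
      by (intro AE_I2 tendsto_intros A_lim) (auto intro!: tendsto_eq_intros e)
    show "AE z in lborel. norm (complex_of_real (gaussian z) * A (e k *\<^sub>R z)) \<le> gaussian z * (L2_norm f)\<^sup>2" for k
      by (auto simp: norm_mult gaussian_nonneg intro!: mult_left_mono A_bound)
  qed measurable
  have avg_eq: "(\<integral>z. complex_of_real (gaussian (z :: real ^ 'n)) * complex_of_real ((L2_norm f)\<^sup>2) \<partial>lborel) =
      complex_of_real (c * (L2_norm f)\<^sup>2)"
    unfolding of_real_mult[symmetric] integral_complex_of_real c_def integral_mult_left_zero integral_gaussian(2) ..
  have "(\<lambda>k. complex_of_real (I k)) \<longlonglongrightarrow> complex_of_real c * complex_of_real (c * (L2_norm f)\<^sup>2)"
    unfolding I_eq by (intro tendsto_mult_left avg_lim[unfolded avg_eq])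
  then have I_lim: "I \<longlonglongrightarrow> (c * L2_norm f)\<^sup>2"
    unfolding of_real_mult[symmetric] tendsto_of_real_iff by (simp add: power2_eq_square mult_ac)
  have G_lim: "(\<lambda>k. (norm (fourier_integral f \<xi>))\<^sup>2 * gaussian (e k *\<^sub>R \<xi>)) \<longlonglongrightarrow> (norm (fourier_integral f \<xi>))\<^sup>2" for \<xi>
  proof -
    have "(\<lambda>k. gaussian (e k *\<^sub>R \<xi>)) \<longlonglongrightarrow> exp (- (norm (0 *\<^sub>R \<xi>))\<^sup>2 / 2)"
      unfolding gaussian_def by (intro tendsto_intros e) auto
    from tendsto_mult_left[OF this, of "(norm (fourier_integral f \<xi>))\<^sup>2"] show ?thesis by simp
  qed
  have "(\<integral>\<^sup>+\<xi>. ennreal ((norm (fourier_integral f \<xi>))\<^sup>2) \<partial>lborel) =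
      (\<integral>\<^sup>+\<xi>. liminf (\<lambda>k. ennreal ((norm (fourier_integral f \<xi>))\<^sup>2 * gaussian (e k *\<^sub>R \<xi>))) \<partial>lborel)"
    by (intro nn_integral_cong lim_imp_Liminf[symmetric] tendsto_ennrealI G_lim) auto
  also have "\<dots> \<le> liminf (\<lambda>k. \<integral>\<^sup>+\<xi>. ennreal ((norm (fourier_integral f \<xi>))\<^sup>2 * gaussian (e k *\<^sub>R \<xi>)) \<partial>lborel)"
    by (rule nn_integral_liminf) measurable
  also have "(\<lambda>k. \<integral>\<^sup>+\<xi>. ennreal ((norm (fourier_integral f \<xi>))\<^sup>2 * gaussian (e k *\<^sub>R \<xi>)) \<partial>lborel) = (\<lambda>k. ennreal (I k))"
    unfolding I_def by (intro ext nn_integral_eq_integral int_I) (simp add: gaussian_nonneg)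
  also have "liminf (\<lambda>k. ennreal (I k)) = ennreal ((c * L2_norm f)\<^sup>2)"
    by (intro lim_imp_Liminf tendsto_ennrealI I_lim) simp
  finally show sq: "square_integrable (fourier_integral f)"
    using square_integrableI_nn_integral[of "fourier_integral f" "c * L2_norm f"] c by (simp add: L2_norm_nonneg)
  have "I \<longlonglongrightarrow> (L2_norm (fourier_integral f))\<^sup>2"
    unfolding I_def L2_norm_power2
  proof (rule integral_dominated_convergence[where w="\<lambda>\<xi>. (norm (fourier_integral f \<xi>))\<^sup>2"])
    show "integrable lborel (\<lambda>\<xi>. (norm (fourier_integral f \<xi>))\<^sup>2)"
      using sq by (simp add: square_integrable_def)
    show "AE \<xi> in lborel. norm ((norm (fourier_integral f \<xi>))\<^sup>2 * gaussian (e k *\<^sub>R \<xi>)) \<le> (norm (fourier_integral f \<xi>))\<^sup>2" for k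
      by (intro AE_I2) (auto simp: abs_mult gaussian_nonneg gaussian_le_1 intro!: mult_left_le)
  qed (use G_lim in auto)
  with I_lim have "(L2_norm (fourier_integral f))\<^sup>2 = (c * L2_norm f)\<^sup>2"
    using LIMSEQ_unique by blast
  then show "L2_norm (fourier_integral f) = sqrt (2 * pi) ^ CARD('n) * L2_norm f"
    using c by (simp add: c_def L2_norm_nonneg)
qed

section \<open>The Fourier transform on square integrable functions\<close>

lemma is_L2_fourier_square_integrable:
  "is_L2_fourier f g \<Longrightarrow> square_integrable f" "is_L2_fourier f g \<Longrightarrow> square_integrable g"
  by (auto simp: is_L2_fourier_def)

definition fourier_approximation ::
    "(nat \<Rightarrow> real ^ 'n \<Rightarrow> complex) \<Rightarrow> (real ^ 'n \<Rightarrow> complex) \<Rightarrow> (real ^ 'n \<Rightarrow> complex) \<Rightarrow> bool" where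
  "fourier_approximation \<phi> f g \<longleftrightarrow>
    (\<forall>k. integrable lborel (\<phi> k) \<and> square_integrable (\<phi> k) \<and> square_integrable (fourier_integral (\<phi> k))) \<and>
    (\<lambda>k. L2_norm (\<lambda>x. \<phi> k x - f x)) \<longlonglongrightarrow> 0 \<and>
    (\<lambda>k. L2_norm (\<lambda>\<xi>. fourier_integral (\<phi> k) \<xi> - g \<xi>)) \<longlonglongrightarrow> 0"

lemma fourier_approximationD:
  assumes "fourier_approximation \<phi> f g"
  shows "\<And>k. integrable lborel (\<phi> k)" "\<And>k. square_integrable (\<phi> k)"
    "\<And>k. square_integrable (fourier_integral (\<phi> k))"
    "(\<lambda>k. L2_norm (\<lambda>x. \<phi> k x - f x)) \<longlonglongrightarrow> 0"
    "(\<lambda>k. L2_norm (\<lambda>\<xi>. fourier_integral (\<phi> k) \<xi> - g \<xi>)) \<longlonglongrightarrow> 0"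
  using assms by (auto simp: fourier_approximation_def)

lemma is_L2_fourier_approximation:
  "is_L2_fourier f g \<longleftrightarrow> square_integrable f \<and> square_integrable g \<and> (\<exists>\<phi>. fourier_approximation \<phi> f g)"
  by (simp add: is_L2_fourier_def fourier_approximation_def)

lemma is_L2_fourier_limit:
  assumes "is_L2_fourier f g"
  obtains \<phi> where "fourier_approximation \<phi> f g"
  using assms by (auto simp: is_L2_fourier_approximation)

lemma is_L2_fourier_integrable:
  fixes f :: "real ^ 'n \<Rightarrow> complex"
  assumes "integrable lborel f" "square_integrable f"
  shows "is_L2_fourier f (fourier_integral f)"
  unfolding is_L2_fourier_def using assms plancherel_integrable(1)[OF assms]
  by (auto intro!: exI[of _ "\<lambda>_. f"] simp: L2_norm_def)

lemma is_L2_fourier_norm: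
  fixes f :: "real ^ 'n \<Rightarrow> complex"
  assumes "is_L2_fourier f g"
  shows "L2_norm g = sqrt (2 * pi) ^ CARD('n) * L2_norm f"
proof -
  obtain \<phi> where "fourier_approximation \<phi> f g" using is_L2_fourier_limit[OF assms] .
  note \<phi> = fourier_approximationD[OF this]
  note lim = \<phi>(4,5)
  note fg = is_L2_fourier_square_integrable[OF assms]
  have "(\<lambda>k. L2_norm (fourier_integral (\<phi> k))) \<longlonglongrightarrow> sqrt (2 * pi) ^ CARD('n) * L2_norm f"
    unfolding plancherel_integrable(2)[OF \<phi>(1,2)]
    by (intro tendsto_mult_left L2_norm_tendsto \<phi> fg lim)
  moreover have "(\<lambda>k. L2_norm (fourier_integral (\<phi> k))) \<longlonglongrightarrow> L2_norm g"
    by (intro L2_norm_tendsto \<phi> fg lim)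
  ultimately show ?thesis using LIMSEQ_unique by blast
qed

lemma is_L2_fourier_add:
  fixes f :: "real ^ 'n \<Rightarrow> complex"
  assumes "is_L2_fourier f g" "is_L2_fourier f' g'"
  shows "is_L2_fourier (\<lambda>x. f x + f' x) (\<lambda>\<xi>. g \<xi> + g' \<xi>)"
proof -
  obtain \<phi> where "fourier_approximation \<phi> f g" using is_L2_fourier_limit[OF assms(1)] .
  note \<phi> = fourier_approximationD[OF this]
  note lim = \<phi>(4,5)
  obtain \<psi> where "fourier_approximation \<psi> f' g'" using is_L2_fourier_limit[OF assms(2)] .
  note \<psi> = fourier_approximationD[OF this]
  note lim' = \<psi>(4,5)
  note fg = is_L2_fourier_square_integrable[OF assms(1)] is_L2_fourier_square_integrable[OF assms(2)]
  have sum_lim: "(\<lambda>k. L2_norm (\<lambda>x. (a k x + a' k x) - (b x + b' x))) \<longlonglongrightarrow> 0"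
    if "(\<lambda>k. L2_norm (\<lambda>x. a k x - b x)) \<longlonglongrightarrow> 0" "(\<lambda>k. L2_norm (\<lambda>x. a' k x - b' x)) \<longlonglongrightarrow> 0"
      "\<And>k. square_integrable (a k)" "\<And>k. square_integrable (a' k)" "square_integrable b" "square_integrable b'"
    for a a' :: "nat \<Rightarrow> real ^ 'n \<Rightarrow> complex" and b b'
  proof (rule Lim_null_comparison[where g="\<lambda>k. L2_norm (\<lambda>x. a k x - b x) + L2_norm (\<lambda>x. a' k x - b' x)"])
    have "L2_norm (\<lambda>x. (a k x + a' k x) - (b x + b' x)) \<le> L2_norm (\<lambda>x. a k x - b x) + L2_norm (\<lambda>x. a' k x - b' x)" for k
      using L2_norm_triangle[OF square_integrable_diff[OF that(3,5), of k] square_integrable_diff[OF that(4,6), of k]]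
      by (simp add: add_diff_add)
    then show "\<forall>\<^sub>F k in sequentially. norm (L2_norm (\<lambda>x. (a k x + a' k x) - (b x + b' x)))
        \<le> L2_norm (\<lambda>x. a k x - b x) + L2_norm (\<lambda>x. a' k x - b' x)"
      by (simp add: L2_norm_nonneg)
    show "(\<lambda>k. L2_norm (\<lambda>x. a k x - b x) + L2_norm (\<lambda>x. a' k x - b' x)) \<longlonglongrightarrow> 0"
      using tendsto_add[OF that(1,2)] by simp
  qed
  have F: "fourier_integral (\<lambda>x. \<phi> k x + \<psi> k x) = (\<lambda>\<xi>. fourier_integral (\<phi> k) \<xi> + fourier_integral (\<psi> k) \<xi>)" for k
    by (intro ext fourier_integral_add \<phi> \<psi>)
  show ?thesis
    unfolding is_L2_fourier_def
  proof (intro conjI exI[of _ "\<lambda>k x. \<phi> k x + \<psi> k x"] allI)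
    show "integrable lborel (\<lambda>x. \<phi> k x + \<psi> k x)" for k
      by (intro Bochner_Integration.integrable_add \<phi> \<psi>)
    show "square_integrable (\<lambda>x. \<phi> k x + \<psi> k x)" for k
      by (intro square_integrable_add \<phi> \<psi>)
    show "square_integrable (fourier_integral (\<lambda>x. \<phi> k x + \<psi> k x))" for k
      unfolding F by (intro square_integrable_add \<phi> \<psi>)
    show "(\<lambda>k. L2_norm (\<lambda>x. \<phi> k x + \<psi> k x - (f x + f' x))) \<longlonglongrightarrow> 0"
      by (intro sum_lim lim lim' \<phi> \<psi> fg)
    show "(\<lambda>k. L2_norm (\<lambda>\<xi>. fourier_integral (\<lambda>x. \<phi> k x + \<psi> k x) \<xi> - (g \<xi> + g' \<xi>))) \<longlonglongrightarrow> 0"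
      unfolding F by (intro sum_lim lim lim' \<phi> \<psi> fg)
  qed (intro square_integrable_add fg)+
qed

lemma is_L2_fourier_cmult:
  fixes f :: "real ^ 'n \<Rightarrow> complex"
  assumes "is_L2_fourier f g"
  shows "is_L2_fourier (\<lambda>x. c * f x) (\<lambda>\<xi>. c * g \<xi>)"
proof -
  obtain \<phi> where "fourier_approximation \<phi> f g" using is_L2_fourier_limit[OF assms] .
  note \<phi> = fourier_approximationD[OF this]
  note lim = \<phi>(4,5)
  note fg = is_L2_fourier_square_integrable[OF assms]
  have F: "fourier_integral (\<lambda>x. c * \<phi> k x) = (\<lambda>\<xi>. c * fourier_integral (\<phi> k) \<xi>)" for k
    by (intro ext fourier_integral_cmult)
  show ?thesis
    unfolding is_L2_fourier_def
  proof (intro conjI exI[of _ "\<lambda>k x. c * \<phi> k x"] allI)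
    show "integrable lborel (\<lambda>x. c * \<phi> k x)" for k
      using \<phi>(1) by simp
    show "(\<lambda>k. L2_norm (\<lambda>x. c * \<phi> k x - c * f x)) \<longlonglongrightarrow> 0"
      using tendsto_mult_right_zero[OF lim(1), of "norm c"]
      by (simp only: L2_norm_cmult right_diff_distrib[symmetric])
    show "(\<lambda>k. L2_norm (\<lambda>\<xi>. fourier_integral (\<lambda>x. c * \<phi> k x) \<xi> - c * g \<xi>)) \<longlonglongrightarrow> 0"
      unfolding F using tendsto_mult_right_zero[OF lim(2), of "norm c"]
      by (simp only: L2_norm_cmult right_diff_distrib[symmetric])
    show "square_integrable (\<lambda>x. c * \<phi> k x)" for k
      by (intro square_integrable_cmult \<phi>)
    show "square_integrable (fourier_integral (\<lambda>x. c * \<phi> k x))" for k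
      unfolding F by (intro square_integrable_cmult \<phi>)
  qed (intro square_integrable_cmult fg)+
qed

lemma is_L2_fourier_diff:
  fixes f :: "real ^ 'n \<Rightarrow> complex"
  assumes "is_L2_fourier f g" "is_L2_fourier f' g'"
  shows "is_L2_fourier (\<lambda>x. f x - f' x) (\<lambda>\<xi>. g \<xi> - g' \<xi>)"
  using is_L2_fourier_add[OF assms(1) is_L2_fourier_cmult[OF assms(2), of "-1"]] by simp

lemma is_L2_fourier_unique:
  fixes f :: "real ^ 'n \<Rightarrow> complex"
  assumes "is_L2_fourier f g" "is_L2_fourier f g'"
  shows "AE \<xi> in lborel. g \<xi> = g' \<xi>"
proof -
  have *: "is_L2_fourier (\<lambda>x. f x - f x) (\<lambda>\<xi>. g \<xi> - g' \<xi>)"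
    by (rule is_L2_fourier_diff[OF assms])
  have "L2_norm (\<lambda>\<xi>. g \<xi> - g' \<xi>) = 0"
    using is_L2_fourier_norm[OF *] by (simp add: L2_norm_def)
  from L2_norm_zero_AE[OF is_L2_fourier_square_integrable(2)[OF *] this]
  show ?thesis by eventually_elim simp
qed

text \<open>The transform is only determined up to null sets, so any measurable version serves as well.\<close>

lemma is_L2_fourier_cong_AE:
  fixes f :: "real ^ 'n \<Rightarrow> complex"
  assumes fg: "is_L2_fourier f g" and [measurable]: "g' \<in> borel_measurable borel"
    and ae: "AE \<xi> in lborel. g \<xi> = g' \<xi>"
  shows "is_L2_fourier f g'"
proof -
  note sq = is_L2_fourier_square_integrable[OF fg]
  note [measurable] = square_integrable_measurable[OF sq(2)]
  have g': "square_integrable g'"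
    by (rule square_integrable_bound[OF sq(2)]) (use ae in \<open>auto elim: eventually_mono\<close>)
  have "L2_norm (\<lambda>\<xi>. h \<xi> - g \<xi>) = L2_norm (\<lambda>\<xi>. h \<xi> - g' \<xi>)" if "square_integrable h" for h
  proof -
    note [measurable] = square_integrable_measurable[OF that]
    show ?thesis
      by (rule L2_norm_cong_AE) (use ae in \<open>auto elim: eventually_mono\<close>)
  qed
  note norm_eq = this
  obtain \<phi> where "fourier_approximation \<phi> f g" using is_L2_fourier_limit[OF fg] .
  note \<phi> = fourier_approximationD[OF this]
  have "(\<lambda>k. L2_norm (\<lambda>\<xi>. fourier_integral (\<phi> k) \<xi> - g' \<xi>)) \<longlonglongrightarrow> 0"
    using \<phi>(5) unfolding norm_eq[OF \<phi>(3)] .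
  then show ?thesis
    unfolding is_L2_fourier_def using sq g' \<phi>(1-4) by blast
qed

text \<open>The transforms of the cut-offs of \<open>f\<close> form a Cauchy sequence because the transform is a multiple
  of an isometry on them.\<close>

lemma is_L2_fourier_exists:
  fixes f :: "real ^ 'n \<Rightarrow> complex"
  assumes f: "square_integrable f"
  shows "\<exists>g. is_L2_fourier f g"
proof -
  define \<phi> where "\<phi> k x = (if norm x \<le> real k then f x else 0)" for k x
  have \<phi>: "integrable lborel (\<phi> k)" "square_integrable (\<phi> k)" for k
    unfolding \<phi>_def by (rule integrable_square_integrable_cutoff[OF f])+
  have lim: "(\<lambda>k. L2_norm (\<lambda>x. \<phi> k x - f x)) \<longlonglongrightarrow> 0"
    unfolding \<phi>_def by (rule L2_norm_cutoff_tendsto[OF f])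
  define c where "c = sqrt (2 * pi) ^ CARD('n)"
  have c: "c > 0" by (simp add: c_def)
  have F: "is_L2_fourier (\<phi> k) (fourier_integral (\<phi> k))" for k
    by (intro is_L2_fourier_integrable \<phi>)
  have "\<exists>G. square_integrable G \<and> (\<lambda>k. L2_norm (\<lambda>x. fourier_integral (\<phi> k) x - G x)) \<longlonglongrightarrow> 0"
  proof (rule square_integrable_complete)
    show "square_integrable (fourier_integral (\<phi> k))" for k
      by (intro plancherel_integrable \<phi>)
    fix e :: real assume "e > 0"
    then have "e / (2 * c) > 0" using c by simp
    then have "\<forall>\<^sub>F k in sequentially. L2_norm (\<lambda>x. \<phi> k x - f x) < e / (2 * c)"
      using lim by (intro order_tendstoD)
    then obtain N where N: "\<And>k. k \<ge> N \<Longrightarrow> L2_norm (\<lambda>x. \<phi> k x - f x) < e / (2 * c)"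
      unfolding eventually_sequentially by auto
    have "L2_norm (\<lambda>x. fourier_integral (\<phi> m) x - fourier_integral (\<phi> k) x) < e" if "m \<ge> N" "k \<ge> N" for m k
    proof -
      have "L2_norm (\<lambda>x. \<phi> m x - \<phi> k x) \<le> L2_norm (\<lambda>x. \<phi> m x - f x) + L2_norm (\<lambda>x. f x - \<phi> k x)"
        by (intro L2_norm_triangle_diff \<phi> f)
      also have "\<dots> < e / c"
        using N[OF that(1)] N[OF that(2)] by (simp add: L2_norm_minus_commute[of f])
      finally have "c * L2_norm (\<lambda>x. \<phi> m x - \<phi> k x) < e"
        using c by (simp add: field_simps)
      then show ?thesis
        using is_L2_fourier_norm[OF is_L2_fourier_diff[OF F F], of m k] by (simp add: c_def)
    qed
    then show "\<exists>N. \<forall>m\<ge>N. \<forall>k\<ge>N. L2_norm (\<lambda>x. fourier_integral (\<phi> m) x - fourier_integral (\<phi> k) x) < e"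
      by blast
  qed
  then obtain G where "square_integrable G" "(\<lambda>k. L2_norm (\<lambda>x. fourier_integral (\<phi> k) x - G x)) \<longlonglongrightarrow> 0"
    by blast
  then have "is_L2_fourier f G"
    unfolding is_L2_fourier_def using f \<phi> lim plancherel_integrable(1)[OF \<phi>] by blast
  then show ?thesis by blast
qed

lemma is_L2_fourier_fourier:
  fixes f :: "real ^ 'n \<Rightarrow> complex"
  assumes f: "square_integrable f"
  shows "is_L2_fourier f (fourier f)"
proof (cases "integrable lborel f")
  case True
  then show ?thesis using is_L2_fourier_integrable[OF True f] by (simp add: fourier_def)
next
  case False
  then show ?thesis using someI_ex[OF is_L2_fourier_exists[OF f]] by (simp add: fourier_def)
qed

lemma L2_inner_tendsto:
  fixes f g :: "real ^ 'n \<Rightarrow> complex"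
  assumes a: "\<And>k. square_integrable (a k)" and b: "\<And>k. square_integrable (b k)"
    and f: "square_integrable f" and g: "square_integrable g"
    and al: "(\<lambda>k. L2_norm (\<lambda>x. a k x - f x)) \<longlonglongrightarrow> 0" and bl: "(\<lambda>k. L2_norm (\<lambda>x. b k x - g x)) \<longlonglongrightarrow> 0"
  shows "(\<lambda>k. \<integral>x. a k x * b k x \<partial>lborel) \<longlonglongrightarrow> (\<integral>x. f x * g x \<partial>lborel)"
proof (rule LIM_zero_cancel, rule Lim_null_comparison)
  have "norm ((\<integral>x. a k x * b k x \<partial>lborel) - (\<integral>x. f x * g x \<partial>lborel)) \<le>
      L2_norm (\<lambda>x. a k x - f x) * L2_norm (b k) + L2_norm f * L2_norm (\<lambda>x. b k x - g x)" for k
  proof -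
    have "(\<integral>x. a k x * b k x \<partial>lborel) - (\<integral>x. f x * g x \<partial>lborel) = (\<integral>x. a k x * b k x - f x * g x \<partial>lborel)"
      by (intro Bochner_Integration.integral_diff[symmetric] square_integrable_mult_integrable a b f g)
    also have "\<dots> = (\<integral>x. (a k x - f x) * b k x + f x * (b k x - g x) \<partial>lborel)"
      by (intro Bochner_Integration.integral_cong) (auto simp: algebra_simps)
    also have "\<dots> = (\<integral>x. (a k x - f x) * b k x \<partial>lborel) + (\<integral>x. f x * (b k x - g x) \<partial>lborel)"
      by (intro Bochner_Integration.integral_add square_integrable_mult_integrable square_integrable_diff a b f g)
    finally have eq: "(\<integral>x. a k x * b k x \<partial>lborel) - (\<integral>x. f x * g x \<partial>lborel) =
        (\<integral>x. (a k x - f x) * b k x \<partial>lborel) + (\<integral>x. f x * (b k x - g x) \<partial>lborel)" .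
    show ?thesis
      unfolding eq
      using L2_inner_bound[OF square_integrable_diff[OF a f] b, of k k] L2_inner_bound[OF f square_integrable_diff[OF b g], of k]
        norm_triangle_ineq[of "\<integral>x. (a k x - f x) * b k x \<partial>lborel" "\<integral>x. f x * (b k x - g x) \<partial>lborel"] by linarith
  qed
  then show "\<forall>\<^sub>F k in sequentially. norm ((\<integral>x. a k x * b k x \<partial>lborel) - (\<integral>x. f x * g x \<partial>lborel)) \<le>
      L2_norm (\<lambda>x. a k x - f x) * L2_norm (b k) + L2_norm f * L2_norm (\<lambda>x. b k x - g x)" by simp
  have "(\<lambda>k. L2_norm (\<lambda>x. a k x - f x) * L2_norm (b k) + L2_norm f * L2_norm (\<lambda>x. b k x - g x))
      \<longlonglongrightarrow> 0 * L2_norm g + L2_norm f * 0"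
    by (intro tendsto_intros al bl L2_norm_tendsto[OF b g bl])
  then show "(\<lambda>k. L2_norm (\<lambda>x. a k x - f x) * L2_norm (b k) + L2_norm f * L2_norm (\<lambda>x. b k x - g x)) \<longlonglongrightarrow> 0"
    by simp
qed

lemma is_L2_fourier_multiplication_formula:
  fixes f h :: "real ^ 'n \<Rightarrow> complex"
  assumes ff: "is_L2_fourier f f'" and hh: "is_L2_fourier h h'"
  shows "(\<integral>x. f' x * h x \<partial>lborel) = (\<integral>x. f x * h' x \<partial>lborel)"
proof -
  note sq = is_L2_fourier_square_integrable[OF ff] is_L2_fourier_square_integrable[OF hh]
  obtain \<phi> where "fourier_approximation \<phi> f f'" using is_L2_fourier_limit[OF ff] .
  note \<phi> = fourier_approximationD[OF this]
  obtain \<psi> where "fourier_approximation \<psi> h h'" using is_L2_fourier_limit[OF hh] .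
  note \<psi> = fourier_approximationD[OF this]
  have "(\<lambda>k. \<integral>x. fourier_integral (\<phi> k) x * \<psi> k x \<partial>lborel) \<longlonglongrightarrow> (\<integral>x. f' x * h x \<partial>lborel)"
    by (intro L2_inner_tendsto \<phi> \<psi> sq)
  moreover have "(\<lambda>k. \<integral>x. fourier_integral (\<phi> k) x * \<psi> k x \<partial>lborel) \<longlonglongrightarrow> (\<integral>x. f x * h' x \<partial>lborel)"
    unfolding fourier_integral_multiplication_formula[OF \<phi>(1) \<psi>(1)]
    by (intro L2_inner_tendsto \<phi> \<psi> sq)
  ultimately show ?thesis using LIMSEQ_unique by blast
qed

text \<open>The adjoint of the Fourier transform \<open>F\<close> is \<open>g \<mapsto> cnj (F (cnj g))\<close>, and both are
  multiples of isometries by the same constant; hence \<open>f = cnj (F (cnj g)) / (2\<pi>)\<^sup>n\<close> makes the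
  square \<open>\<bar>F f - g\<bar>\<^sup>2\<close> collapse to \<open>0\<close> when it is expanded.\<close>

lemma is_L2_fourier_surj:
  fixes g :: "real ^ 'n \<Rightarrow> complex"
  assumes g: "square_integrable g"
  shows "\<exists>f. is_L2_fourier f g"
proof -
  define c where "c = sqrt (2 * pi) ^ CARD('n)"
  have c: "c > 0" by (simp add: c_def)
  obtain h where h: "is_L2_fourier (\<lambda>x. cnj (g x)) h"
    using is_L2_fourier_exists[OF square_integrable_cnj[OF g]] by blast
  note hsq = is_L2_fourier_square_integrable(2)[OF h]
  have hnorm: "L2_norm h = c * L2_norm g"
    using is_L2_fourier_norm[OF h] by (simp add: c_def L2_norm_cnj)
  define f where "f x = complex_of_real (1 / c\<^sup>2) * cnj (h x)" for x
  have fsq: "square_integrable f"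
    unfolding f_def by (intro square_integrable_cmult square_integrable_cnj hsq)
  have "L2_norm f = \<bar>1 / c\<^sup>2\<bar> * (c * L2_norm g)"
    unfolding f_def L2_norm_cmult L2_norm_cnj hnorm norm_of_real ..
  then have fnorm: "L2_norm f = L2_norm g / c"
    using c by (simp add: power2_eq_square)
  obtain f' where f': "is_L2_fourier f f'"
    using is_L2_fourier_exists[OF fsq] by blast
  note f'sq = is_L2_fourier_square_integrable(2)[OF f']
  have f'norm: "L2_norm f' = L2_norm g"
    using is_L2_fourier_norm[OF f'] c by (simp add: fnorm c_def[symmetric])
  have "(\<integral>x. f' x * cnj (g x) \<partial>lborel) = (\<integral>x. f x * h x \<partial>lborel)"
    by (rule is_L2_fourier_multiplication_formula[OF f' h])
  also have "\<dots> = (\<integral>x. complex_of_real ((norm (h x))\<^sup>2 / c\<^sup>2) \<partial>lborel)"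
  proof (intro Bochner_Integration.integral_cong refl)
    fix x
    have "f x * h x = complex_of_real (1 / c\<^sup>2) * (h x * cnj (h x))"
      by (simp add: f_def)
    then show "f x * h x = complex_of_real ((norm (h x))\<^sup>2 / c\<^sup>2)"
      unfolding complex_norm_square[symmetric] of_real_mult[symmetric] by simp
  qed
  also have "\<dots> = complex_of_real ((L2_norm h)\<^sup>2 / c\<^sup>2)"
    unfolding integral_complex_of_real L2_norm_power2 by simp
  also have "\<dots> = complex_of_real ((L2_norm g)\<^sup>2)"
    using c by (simp add: hnorm power_mult_distrib)
  finally have inner: "(\<integral>x. f' x * cnj (g x) \<partial>lborel) = complex_of_real ((L2_norm g)\<^sup>2)" .
  have int: "integrable lborel (\<lambda>x. f' x * cnj (g x))"
    by (intro square_integrable_mult_integrable f'sq square_integrable_cnj g)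
  have "(L2_norm (\<lambda>x. f' x - g x))\<^sup>2 = (\<integral>x. (norm (f' x))\<^sup>2 + (norm (g x))\<^sup>2 - 2 * Re (f' x * cnj (g x)) \<partial>lborel)"
    unfolding L2_norm_power2
  proof (intro Bochner_Integration.integral_cong refl)
    show "(norm (f' x - g x))\<^sup>2 = (norm (f' x))\<^sup>2 + (norm (g x))\<^sup>2 - 2 * Re (f' x * cnj (g x))" for x
      unfolding cmod_power2 by (simp add: power2_eq_square algebra_simps)
  qed
  also have "\<dots> = (L2_norm f')\<^sup>2 + (L2_norm g)\<^sup>2 - 2 * (\<integral>x. Re (f' x * cnj (g x)) \<partial>lborel)"
    unfolding L2_norm_power2
    using square_integrable_integrable[OF f'sq] square_integrable_integrable[OF g] integrable_Re[OF int]
    by (simp del: times_complex.sel)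
  also have "(\<integral>x. Re (f' x * cnj (g x)) \<partial>lborel) = Re (\<integral>x. f' x * cnj (g x) \<partial>lborel)"
    by (rule integral_Re[OF int])
  also have "\<dots> = (L2_norm g)\<^sup>2" unfolding inner by simp
  finally have "(L2_norm (\<lambda>x. f' x - g x))\<^sup>2 = 0" unfolding f'norm by simp
  then have "L2_norm (\<lambda>x. f' x - g x) = 0" by simp
  from L2_norm_zero_AE[OF square_integrable_diff[OF f'sq g] this]
  have "AE x in lborel. f' x = g x" by eventually_elim simp
  from is_L2_fourier_cong_AE[OF f' square_integrable_measurable[OF g] this] show ?thesis by blast
qed

lemma is_L2_fourier_inv_fourier:
  fixes g :: "real ^ 'n \<Rightarrow> complex"
  assumes g: "square_integrable g"
  shows "is_L2_fourier (inv_fourier g) g"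
proof -
  obtain f where f: "is_L2_fourier f g" using is_L2_fourier_surj[OF g] by blast
  note fsq = is_L2_fourier_square_integrable(1)[OF f]
  have "\<exists>f. square_integrable f \<and> (AE \<xi> in lborel. fourier f \<xi> = g \<xi>)"
    using fsq is_L2_fourier_unique[OF is_L2_fourier_fourier[OF fsq] f] by blast
  from someI_ex[OF this] have *: "square_integrable (inv_fourier g)" "AE \<xi> in lborel. fourier (inv_fourier g) \<xi> = g \<xi>"
    unfolding inv_fourier_def by auto
  from is_L2_fourier_cong_AE[OF is_L2_fourier_fourier[OF *(1)] square_integrable_measurable[OF g] *(2)]
  show ?thesis .
qed

lemma fourier_AE_eq:
  fixes f :: "real ^ 'n \<Rightarrow> complex"
  assumes "is_L2_fourier f g"
  shows "AE \<xi> in lborel. fourier f \<xi> = g \<xi>"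
  by (rule is_L2_fourier_unique[OF is_L2_fourier_fourier[OF is_L2_fourier_square_integrable(1)[OF assms]] assms])

lemma is_L2_fourier_abs_D:
  fixes f :: "real ^ 'n \<Rightarrow> complex"
  assumes "is_L2_fourier f g" and "square_integrable (\<lambda>\<xi>. complex_of_real (norm \<xi> powr s) * g \<xi>)"
  shows "is_L2_fourier (abs_D s f) (\<lambda>\<xi>. complex_of_real (norm \<xi> powr s) * g \<xi>)"
proof -
  note fsq = is_L2_fourier_square_integrable[OF assms(1)]
  have F: "square_integrable (fourier f)"
    using is_L2_fourier_fourier[OF fsq(1)] is_L2_fourier_square_integrable(2) by blast
  note [measurable] = square_integrable_measurable[OF F] square_integrable_measurable[OF fsq(2)]
  have ae: "AE \<xi> in lborel. complex_of_real (norm \<xi> powr s) * fourier f \<xi> = complex_of_real (norm \<xi> powr s) * g \<xi>"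
    using fourier_AE_eq[OF assms(1)] by eventually_elim simp
  have "square_integrable (\<lambda>\<xi>. complex_of_real (norm \<xi> powr s) * fourier f \<xi>)"
    by (rule square_integrable_bound[OF assms(2)]) (measurable, use ae in \<open>auto elim: eventually_mono\<close>)
  from is_L2_fourier_inv_fourier[OF this]
  have "is_L2_fourier (abs_D s f) (\<lambda>\<xi>. complex_of_real (norm \<xi> powr s) * fourier f \<xi>)"
    by (simp add: abs_D_def)
  then show ?thesis
    by (rule is_L2_fourier_cong_AE) (measurable, use ae in simp)
qed

section \<open>Time derivatives of curves of square integrable functions\<close>

text \<open>Uniqueness makes the norm of the derivative independent of the representative chosen for it.\<close>

lemma has_L2_time_derivative_unique:
  fixes w :: "real \<Rightarrow> real ^ 'n \<Rightarrow> complex"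
  assumes w: "has_L2_time_derivative w v t" and w': "has_L2_time_derivative w v' t"
  shows "AE x in lborel. v x = v' x"
proof -
  have v: "square_integrable v" "square_integrable v'"
    using w w' by (auto simp: has_L2_time_derivative_def)
  define Q where "Q h x = (w (t + h) x - w t x) /\<^sub>R h" for h x
  have sq: "\<forall>\<^sub>F h in nhds 0. square_integrable (w (t + h))"
    using w by (simp add: has_L2_time_derivative_def)
  then have "square_integrable (w (t + 0))" by (rule eventually_nhds_x_imp_x)
  then have wt: "square_integrable (w t)" by simp
  have "\<forall>\<^sub>F h in at 0. square_integrable (w (t + h))"
    using sq unfolding eventually_at_filter by (auto elim: eventually_mono)
  then have "\<forall>\<^sub>F h in at 0. square_integrable (Q h)"
  proof eventually_elim
    fix h assume "square_integrable (w (t + h))"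
    from square_integrable_cmult[OF square_integrable_diff[OF this wt], of "complex_of_real (inverse h)"]
    moreover have "Q h = (\<lambda>x. complex_of_real (inverse h) * (w (t + h) x - w t x))"
      by (simp add: Q_def scaleR_conv_of_real fun_eq_iff)
    ultimately show "square_integrable (Q h)" by simp
  qed
  then have "\<forall>\<^sub>F h in at 0. L2_norm (\<lambda>x. v x - v' x) \<le> L2_norm (\<lambda>x. Q h x - v x) + L2_norm (\<lambda>x. Q h x - v' x)"
  proof eventually_elim
    case (elim h)
    show ?case
      using L2_norm_triangle_diff[OF v(1) elim v(2)] by (simp add: L2_norm_minus_commute[of v])
  qed
  moreover have "((\<lambda>h. L2_norm (\<lambda>x. Q h x - v x) + L2_norm (\<lambda>x. Q h x - v' x)) \<longlongrightarrow> 0 + 0) (at 0)"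
    by (intro tendsto_add) (use w w' in \<open>auto simp: has_L2_time_derivative_def Q_def\<close>)
  ultimately have "L2_norm (\<lambda>x. v x - v' x) \<le> 0 + 0"
    by (intro tendsto_lowerbound[where F="at 0"]) auto
  then have "L2_norm (\<lambda>x. v x - v' x) = 0" using L2_norm_nonneg[of "\<lambda>x. v x - v' x"] by linarith
  from L2_norm_zero_AE[OF square_integrable_diff[OF v] this] show ?thesis
    by eventually_elim simp
qed

lemma L2_norm_time_deriv:
  fixes w :: "real \<Rightarrow> real ^ 'n \<Rightarrow> complex"
  assumes v: "has_L2_time_derivative w v t"
  shows "L2_norm (L2_time_deriv w t) = L2_norm v"
proof -
  have d: "has_L2_time_derivative w (L2_time_deriv w t) t"
    unfolding L2_time_deriv_def by (rule someI[of _ v]) (rule v)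
  have "square_integrable v" "square_integrable (L2_time_deriv w t)"
    using v d by (auto simp: has_L2_time_derivative_def)
  then show ?thesis
    using has_L2_time_derivative_unique[OF d v]
    by (intro L2_norm_cong_AE square_integrable_measurable) (auto elim: eventually_mono)
qed

text \<open>A curve of square integrable functions is differentiable in the mean when its Fourier
  transform is differentiable in time at almost every frequency, with a derivative that is
  dominated uniformly in time by a square integrable function: the mean value inequality then
  dominates the difference quotients. The transforms \<open>F \<tau>\<close> agree with \<open>G \<tau>\<close> outside null sets that
  may depend on \<open>\<tau>\<close>, which is why the limit is taken along sequences of increments.\<close>

lemma has_L2_time_derivative_fourier:
  fixes w :: "real \<Rightarrow> real ^ 'n \<Rightarrow> complex" and G G' :: "real \<Rightarrow> real ^ 'n \<Rightarrow> complex"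
  assumes a: "a < t"
    and w: "\<And>\<tau>. \<tau> > a \<Longrightarrow> is_L2_fourier (w \<tau>) (F \<tau>)"
    and FG: "\<And>\<tau>. \<tau> > a \<Longrightarrow> AE \<xi> in lborel. F \<tau> \<xi> = G \<tau> \<xi>"
    and deriv: "AE \<xi> in lborel. \<forall>\<tau>>a. ((\<lambda>\<tau>. G \<tau> \<xi>) has_vector_derivative G' \<tau> \<xi>) (at \<tau>) \<and> norm (G' \<tau> \<xi>) \<le> norm (D \<xi>)"
    and D: "square_integrable D"
    and g: "g \<in> borel_measurable borel" "AE \<xi> in lborel. g \<xi> = G' t \<xi>"
  shows "square_integrable g" "has_L2_time_derivative w (inv_fourier g) t"
proof -
  show gsq: "square_integrable g"
  proof (rule square_integrable_bound[OF D g(1)])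
    show "AE \<xi> in lborel. norm (g \<xi>) \<le> norm (D \<xi>)"
      using g(2) deriv by eventually_elim (use a in auto)
  qed
  note inv = is_L2_fourier_inv_fourier[OF gsq]
  have Fsq: "square_integrable (F \<tau>)" if "\<tau> > a" for \<tau>
    using is_L2_fourier_square_integrable(2)[OF w[OF that]] .
  define c where "c = sqrt (2 * pi) ^ CARD('n)"
  have c: "c > 0" by (simp add: c_def)
  define Q where "Q h \<xi> = complex_of_real (inverse h) * (F (t + h) \<xi> - F t \<xi>) - g \<xi>" for h \<xi>
  have Q: "is_L2_fourier (\<lambda>x. (w (t + h) x - w t x) /\<^sub>R h - inv_fourier g x) (Q h)" if "t + h > a" for h
    unfolding Q_def scaleR_conv_of_real
    by (intro is_L2_fourier_diff is_L2_fourier_cmult inv w that a)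
  have Q_lim: "(\<lambda>k. L2_norm (Q (h k))) \<longlonglongrightarrow> 0"
    if h: "h \<longlonglongrightarrow> 0" "\<And>k. h k \<noteq> 0" "\<And>k. t + h k > a" for h :: "nat \<Rightarrow> real"
  proof (rule L2_norm_dominated_convergence[OF _ square_integrable_cmult[OF D, of 2]])
    show "Q (h k) \<in> borel_measurable borel" for k
      by (rule square_integrable_measurable[OF is_L2_fourier_square_integrable(2)[OF Q[OF h(3)]]])
    have FGk: "AE \<xi> in lborel. \<forall>k. F (t + h k) \<xi> = G (t + h k) \<xi>"
      using FG[OF h(3)] by (subst AE_all_countable) auto
    have FGt: "AE \<xi> in lborel. F t \<xi> = G t \<xi>" using FG[OF a] .
    show "AE \<xi> in lborel. (\<lambda>k. Q (h k) \<xi>) \<longlonglongrightarrow> 0"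
      using FGk FGt deriv g(2)
    proof eventually_elim
      case (elim \<xi>)
      have "((\<lambda>y. norm (G (t + y) \<xi> - G t \<xi> - y *\<^sub>R G' t \<xi>) / norm y) \<longlongrightarrow> 0) (at 0)"
        using elim(3) a unfolding has_vector_derivative_def has_derivative_at by blast
      moreover have "filterlim h (at 0) sequentially"
        using h by (simp add: filterlim_at)
      ultimately have "(\<lambda>k. norm (G (t + h k) \<xi> - G t \<xi> - h k *\<^sub>R G' t \<xi>) / norm (h k)) \<longlonglongrightarrow> 0"
        by (rule filterlim_compose)
      moreover have "norm (G (t + h k) \<xi> - G t \<xi> - h k *\<^sub>R G' t \<xi>) / norm (h k) = norm (Q (h k) \<xi>)" for k
      proof -
        have "Q (h k) \<xi> = inverse (h k) *\<^sub>R (G (t + h k) \<xi> - G t \<xi> - h k *\<^sub>R G' t \<xi>)"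
          using elim h(2)[of k] by (simp add: Q_def scaleR_conv_of_real right_diff_distrib of_real_inverse)
        then show ?thesis by (simp add: divide_inverse mult.commute)
      qed
      ultimately show ?case by (simp add: tendsto_norm_zero_iff)
    qed
    show "AE \<xi> in lborel. norm (Q (h k) \<xi>) \<le> norm (2 * D \<xi>)" for k
      using FGk FGt deriv g(2)
    proof eventually_elim
      case (elim \<xi>)
      have "norm (G (t + h k) \<xi> - G t \<xi>) \<le> norm (D \<xi>) * norm (t + h k - t)"
      proof (rule differentiable_bound[where S="{a<..}" and f'="\<lambda>\<tau> x. x *\<^sub>R G' \<tau> \<xi>"])
        show "((\<lambda>\<tau>. G \<tau> \<xi>) has_derivative (\<lambda>x. x *\<^sub>R G' \<tau> \<xi>)) (at \<tau> within {a<..})" if "\<tau> \<in> {a<..}" for \<tau>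
          using elim(3) that unfolding has_vector_derivative_def by (auto intro: has_derivative_at_withinI)
        show "onorm (\<lambda>x. x *\<^sub>R G' \<tau> \<xi>) \<le> norm (D \<xi>)" if "\<tau> \<in> {a<..}" for \<tau>
          using elim(3) that by (intro onorm_bound) (auto simp: mult.commute intro!: mult_left_mono)
      qed (use h(3)[of k] a in auto)
      then have "norm (inverse (h k) *\<^sub>R (G (t + h k) \<xi> - G t \<xi>)) \<le> norm (D \<xi>)"
        using h(2)[of k] unfolding norm_scaleR by (simp add: divide_simps mult.commute)
      moreover have "norm (g \<xi>) \<le> norm (D \<xi>)"
        using elim a by auto
      moreover have "Q (h k) \<xi> = inverse (h k) *\<^sub>R (G (t + h k) \<xi> - G t \<xi>) - g \<xi>"
        using elim by (simp add: Q_def scaleR_conv_of_real)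
      ultimately show ?case
        using norm_triangle_ineq4[of "inverse (h k) *\<^sub>R (G (t + h k) \<xi> - G t \<xi>)" "g \<xi>"]
        by (simp add: norm_mult)
    qed
  qed
  show "has_L2_time_derivative w (inv_fourier g) t"
    unfolding has_L2_time_derivative_def
  proof (intro conjI)
    show "square_integrable (inv_fourier g)" by (rule is_L2_fourier_square_integrable[OF inv])
    have "\<forall>\<^sub>F h in nhds 0. t + h > a"
    proof (rule order_tendstoD(1))
      show "((\<lambda>h. t + h) \<longlongrightarrow> t + 0) (nhds 0)"
        by (intro tendsto_add tendsto_const) (simp add: filterlim_ident)
    qed (use a in simp)
    then show "\<forall>\<^sub>F h in nhds 0. square_integrable (w (t + h))"
      by eventually_elim (rule is_L2_fourier_square_integrable[OF w])
    show "((\<lambda>h. L2_norm (\<lambda>x. (w (t + h) x - w t x) /\<^sub>R h - inv_fourier g x)) \<longlongrightarrow> 0) (at 0)"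
      unfolding tendsto_at_iff_sequentially comp_def
    proof (intro allI impI)
      fix h :: "nat \<Rightarrow> real" assume nz: "\<forall>i. h i \<in> UNIV - {0}" and h: "h \<longlonglongrightarrow> 0"
      have "\<forall>\<^sub>F k in sequentially. h k > a - t"
        using h a by (intro order_tendstoD(1)) auto
      then obtain N where N: "\<And>k. k \<ge> N \<Longrightarrow> h k > a - t"
        unfolding eventually_sequentially by blast
      have large: "t + h (k + N) > a" for k
        using N[of "k + N"] by simp
      have "(\<lambda>k. L2_norm (Q (h (k + N)))) \<longlonglongrightarrow> 0"
        by (rule Q_lim) (use nz large LIMSEQ_ignore_initial_segment[OF h] in auto)
      moreover have "L2_norm (Q (h (k + N))) = c * L2_norm (\<lambda>x. (w (t + h (k + N)) x - w t x) /\<^sub>R h (k + N) - inv_fourier g x)" for k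
        unfolding c_def by (rule is_L2_fourier_norm[OF Q[OF large]])
      ultimately have "(\<lambda>k. c * L2_norm (\<lambda>x. (w (t + h (k + N)) x - w t x) /\<^sub>R h (k + N) - inv_fourier g x)) \<longlonglongrightarrow> 0"
        by simp
      from tendsto_mult_right_zero[OF this, of "inverse c"]
      have "(\<lambda>k. L2_norm (\<lambda>x. (w (t + h (k + N)) x - w t x) /\<^sub>R h (k + N) - inv_fourier g x)) \<longlonglongrightarrow> 0"
        using c by (simp add: mult.assoc[symmetric])
      then show "(\<lambda>k. L2_norm (\<lambda>x. (w (t + h k) x - w t x) /\<^sub>R h k - inv_fourier g x)) \<longlonglongrightarrow> 0"
        by (rule LIMSEQ_offset)
    qed
  qed
qed

section \<open>Integrability of powers with exponential decay\<close>

text \<open>Covering the support by balls, on which the function is controlled by constants, replaces polar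
  coordinates; the radii are powers of \<open>1/2\<close> near the origin and powers of \<open>2\<close> far from it.\<close>

lemma integrable_cover_balls:
  fixes f :: "'a::euclidean_space \<Rightarrow> real"
  assumes [measurable]: "f \<in> borel_measurable borel" and f: "\<And>x. f x \<ge> 0"
    and cover: "\<And>x. f x \<noteq> 0 \<Longrightarrow> \<exists>k. norm x < R k \<and> f x \<le> a k"
    and a: "\<And>k. a k \<ge> 0" and R: "\<And>k. R k > 0" and sum: "summable (\<lambda>k. a k * R k ^ DIM('a))"
  shows "integrable lborel f"
proof (rule integrableI_bounded)
  have [measurable]: "ball (0::'a) r \<in> sets borel" for r by (rule borel_open[OF open_ball])
  define V where "V = measure lborel (ball (0::'a) 1)"
  have V: "emeasure lborel (ball (0::'a) 1) = ennreal V"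
    unfolding V_def by (rule emeasure_eq_ennreal_measure) (use emeasure_lborel_ball_finite[of "0::'a" 1] in auto)
  have ball: "emeasure lborel (ball (0::'a) r) = ennreal (r ^ DIM('a) * V)" if "r > 0" for r
  proof -
    have eq: "indicator (ball (0::'a) r) (0 + r *\<^sub>R x) = (indicator (ball 0 1) x :: ennreal)" for x
      using that by (auto simp: indicator_def)
    have "emeasure lborel (ball (0::'a) r) = (\<integral>\<^sup>+x. indicator (ball (0::'a) r) x \<partial>lborel)" by simp
    also have "\<dots> = ennreal (\<bar>r\<bar> ^ DIM('a)) * (\<integral>\<^sup>+x. indicator (ball (0::'a) r) (0 + r *\<^sub>R x) \<partial>lborel)"
      by (rule nn_integral_lborel_affine) (measurable, use that in auto)
    also have "\<dots> = ennreal (r ^ DIM('a)) * ennreal V"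
      unfolding eq using that by (simp add: V)
    finally show ?thesis using that by (simp add: ennreal_mult V_def)
  qed
  have "(\<integral>\<^sup>+x. ennreal (norm (f x)) \<partial>lborel) \<le> (\<integral>\<^sup>+x. (\<Sum>k. ennreal (a k) * indicator (ball (0::'a) (R k)) x) \<partial>lborel)"
  proof (rule nn_integral_mono)
    fix x :: 'a
    show "ennreal (norm (f x)) \<le> (\<Sum>k. ennreal (a k) * indicator (ball 0 (R k)) x)"
    proof (cases "f x = 0")
      case False
      then obtain k where k: "norm x < R k" "f x \<le> a k" using cover by blast
      then have "ennreal (norm (f x)) \<le> (\<Sum>k\<in>{k}. ennreal (a k) * indicator (ball 0 (R k)) x)"
        using f[of x] by (simp add: ennreal_leI)
      also have "\<dots> \<le> (\<Sum>k. ennreal (a k) * indicator (ball 0 (R k)) x)"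
        by (intro sum_le_suminf) auto
      finally show ?thesis .
    qed simp
  qed
  also have "\<dots> = (\<Sum>k. \<integral>\<^sup>+x. ennreal (a k) * indicator (ball (0::'a) (R k)) x \<partial>lborel)"
    by (rule nn_integral_suminf) measurable
  also have "\<dots> = (\<Sum>k. ennreal (a k * R k ^ DIM('a) * V))"
  proof (intro suminf_cong)
    fix k
    have "(\<integral>\<^sup>+x. ennreal (a k) * indicator (ball (0::'a) (R k)) x \<partial>lborel) = ennreal (a k) * ennreal (R k ^ DIM('a) * V)"
      by (simp add: nn_integral_cmult_indicator ball[OF R])
    also have "\<dots> = ennreal (a k * (R k ^ DIM('a) * V))"
      by (intro ennreal_mult[symmetric] a mult_nonneg_nonneg zero_le_power less_imp_le[OF R]) (simp add: V_def)
    finally show "(\<integral>\<^sup>+x. ennreal (a k) * indicator (ball (0::'a) (R k)) x \<partial>lborel) = ennreal (a k * R k ^ DIM('a) * V)"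
      by (simp add: mult.assoc)
  qed
  also have "\<dots> = ennreal (\<Sum>k. a k * R k ^ DIM('a) * V)"
    by (rule suminf_ennreal2) (use a R less_imp_le[OF R] summable_mult2[OF sum] in \<open>auto simp: V_def\<close>)
  also have "\<dots> < \<infinity>" by simp
  finally show "(\<integral>\<^sup>+x. ennreal (norm (f x)) \<partial>lborel) < \<infinity>" .
qed simp

lemma power_powr_eq:
  fixes x :: real
  assumes "x > 0"
  shows "(x ^ j) powr r = x powr (real j * r)" "(x ^ j) ^ d = x powr (real j * real d)"
proof -
  show "(x ^ j) powr r = x powr (real j * r)"
    using assms by (simp add: powr_realpow[symmetric] powr_powr)
  have "x powr (real j * real d) = x powr real (j * d)" by simp
  also have "\<dots> = (x ^ j) ^ d"
    using assms by (subst powr_realpow) (simp_all add: power_mult)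
  finally show "(x ^ j) ^ d = x powr (real j * real d)" ..
qed

lemma integrable_norm_powr_near:
  assumes p: "p > - real DIM('a)"
  shows "integrable lborel (\<lambda>x::'a::euclidean_space. if norm x < 1 then norm x powr p else 0)"
proof -
  define m where "m = min p 0"
  have m: "m > - real DIM('a)" "m \<le> 0" "m \<le> p" using p by (auto simp: m_def)
  show ?thesis
  proof (rule integrable_cover_balls[where R="\<lambda>k. (1/2) ^ k" and a="\<lambda>k. ((1/2) ^ Suc k) powr m"])
    fix x :: 'a assume "(if norm x < 1 then norm x powr p else 0) \<noteq> 0"
    then have x: "norm x < 1" "norm x > 0" by (auto split: if_splits)
    have ex: "\<exists>k. (1/2) ^ Suc k \<le> norm x"
    proof -
      obtain k where "(1/2) ^ k < norm x" using real_arch_pow_inv[of "norm x" "1/2"] x by auto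
      then have "(1/2) ^ Suc k \<le> norm x" using x(2) unfolding power_Suc by linarith
      then show ?thesis ..
    qed
    define k where "k = (LEAST k. (1/2) ^ Suc k \<le> norm x)"
    have k: "(1/2) ^ Suc k \<le> norm x" unfolding k_def by (rule LeastI_ex[OF ex])
    have "norm x < (1/2) ^ k"
    proof (cases k)
      case 0
      then show ?thesis using x by simp
    next
      case (Suc j)
      then have "\<not> (1/2) ^ Suc j \<le> norm x" unfolding k_def by (intro not_less_Least) simp
      then show ?thesis unfolding Suc by simp
    qed
    moreover have "norm x powr p \<le> norm x powr m"
      using x m by (intro powr_mono') auto
    moreover have "norm x powr m \<le> ((1/2) ^ Suc k) powr m"
      using k m by (intro powr_mono2') auto
    ultimately show "\<exists>k. norm x < (1/2) ^ k \<and> (if norm x < 1 then norm x powr p else 0) \<le> ((1/2) ^ Suc k) powr m"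
      using x by (intro exI[of _ k]) auto
  next
    have "((1/2) ^ Suc k) powr m * ((1/2) ^ k) ^ DIM('a) = (1/2) powr m * ((1/2) powr (m + real DIM('a))) ^ k" for k
    proof -
      have "((1/2::real) ^ Suc k) powr m * ((1/2) ^ k) ^ DIM('a) = (1/2) powr (real (Suc k) * m) * (1/2) powr (real k * real DIM('a))"
        by (simp only: power_powr_eq zero_less_one half_gt_zero)
      also have "\<dots> = (1/2) powr m * (1/2) powr (real k * (m + real DIM('a)))"
        by (simp add: powr_add[symmetric] algebra_simps)
      finally show ?thesis by (simp add: powr_power mult.commute)
    qed
    moreover have "(1/2) powr (m + real DIM('a)) < (1::real)"
      using m powr_less_one[of "1/2"] by (simp add: powr_less_cancel_iff powr_mono' powr01_less_one)
    ultimately show "summable (\<lambda>k. ((1/2) ^ Suc k) powr m * ((1/2) ^ k) ^ DIM('a))"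
      by (simp only:) (intro summable_mult summable_geometric, simp)
  qed auto
qed

lemma integrable_norm_powr_far:
  assumes p: "p < - real DIM('a)"
  shows "integrable lborel (\<lambda>x::'a::euclidean_space. if norm x < 1 then 0 else norm x powr p)"
proof (rule integrable_cover_balls[where R="\<lambda>k. 2 ^ Suc k" and a="\<lambda>k. (2 ^ k) powr p"])
  fix x :: 'a assume "(if norm x < 1 then 0 else norm x powr p) \<noteq> 0"
  then have x: "norm x \<ge> 1" by (auto split: if_splits)
  have ex: "\<exists>k. norm x < 2 ^ Suc k"
  proof -
    obtain k where "norm x < 2 ^ k" using real_arch_pow[of 2 "norm x"] by auto
    moreover have "(0::real) < 2 ^ k" by simp
    ultimately have "norm x < 2 ^ Suc k" unfolding power_Suc by linarith
    then show ?thesis ..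
  qed
  define k where "k = (LEAST k. norm x < 2 ^ Suc k)"
  have k: "norm x < 2 ^ Suc k" unfolding k_def by (rule LeastI_ex[OF ex])
  have "2 ^ k \<le> norm x"
  proof (cases k)
    case 0
    then show ?thesis using x by simp
  next
    case (Suc j)
    then have "\<not> norm x < 2 ^ Suc j" unfolding k_def by (intro not_less_Least) simp
    then show ?thesis unfolding Suc by simp
  qed
  then have "norm x powr p \<le> (2 ^ k) powr p"
    using p by (intro powr_mono2') auto
  then show "\<exists>k. norm x < 2 ^ Suc k \<and> (if norm x < 1 then 0 else norm x powr p) \<le> (2 ^ k) powr p"
    using x k by (intro exI[of _ k]) auto
next
  have "(2 ^ k) powr p * (2 ^ Suc k) ^ DIM('a) = 2 ^ DIM('a) * (2 powr (p + real DIM('a))) ^ k" for k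
  proof -
    have "(2 ^ k) powr p * (2 ^ Suc k) ^ DIM('a) = (2::real) powr (real k * p) * 2 powr (real (Suc k) * real DIM('a))"
      by (simp only: power_powr_eq zero_less_numeral)
    also have "\<dots> = 2 powr real DIM('a) * 2 powr (real k * (p + real DIM('a)))"
      by (simp add: powr_add[symmetric] algebra_simps)
    finally show ?thesis by (simp add: powr_power powr_realpow mult.commute)
  qed
  moreover have "2 powr (p + real DIM('a)) < (2::real) powr 0"
    using p by (intro powr_less_mono) auto
  ultimately show "summable (\<lambda>k. (2 ^ k) powr p * (2 ^ Suc k) ^ DIM('a))"
    by (simp only:) (intro summable_mult summable_geometric, simp)
qed auto

text \<open>One term of the exponential series, of an order \<open>N\<close> with \<open>N q \<ge> p - m\<close>, already beats the power.\<close>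

lemma powr_exp_bound:
  fixes c q p m :: real
  assumes "c > 0" "q > 0"
  shows "\<exists>C>0. \<forall>r\<ge>1. r powr p * exp (- c * r powr q) \<le> C * r powr m"
proof -
  obtain N :: nat where "p - m < real N * q"
    using ex_less_of_nat_mult[OF \<open>q > 0\<close>, of "p - m"] by auto
  then have N: "real N * q \<ge> p - m" by simp
  show ?thesis
  proof (intro exI[of _ "fact N / c ^ N"] conjI allI impI)
    show "fact N / c ^ N > 0" using assms by simp
    fix r :: real assume r: "r \<ge> 1"
    define y where "y = c * r powr q"
    have y: "y > 0" using assms r by (simp add: y_def)
    have "y ^ N / fact N = (\<Sum>k\<in>{N}. y ^ k /\<^sub>R fact k)" by (simp add: divide_inverse mult.commute)
    also have "\<dots> \<le> (\<Sum>k. y ^ k /\<^sub>R fact k)"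
      by (rule sum_le_suminf) (use summable_exp_generic[of y] y in auto)
    also have "\<dots> = exp y" by (simp add: exp_def)
    finally have "exp (- y) \<le> fact N / y ^ N"
      using y by (simp add: exp_minus field_simps)
    then have "r powr p * exp (- c * r powr q) \<le> r powr p * (fact N / y ^ N)"
      by (intro mult_left_mono) (auto simp: y_def)
    also have "y ^ N = c ^ N * r powr (real N * q)"
      using r by (simp add: y_def power_mult_distrib powr_power mult.commute)
    also have "r powr p * (fact N / (c ^ N * r powr (real N * q))) = fact N / c ^ N * r powr (p - real N * q)"
      using r by (simp add: powr_diff)
    also have "\<dots> \<le> fact N / c ^ N * r powr m"
      using r N assms by (intro mult_left_mono powr_mono) auto
    finally show "r powr p * exp (- c * r powr q) \<le> fact N / c ^ N * r powr m" .
  qed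
qed

lemma integrable_norm_powr_exp:
  assumes p: "p > - real DIM('a)" and "c > 0" "q > 0"
  shows "integrable lborel (\<lambda>x::'a::euclidean_space. norm x powr p * exp (- c * norm x powr q))"
proof -
  define m where "m = - real DIM('a) - 1"
  obtain C where C: "C > 0" "\<And>r. r \<ge> 1 \<Longrightarrow> r powr p * exp (- c * r powr q) \<le> C * r powr m"
    using powr_exp_bound[OF assms(2,3)] by blast
  show ?thesis
  proof (rule Bochner_Integration.integrable_bound)
    show "integrable lborel (\<lambda>x::'a. (if norm x < 1 then norm x powr p else 0) + C * (if norm x < 1 then 0 else norm x powr m))"
      by (intro Bochner_Integration.integrable_add integrable_mult_right integrable_norm_powr_near[OF p] integrable_norm_powr_far)
         (simp add: m_def)
    show "AE x::'a in lborel. norm (norm x powr p * exp (- c * norm x powr q)) \<le>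
        norm ((if norm x < 1 then norm x powr p else 0) + C * (if norm x < 1 then 0 else norm x powr m))"
    proof (rule AE_I2)
      fix x :: 'a
      have "norm x powr p * exp (- c * norm x powr q) \<le> norm x powr p * 1"
        using assms by (intro mult_left_mono) auto
      then show "norm (norm x powr p * exp (- c * norm x powr q)) \<le>
        norm ((if norm x < 1 then norm x powr p else 0) + C * (if norm x < 1 then 0 else norm x powr m))"
        using C(2)[of "norm x"] C(1) by (auto simp: abs_mult)
    qed
  qed measurable
qed

lemma square_integrable_norm_powr_exp:
  assumes p: "2 * p > - real CARD('n)" and "c > 0" "q > 0"
  shows "square_integrable (\<lambda>\<xi>::real ^ 'n. complex_of_real (norm \<xi> powr p * exp (- c * norm \<xi> powr q)))"
  unfolding square_integrable_def
proof
  have "integrable lborel (\<lambda>\<xi>::real ^ 'n. norm \<xi> powr (2 * p) * exp (- (2 * c) * norm \<xi> powr q))"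
    by (rule integrable_norm_powr_exp) (use assms in auto)
  moreover have "norm \<xi> powr (2 * p) * exp (- (2 * c) * norm \<xi> powr q) =
      (norm (complex_of_real (norm \<xi> powr p * exp (- c * norm \<xi> powr q))))\<^sup>2" for \<xi> :: "real ^ 'n"
    unfolding norm_of_real power2_abs power_mult_distrib
    by (simp add: power2_eq_square powr_add[symmetric] exp_add[symmetric])
  ultimately show "integrable lborel (\<lambda>\<xi>::real ^ 'n. (norm (complex_of_real (norm \<xi> powr p * exp (- c * norm \<xi> powr q))))\<^sup>2)"
    by simp
qed measurable

section \<open>The damped oscillator\<close>

lemma exponential_decay:
  fixes E :: "real \<Rightarrow> real"
  assumes E: "\<And>t. t \<ge> 0 \<Longrightarrow> (E has_real_derivative E' t) (at t within {0..})"
    and le: "\<And>t. t \<ge> 0 \<Longrightarrow> E' t \<le> - l * E t" and t: "t \<ge> 0"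
  shows "E t \<le> E 0 * exp (- l * t)"
proof (cases "t = 0")
  case False
  define F where "F s = exp (l * s) * E s" for s
  have d: "(F has_real_derivative exp (l * s) * (E' s + l * E s)) (at s within {0..})" if "s \<ge> 0" for s
    unfolding F_def by (rule derivative_eq_intros E that refl)+ (simp add: algebra_simps)
  have "F t \<le> F 0"
  proof (rule DERIV_nonpos_imp_decreasing_open[of 0 t F])
    show "0 \<le> t" by (rule t)
    show "\<exists>y. (F has_real_derivative y) (at s) \<and> y \<le> 0" if "0 < s" "s < t" for s
    proof (intro exI conjI)
      have "at s within {0..} = at s"
        using that by (intro at_within_interior) (auto simp: interior_real_atLeast)
      then show "(F has_real_derivative exp (l * s) * (E' s + l * E s)) (at s)"
        using d[of s] that by simp
      show "exp (l * s) * (E' s + l * E s) \<le> 0"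
        using le[of s] that by (intro mult_nonneg_nonpos) auto
    qed
    show "continuous_on {0..t} F"
      by (rule continuous_on_subset[OF DERIV_continuous_on[OF d]]) auto
  qed
  then have "exp (- l * t) * F t \<le> exp (- l * t) * F 0" by (intro mult_left_mono) auto
  then show ?thesis unfolding F_def mult.assoc[symmetric] exp_add[symmetric] by (simp add: mult.commute)
qed simp

locale damped_oscillator =
  fixes a b :: real and y v :: "real \<Rightarrow> complex"
  assumes y: "\<And>t. t \<ge> 0 \<Longrightarrow> (y has_vector_derivative v t) (at t within {0..})"
    and v: "\<And>t. t \<ge> 0 \<Longrightarrow> (v has_vector_derivative (- (a *\<^sub>R v t) - b *\<^sub>R y t)) (at t within {0..})"
begin

lemma lyapunov_derivative:
  assumes "t \<ge> 0"
  shows "((\<lambda>t. (norm (v t))\<^sup>2 + b * (norm (y t))\<^sup>2 + \<theta> * (y t \<bullet> v t)) has_real_derivative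
    (\<theta> - 2 * a) * (norm (v t))\<^sup>2 - \<theta> * b * (norm (y t))\<^sup>2 - \<theta> * a * (y t \<bullet> v t)) (at t within {0..})"
proof -
  note d = y[OF assms, unfolded has_vector_derivative_def] v[OF assms, unfolded has_vector_derivative_def]
  show ?thesis
    unfolding has_field_derivative_def power2_norm_eq_inner
    by (rule derivative_eq_intros d refl)+
       (auto simp: fun_eq_iff inner_commute algebra_simps inner_diff_right inner_diff_left)
qed

lemma energy_nonincreasing:
  assumes "a \<ge> 0" "t \<ge> 0"
  shows "(norm (v t))\<^sup>2 + b * (norm (y t))\<^sup>2 \<le> (norm (v 0))\<^sup>2 + b * (norm (y 0))\<^sup>2"
  using exponential_decay[where l=0 and E="\<lambda>t. (norm (v t))\<^sup>2 + b * (norm (y t))\<^sup>2" and t=t,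
      OF lyapunov_derivative[where \<theta>=0, simplified]] assms
  by simp

text \<open>The cross term \<open>\<epsilon> a y \<bullet> v\<close> transfers the damping of the velocity to the displacement;
  it costs little because \<open>a\<^sup>2 \<le> K b\<close> bounds \<open>a \<bar>y\<bar>\<close> by a multiple of \<open>\<surd>b \<bar>y\<bar>\<close>.\<close>

lemma energy_decay:
  assumes a: "a > 0" and K: "K > 0" "a\<^sup>2 \<le> K * b" and t: "t \<ge> 0"
  shows "(norm (v t))\<^sup>2 + b * (norm (y t))\<^sup>2 \<le>
    3 * exp (- (a / (3 * (1 + K))) * t) * ((norm (v 0))\<^sup>2 + b * (norm (y 0))\<^sup>2)"
proof -
  define \<epsilon> where "\<epsilon> = 1 / (1 + K)"
  have eps: "\<epsilon> > 0" "\<epsilon> * (1 + K) = 1" "\<epsilon> \<le> 1" using K by (auto simp: \<epsilon>_def)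
  have epsK: "\<epsilon> * K \<le> 1" "\<epsilon> + \<epsilon> * K / 2 \<le> 1" using eps K mult_pos_pos[OF eps(1) K(1)] by (auto simp: algebra_simps)
  define E where "E t = (norm (v t))\<^sup>2 + b * (norm (y t))\<^sup>2" for t
  define L where "L t = E t + \<epsilon> * a * (y t \<bullet> v t)" for t
  have b: "b > 0" using a K zero_less_mult_pos[OF _ K(1)] zero_less_power[OF a, of 2] by (meson less_le_trans)
  have cross: "a * \<bar>y t \<bullet> v t\<bar> \<le> (b * (norm (y t))\<^sup>2 + K * (norm (v t))\<^sup>2) / 2" for t
  proof -
    define Z X where "Z = a * norm (y t)" and "X = norm (v t)"
    have "a * \<bar>y t \<bullet> v t\<bar> \<le> Z * X"
      using mult_left_mono[OF Cauchy_Schwarz_ineq2[of "y t" "v t"], of a] a by (simp add: Z_def X_def mult.assoc)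
    also have "2 * K * (Z * X) \<le> Z\<^sup>2 + (K * X)\<^sup>2"
      using zero_le_power2[of "Z - K * X"] by (simp add: power2_eq_square algebra_simps)
    then have "Z * X \<le> (Z\<^sup>2 / K + K * X\<^sup>2) / 2"
      using K by (simp add: field_simps power2_eq_square)
    also have "Z\<^sup>2 / K \<le> b * (norm (y t))\<^sup>2"
      using mult_right_mono[OF K(2), of "(norm (y t))\<^sup>2"] K(1) by (simp add: Z_def power_mult_distrib field_simps)
    finally show ?thesis by (simp add: X_def)
  qed
  have E0: "E t \<ge> 0" for t using b by (simp add: E_def)
  have crossE: "\<bar>\<epsilon> * a * (y t \<bullet> v t)\<bar> \<le> E t / 2" for t
  proof -
    have "\<bar>\<epsilon> * a * (y t \<bullet> v t)\<bar> = \<epsilon> * (a * \<bar>y t \<bullet> v t\<bar>)" using a eps by (simp add: abs_mult)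
    also have "\<dots> \<le> \<epsilon> * ((b * (norm (y t))\<^sup>2 + K * (norm (v t))\<^sup>2) / 2)"
      using eps cross[of t] by (intro mult_left_mono) auto
    also have "\<dots> = (\<epsilon> * (b * (norm (y t))\<^sup>2) + \<epsilon> * K * (norm (v t))\<^sup>2) / 2" by (simp add: algebra_simps)
    also have "\<dots> \<le> (1 * (b * (norm (y t))\<^sup>2) + 1 * (norm (v t))\<^sup>2) / 2"
      using eps epsK b by (intro divide_right_mono add_mono mult_right_mono) auto
    finally show ?thesis by (simp add: E_def)
  qed
  have "L t \<le> L 0 * exp (- (a * \<epsilon> / 3) * t)"
  proof (rule exponential_decay[OF _ _ t])
    fix t :: real assume "t \<ge> 0"
    show "(L has_real_derivative ((\<epsilon> * a - 2 * a) * (norm (v t))\<^sup>2 - \<epsilon> * a * b * (norm (y t))\<^sup>2 - \<epsilon> * a * a * (y t \<bullet> v t)))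
        (at t within {0..})"
      unfolding L_def E_def by (rule lyapunov_derivative) fact
    have "- (\<epsilon> * (a * (y t \<bullet> v t))) \<le> \<epsilon> * ((b * (norm (y t))\<^sup>2 + K * (norm (v t))\<^sup>2) / 2)"
    proof -
      have "- (a * (y t \<bullet> v t)) \<le> a * \<bar>y t \<bullet> v t\<bar>" using a by (simp add: abs_if)
      also note cross[of t]
      finally show ?thesis using mult_left_mono[OF _ less_imp_le[OF eps(1)]] by (metis mult_minus_right)
    qed
    then have "(\<epsilon> - 2) * (norm (v t))\<^sup>2 - \<epsilon> * (b * (norm (y t))\<^sup>2) - \<epsilon> * (a * (y t \<bullet> v t)) \<le>
        (\<epsilon> + \<epsilon> * K / 2 - 2) * (norm (v t))\<^sup>2 - \<epsilon> / 2 * (b * (norm (y t))\<^sup>2)"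
      by (simp add: algebra_simps)
    also have "\<dots> \<le> (- (\<epsilon> / 2)) * (norm (v t))\<^sup>2 - \<epsilon> / 2 * (b * (norm (y t))\<^sup>2)"
      using epsK eps by (intro diff_right_mono mult_right_mono) auto
    also have "\<dots> = - (\<epsilon> / 2) * E t" by (simp add: E_def algebra_simps)
    also have "\<dots> \<le> - (\<epsilon> / 3) * L t"
    proof -
      have "L t \<le> 3 / 2 * E t" unfolding L_def using crossE[of t] by (simp add: abs_le_iff)
      then have "\<epsilon> / 3 * L t \<le> \<epsilon> / 3 * (3 / 2 * E t)" using eps by (intro mult_left_mono) auto
      then show ?thesis by simp
    qed
    finally have *: "(\<epsilon> - 2) * (norm (v t))\<^sup>2 - \<epsilon> * (b * (norm (y t))\<^sup>2) - \<epsilon> * (a * (y t \<bullet> v t)) \<le> - (\<epsilon> / 3) * L t" .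
    show "(\<epsilon> * a - 2 * a) * (norm (v t))\<^sup>2 - \<epsilon> * a * b * (norm (y t))\<^sup>2 - \<epsilon> * a * a * (y t \<bullet> v t) \<le> - (a * \<epsilon> / 3) * L t"
      using mult_left_mono[OF *, of a] a by (simp add: algebra_simps)
  qed
  moreover have "L 0 \<le> 3 / 2 * E 0" unfolding L_def using crossE[of 0] by (simp add: abs_le_iff)
  moreover have "E t \<le> 2 * L t" unfolding L_def using crossE[of t] by (simp add: abs_le_iff)
  ultimately have "E t \<le> 2 * (3 / 2 * E 0 * exp (- (a * \<epsilon> / 3) * t))"
    by (smt (verit) exp_ge_zero mult_right_mono)
  then have "E t \<le> 3 * exp (- (a * \<epsilon> / 3) * t) * E 0" by (simp add: mult_ac)
  moreover have eq: "a / (3 * (1 + K)) = a * \<epsilon> / 3" by (simp add: \<epsilon>_def)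
  ultimately show ?thesis unfolding E_def[symmetric] eq by simp
qed

lemma explicit_solution:
  assumes sum: "l1 + l2 = - a" and prod: "l1 * l2 = b" and ne: "l1 \<noteq> l2" and t: "t \<ge> 0"
  shows "y t = (exp (l1 * t) *\<^sub>R (v 0 - l2 *\<^sub>R y 0) - exp (l2 * t) *\<^sub>R (v 0 - l1 *\<^sub>R y 0)) /\<^sub>R (l1 - l2)"
    and "v t = (l1 *\<^sub>R exp (l1 * t) *\<^sub>R (v 0 - l2 *\<^sub>R y 0) - l2 *\<^sub>R exp (l2 * t) *\<^sub>R (v 0 - l1 *\<^sub>R y 0)) /\<^sub>R (l1 - l2)"
proof -
  \<comment> \<open>The combination \<open>v - m y\<close>, where \<open>m\<close> is one characteristic root, grows exactly like the exponential
    of the other root.\<close>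
  have mode: "v t - m *\<^sub>R y t = exp (l * t) *\<^sub>R (v 0 - m *\<^sub>R y 0)"
    if lm: "l + m = - a" "l * m = b" for l m
  proof -
    define z where "z s = exp (- l * s) *\<^sub>R (v s - m *\<^sub>R y s)" for s
    have "(z has_vector_derivative 0) (at s within {0..})" if "s \<in> {0..}" for s
    proof -
      have "((\<lambda>s. v s - m *\<^sub>R y s) has_vector_derivative (- (a *\<^sub>R v s) - b *\<^sub>R y s) - m *\<^sub>R v s) (at s within {0..})"
        using that by (intro has_vector_derivative_diff v bounded_linear.has_vector_derivative[OF bounded_linear_scaleR_right] y) auto
      moreover have "(- (a *\<^sub>R v s) - b *\<^sub>R y s) - m *\<^sub>R v s = l *\<^sub>R (v s - m *\<^sub>R y s)"
        unfolding lm(2)[symmetric] using lm(1) by (simp add: algebra_simps flip: scaleR_add_left minus_add_distrib)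
      ultimately have d: "((\<lambda>s. v s - m *\<^sub>R y s) has_vector_derivative l *\<^sub>R (v s - m *\<^sub>R y s)) (at s within {0..})"
        by simp
      have e: "((\<lambda>s. exp (- l * s)) has_real_derivative - l * exp (- l * s)) (at s within {0..})"
        by (auto intro!: derivative_eq_intros)
      show ?thesis
        unfolding z_def using has_vector_derivative_scaleR[OF e d] by (simp add: algebra_simps)
    qed
    then obtain c where "\<And>s. s \<in> {0..} \<Longrightarrow> z s = c"
      using has_vector_derivative_zero_constant[of "{0..}" z] by auto
    then have "z t = z 0" using t by simp
    then have "exp (l * t) *\<^sub>R z t = exp (l * t) *\<^sub>R z 0" by simp
    then show ?thesis by (simp add: z_def exp_minus)
  qed
  have m1: "v t - l2 *\<^sub>R y t = exp (l1 * t) *\<^sub>R (v 0 - l2 *\<^sub>R y 0)"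
    and m2: "v t - l1 *\<^sub>R y t = exp (l2 * t) *\<^sub>R (v 0 - l1 *\<^sub>R y 0)"
    using sum prod by (auto intro!: mode simp: add.commute mult.commute)
  have "(l1 - l2) *\<^sub>R y t = (v t - l2 *\<^sub>R y t) - (v t - l1 *\<^sub>R y t)" by (simp add: algebra_simps)
  then have "inverse (l1 - l2) *\<^sub>R (l1 - l2) *\<^sub>R y t = ((v t - l2 *\<^sub>R y t) - (v t - l1 *\<^sub>R y t)) /\<^sub>R (l1 - l2)" by simp
  then show "y t = (exp (l1 * t) *\<^sub>R (v 0 - l2 *\<^sub>R y 0) - exp (l2 * t) *\<^sub>R (v 0 - l1 *\<^sub>R y 0)) /\<^sub>R (l1 - l2)"
    unfolding m1 m2 using ne by simp
  have "(l1 - l2) *\<^sub>R v t = l1 *\<^sub>R (v t - l2 *\<^sub>R y t) - l2 *\<^sub>R (v t - l1 *\<^sub>R y t)" by (simp add: algebra_simps)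
  then have "inverse (l1 - l2) *\<^sub>R (l1 - l2) *\<^sub>R v t = (l1 *\<^sub>R (v t - l2 *\<^sub>R y t) - l2 *\<^sub>R (v t - l1 *\<^sub>R y t)) /\<^sub>R (l1 - l2)" by simp
  then show "v t = (l1 *\<^sub>R exp (l1 * t) *\<^sub>R (v 0 - l2 *\<^sub>R y 0) - l2 *\<^sub>R exp (l2 * t) *\<^sub>R (v 0 - l1 *\<^sub>R y 0)) /\<^sub>R (l1 - l2)"
    unfolding m1 m2 using ne by simp
qed

end

section \<open>Low frequencies\<close>

lemma power_exp_neg_le:
  fixes x :: real
  assumes "x \<ge> 0" "j \<le> (1::nat)"
  shows "x ^ j * exp (- x) \<le> exp (- (x / 2))"
proof -
  have "x ^ j \<le> exp (x / 2)"
  proof (cases "j = 0")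
    case False
    then have j: "j = 1" using assms by simp
    have "1 + x / 2 / 2 \<le> exp (x / 2 / 2)" by (rule exp_ge_add_one_self)
    then have "(1 + x / 2 / 2)\<^sup>2 \<le> (exp (x / 2 / 2))\<^sup>2" using assms by (intro power_mono) auto
    also have "\<dots> = exp (x / 2)" by (simp add: power2_eq_square exp_add[symmetric])
    finally have "(1 + x / 2 / 2)\<^sup>2 \<le> exp (x / 2)" .
    moreover have "x \<le> (1 + x / 2 / 2)\<^sup>2"
      using zero_le_power2[of "1 - x / 4"] by (simp add: power2_eq_square algebra_simps)
    ultimately show ?thesis using j by simp
  qed (use assms in simp)
  then have "x ^ j * exp (- x) \<le> exp (x / 2) * exp (- x)" by (intro mult_right_mono) auto
  then show ?thesis by (simp add: exp_add[symmetric])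
qed

lemma filterlim_powr_at_top:
  assumes "p > (0::real)"
  shows "filterlim (\<lambda>x. x powr p) at_top at_top"
proof -
  have "filterlim (\<lambda>x::real. exp (p * ln x)) at_top at_top"
    using assms by (intro filterlim_compose[OF exp_at_top] filterlim_tendsto_pos_mult_at_top[OF tendsto_const] ln_at_top)
  moreover have "\<forall>\<^sub>F x::real in at_top. exp (p * ln x) = x powr p"
    using eventually_gt_at_top[of 0] by eventually_elim (simp add: powr_def)
  ultimately show ?thesis by (simp cong: filterlim_cong)
qed

text \<open>The functions \<open>A\<close> and \<open>B\<close> are the Fourier transforms of the initial position and velocity. Being
  transforms of integrable functions, they are continuous and bounded.\<close>

locale effective_damping =
  fixes \<sigma> \<delta> s :: real and j :: nat and A B :: "real ^ 'n \<Rightarrow> complex" and M :: real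
  assumes delta_pos: "0 < \<delta>" and delta_less: "\<delta> < \<sigma> / 2" and s_nonneg: "s \<ge> 0" and j: "j \<le> 1"
    and dim: "real CARD('n) > 4 * \<delta>"
    and cont_A: "continuous_on UNIV A" and cont_B: "continuous_on UNIV B"
    and bound_A: "\<And>\<xi>. norm (A \<xi>) \<le> M" and bound_B: "\<And>\<xi>. norm (B \<xi>) \<le> M"
begin

text \<open>The slow mode decays like \<open>exp (- t r\<^sup>q)\<close>, and \<open>r\<^sup>m\<close> is the ratio of the stiffness to the square of
  the damping.\<close>

definition q :: real where "q = 2 * (\<sigma> - \<delta>)"
definition m :: real where "m = 2 * \<sigma> - 4 * \<delta>"
definition decay_exponent :: real where "decay_exponent = - (real CARD('n) / 2 + s - 2 * \<delta>) / q - real j"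

text \<open>Below the radius \<open>r\<^sub>0\<close> the characteristic roots are real and separated: the square root
  of the normalised discriminant is at least \<open>1/2\<close>.\<close>

definition r\<^sub>0 :: real where "r\<^sub>0 = (3 / 16) powr (1 / m)"
definition S :: "real \<Rightarrow> real" where "S r = sqrt (1 - 4 * r powr m)"
definition slow :: "real \<Rightarrow> real" where "slow r = - (r powr (2 * \<delta>)) * (1 - S r) / 2"
definition fast :: "real \<Rightarrow> real" where "fast r = - (r powr (2 * \<delta>)) * (1 + S r) / 2"

text \<open>This is the explicit solution of the oscillator (\<open>j = 0\<close>) or its velocity (\<open>j = 1\<close>) with initial
  position \<open>a\<close> and initial velocity \<open>b\<close>.\<close>

definition W :: "real \<Rightarrow> real \<Rightarrow> complex \<Rightarrow> complex \<Rightarrow> complex" where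
  "W t r a b = ((slow r ^ j * exp (t * slow r)) *\<^sub>R (b - fast r *\<^sub>R a)
     - (fast r ^ j * exp (t * fast r)) *\<^sub>R (b - slow r *\<^sub>R a)) /\<^sub>R (r powr (2 * \<delta>) * S r)"

definition low :: "real \<Rightarrow> real ^ 'n \<Rightarrow> complex" where
  "low t \<xi> = (if norm \<xi> < r\<^sub>0 then norm \<xi> powr s *\<^sub>R W t (norm \<xi>) (A \<xi>) (B \<xi>) else 0)"

text \<open>Up to the factor \<open>P\<^sub>1\<close>, this is the Fourier transform of \<open>\<partial>\<^sub>t\<^sup>j \<bar>D\<bar>\<^sup>s\<close> applied to the profile.\<close>

definition prof :: "real \<Rightarrow> real ^ 'n \<Rightarrow> complex" where
  "prof t \<xi> = complex_of_real (norm \<xi> powr (s - 2 * \<delta>) * (- (norm \<xi> powr q)) ^ j * exp (- t * norm \<xi> powr q))"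

lemma exponents: "q > 0" "m > 0" "q > 2 * \<delta>" "2 * \<delta> + m = q" "4 * \<delta> + m = 2 * \<sigma>" "r\<^sub>0 > 0"
  using delta_pos delta_less by (auto simp: q_def m_def r\<^sub>0_def)

lemma M_nonneg: "M \<ge> 0"
  using bound_A[of 0] norm_ge_zero order_trans by blast

lemma measurable_data [measurable]: "A \<in> borel_measurable borel" "B \<in> borel_measurable borel"
  using cont_A cont_B by (auto intro: borel_measurable_continuous_onI)

lemma measurable_low [measurable]: "low t \<in> borel_measurable borel"
  unfolding low_def W_def slow_def fast_def S_def by measurable

lemma measurable_prof [measurable]: "prof t \<in> borel_measurable borel"
  unfolding prof_def by measurable

lemma S_bounds:
  assumes "0 < r" "r < r\<^sub>0"
  shows "1 / 2 \<le> S r" "S r \<le> 1" "(S r)\<^sup>2 = 1 - 4 * r powr m"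
proof -
  have "r powr m < r\<^sub>0 powr m" using assms exponents by (intro powr_less_mono2) auto
  also have "\<dots> = 3 / 16" using exponents by (simp add: r\<^sub>0_def powr_powr)
  finally have rm: "r powr m < 3 / 16" .
  show "S r \<le> 1" by (simp add: S_def)
  have "sqrt ((1 / 2)\<^sup>2) \<le> S r" unfolding S_def using rm by (intro real_sqrt_le_mono) (simp add: power2_eq_square)
  then show "1 / 2 \<le> S r" by simp
  show "(S r)\<^sup>2 = 1 - 4 * r powr m" unfolding S_def using rm by simp
qed

text \<open>The product \<open>(1 - S r) (1 + S r) = 4 r\<^sup>m\<close> turns the cancellation in \<open>1 - S r\<close> into the exact
  factor \<open>r\<^sup>q\<close> of the slow root.\<close>

lemma roots:
  assumes r: "0 < r" "r < r\<^sub>0"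
  shows "slow r + fast r = - (r powr (2 * \<delta>))" "slow r * fast r = r powr (2 * \<sigma>)"
    and "slow r - fast r = r powr (2 * \<delta>) * S r" "slow r \<noteq> fast r"
    and "slow r = - (2 / (1 + S r)) * r powr q"
    and "slow r \<le> - (r powr q)" "fast r \<le> - (3 / 4 * r powr (2 * \<delta>))"
    and "\<bar>slow r\<bar> \<le> r powr (2 * \<delta>)" "\<bar>fast r\<bar> \<le> r powr (2 * \<delta>)"
proof -
  note S = S_bounds[OF r]
  have a: "r powr (2 * \<delta>) > 0" using r by simp
  show "slow r + fast r = - (r powr (2 * \<delta>))" by (simp add: slow_def fast_def field_simps)
  show diff: "slow r - fast r = r powr (2 * \<delta>) * S r" by (simp add: slow_def fast_def field_simps)
  show "slow r \<noteq> fast r" using diff a S by auto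
  have "slow r * fast r = (r powr (2 * \<delta>))\<^sup>2 * (1 - (S r)\<^sup>2) / 4"
    by (simp add: slow_def fast_def power2_eq_square field_simps)
  also have "\<dots> = r powr (2 * \<delta>) * r powr (2 * \<delta>) * r powr m" unfolding S(3) by (simp add: power2_eq_square)
  also have "\<dots> = r powr (2 * \<sigma>)" using exponents by (simp add: powr_add[symmetric])
  finally show "slow r * fast r = r powr (2 * \<sigma>)" .
  have "(1 - S r) * (1 + S r) = 4 * r powr m" using S(3) by (simp add: power2_eq_square algebra_simps)
  then have half: "1 - S r = 4 * r powr m / d" if "d = 1 + S r" for d
    using S that by (simp add: field_simps)
  have "slow r = - (2 / d) * (r powr (2 * \<delta>) * r powr m)" if "d = 1 + S r" for d
    unfolding slow_def half[OF that] by simp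
  then have "slow r = - (2 / (1 + S r)) * (r powr (2 * \<delta>) * r powr m)" by blast
  then show slow: "slow r = - (2 / (1 + S r)) * r powr q" using exponents by (simp add: powr_add[symmetric])
  have "1 * r powr q \<le> 2 / (1 + S r) * r powr q" using S by (intro mult_right_mono) auto
  then show "slow r \<le> - (r powr q)" unfolding slow by simp
  show "fast r \<le> - (3 / 4 * r powr (2 * \<delta>))"
    using mult_left_mono[of "3 / 2" "1 + S r" "r powr (2 * \<delta>)"] S a by (simp add: fast_def)
  have "r powr (2 * \<delta>) * \<bar>1 - S r\<bar> \<le> r powr (2 * \<delta>) * 2" "r powr (2 * \<delta>) * \<bar>1 + S r\<bar> \<le> r powr (2 * \<delta>) * 2"
    using S by (intro mult_left_mono; simp)+
  then show "\<bar>slow r\<bar> \<le> r powr (2 * \<delta>)" "\<bar>fast r\<bar> \<le> r powr (2 * \<delta>)"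
    by (simp_all add: slow_def fast_def abs_mult)
qed

lemma explicit_W:
  assumes osc: "damped_oscillator (r powr (2 * \<delta>)) (r powr (2 * \<sigma>)) y v" and r: "0 < r" "r < r\<^sub>0" and t: "t \<ge> 0"
  shows "(if j = 0 then y t else v t) = W t r (y 0) (v 0)"
proof -
  interpret damped_oscillator "r powr (2 * \<delta>)" "r powr (2 * \<sigma>)" y v by fact
  show ?thesis
    using j explicit_solution[OF roots(1,2,4)[OF r] t] unfolding W_def roots(3)[OF r, symmetric]
    by (auto simp: mult.commute[of t] le_Suc_eq)
qed

subsection \<open>Parabolic scaling\<close>

text \<open>At the length scale \<open>T t\<close> in frequency space the exponent \<open>t r\<^sup>q\<close> of the slow mode is of order one.\<close>

definition T :: "real \<Rightarrow> real" where "T t = t powr (- (1 / q))"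

lemma T_props:
  assumes "t > 0" "\<rho> \<ge> 0"
  shows "T t > 0" "(T t * \<rho>) powr q = \<rho> powr q / t"
proof -
  show "T t > 0" using assms by (simp add: T_def)
  have "T t powr q = t powr (-1)" using exponents by (simp add: T_def powr_powr)
  then show "(T t * \<rho>) powr q = \<rho> powr q / t"
    using assms \<open>T t > 0\<close> by (simp add: powr_mult powr_minus_divide)
qed

text \<open>The factor \<open>T\<^bsup>2\<delta>-s\<^esup> t\<^sup>j\<close> compensates the homogeneity of the profile; with the Jacobian
  \<open>T\<^bsup>n/2\<^esup>\<close> it produces the decay exponent of the theorem.\<close>

lemma L2_norm_T:
  fixes f :: "real ^ 'n \<Rightarrow> complex"
  assumes t: "t > 0"
  shows "L2_norm f = t powr decay_exponent * L2_norm (\<lambda>\<eta>. complex_of_real (T t powr (2 * \<delta> - s) * t ^ j) * f (T t *\<^sub>R \<eta>))"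
proof -
  have T: "T t > 0" using T_props[OF t, of 0] by simp
  define a where "a = T t powr (2 * \<delta> - s) * t ^ j"
  have a: "a > 0" using T t by (simp add: a_def)
  have "sqrt (T t ^ CARD('n)) = T t powr (real CARD('n) / 2)"
    using T by (simp add: powr_half_sqrt[symmetric] powr_realpow[symmetric] powr_powr)
  also have "\<dots> / a = T t powr (real CARD('n) / 2 + s - 2 * \<delta>) * t powr (- real j)"
  proof -
    have "T t powr (real CARD('n) / 2) / a = T t powr (real CARD('n) / 2) / T t powr (2 * \<delta> - s) * (1 / t ^ j)"
      by (simp add: a_def)
    moreover have "T t powr (real CARD('n) / 2) / T t powr (2 * \<delta> - s) = T t powr (real CARD('n) / 2 + s - 2 * \<delta>)"
      by (simp add: powr_diff[symmetric] algebra_simps)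
    moreover have "1 / t ^ j = t powr (- real j)"
      using t by (simp add: powr_minus powr_realpow divide_inverse)
    ultimately show ?thesis by simp
  qed
  also have "\<dots> = t powr (- (1 / q) * (real CARD('n) / 2 + s - 2 * \<delta>)) * t powr (- real j)"
    unfolding T_def powr_powr ..
  also have "\<dots> = t powr decay_exponent"
  proof -
    have "- (1 / q) * x = - x / q" for x by simp
    from this[of "real CARD('n) / 2 + s - 2 * \<delta>"]
    have "- (1 / q) * (real CARD('n) / 2 + s - 2 * \<delta>) + - real j = decay_exponent" unfolding decay_exponent_def by linarith
    then show ?thesis unfolding powr_add[symmetric] by (rule arg_cong)
  qed
  finally have k: "sqrt (T t ^ CARD('n)) = t powr decay_exponent * a" using a by (simp add: field_simps)
  have "L2_norm f = sqrt (T t ^ CARD('n)) * L2_norm (\<lambda>\<eta>. f (T t *\<^sub>R \<eta>))"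
    using L2_norm_affine[of "T t" f 0] T by simp
  also have "\<dots> = t powr decay_exponent * (a * L2_norm (\<lambda>\<eta>. f (T t *\<^sub>R \<eta>)))" unfolding k by simp
  also have "a * L2_norm (\<lambda>\<eta>. f (T t *\<^sub>R \<eta>)) = L2_norm (\<lambda>\<eta>. complex_of_real a * f (T t *\<^sub>R \<eta>))"
    unfolding L2_norm_cmult using a by simp
  finally show ?thesis by (simp only: a_def)
qed

lemma prof_scaled:
  assumes t: "t > 0"
  shows "complex_of_real (T t powr (2 * \<delta> - s) * t ^ j) * prof t (T t *\<^sub>R \<eta>) = prof 1 \<eta>"
proof -
  have T: "T t > 0" "(T t * norm \<eta>) powr q = norm \<eta> powr q / t" using T_props[OF t, of "norm \<eta>"] by simp_all
  have n: "norm (T t *\<^sub>R \<eta>) = T t * norm \<eta>" using T by simp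
  have "T t powr (2 * \<delta> - s) * (T t * norm \<eta>) powr (s - 2 * \<delta>) = norm \<eta> powr (s - 2 * \<delta>)"
    using T by (simp add: powr_mult mult.assoc[symmetric] powr_add[symmetric])
  moreover have "t ^ j * (- (norm \<eta> powr q / t)) ^ j = (- (norm \<eta> powr q)) ^ j"
    using t by (simp add: power_mult_distrib[symmetric])
  ultimately have "T t powr (2 * \<delta> - s) * t ^ j * ((T t * norm \<eta>) powr (s - 2 * \<delta>) * (- (norm \<eta> powr q / t)) ^ j * exp (- t * (norm \<eta> powr q / t)))
     = norm \<eta> powr (s - 2 * \<delta>) * (- (norm \<eta> powr q)) ^ j * exp (- 1 * norm \<eta> powr q)"
    using t by (simp add: mult_ac)
  then show ?thesis unfolding prof_def n T(2) of_real_mult[symmetric] by (simp only:)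
qed

lemma square_integrable_prof:
  assumes "t > 0"
  shows "square_integrable (prof t)"
proof -
  have j01: "j = 0 \<or> j = 1" using j by auto
  define e where "e = s - 2 * \<delta> + real j * q"
  have "square_integrable (\<lambda>\<xi>::real ^ 'n. complex_of_real (norm \<xi> powr e * exp (- t * norm \<xi> powr q)))"
  proof (rule square_integrable_norm_powr_exp)
    have "0 \<le> real j * q" using exponents by simp
    then show "- real CARD('n) < 2 * e" using dim s_nonneg by (simp add: e_def)
  qed (use assms exponents in auto)
  moreover have "norm (prof t \<xi>) = norm (complex_of_real (norm \<xi> powr e * exp (- t * norm \<xi> powr q)))" for \<xi>
    using j01 by (auto simp: prof_def e_def norm_mult powr_add abs_mult split: if_splits)
  ultimately show ?thesis
    by (elim square_integrable_bound) (simp_all add: measurable_prof)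
qed

lemma L2_norm_prof:
  assumes "t > 0"
  shows "L2_norm (prof t) = t powr decay_exponent * L2_norm (prof 1)"
  using L2_norm_T[OF assms, of "prof t"] unfolding prof_scaled[OF assms] .

lemma L2_norm_prof_pos: "L2_norm (prof 1) > 0"
proof (rule ccontr)
  assume "\<not> L2_norm (prof 1) > 0"
  then have "L2_norm (prof 1) = 0" using L2_norm_nonneg[of "prof 1"] by linarith
  from L2_norm_zero_AE[OF square_integrable_prof this]
  have "AE \<xi> in lborel. prof 1 \<xi> = 0" by simp
  moreover have "AE \<xi>::real ^ 'n in lborel. \<xi> \<noteq> 0"
    by (rule AE_lborel_singleton)
  ultimately have "AE \<xi>::real ^ 'n in lborel. False"
    by eventually_elim (auto simp: prof_def)
  then show False by (simp add: eventually_False ae_filter_eq_bot_iff emeasure_lborel_UNIV)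
qed

lemma low_scaled:
  assumes t: "t > 0" and eta: "\<eta> \<noteq> 0" "T t * norm \<eta> < r\<^sub>0"
  defines "r \<equiv> T t * norm \<eta>"
  shows "complex_of_real (T t powr (2 * \<delta> - s) * t ^ j) * low t (T t *\<^sub>R \<eta>) =
    (norm \<eta> powr (s - 2 * \<delta>) / S r) *\<^sub>R
      (((t * slow r) ^ j * exp (t * slow r)) *\<^sub>R (B (T t *\<^sub>R \<eta>) - fast r *\<^sub>R A (T t *\<^sub>R \<eta>))
     - ((t * fast r) ^ j * exp (t * fast r)) *\<^sub>R (B (T t *\<^sub>R \<eta>) - slow r *\<^sub>R A (T t *\<^sub>R \<eta>)))"
proof -
  have T: "T t > 0" using T_props[OF t, of 0] by simp
  have n: "norm (T t *\<^sub>R \<eta>) = r" using T by (simp add: r_def)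
  have scal: "T t powr (2 * \<delta> - s) * r powr s / (r powr (2 * \<delta>) * S r) = norm \<eta> powr (s - 2 * \<delta>) / S r"
    using T eta by (simp add: r_def powr_mult powr_diff)
  define E1 E2 where "E1 = exp (t * slow r) *\<^sub>R (B (T t *\<^sub>R \<eta>) - fast r *\<^sub>R A (T t *\<^sub>R \<eta>))"
    and "E2 = exp (t * fast r) *\<^sub>R (B (T t *\<^sub>R \<eta>) - slow r *\<^sub>R A (T t *\<^sub>R \<eta>))"
  have "complex_of_real (T t powr (2 * \<delta> - s) * t ^ j) * low t (T t *\<^sub>R \<eta>) =
      (T t powr (2 * \<delta> - s) * t ^ j) *\<^sub>R r powr s *\<^sub>R (slow r ^ j *\<^sub>R E1 - fast r ^ j *\<^sub>R E2) /\<^sub>R (r powr (2 * \<delta>) * S r)"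
    unfolding scaleR_conv_of_real[symmetric] low_def n W_def E1_def E2_def using eta(2) by (simp add: r_def)
  also have "\<dots> = (T t powr (2 * \<delta> - s) * r powr s / (r powr (2 * \<delta>) * S r)) *\<^sub>R
      (t ^ j *\<^sub>R (slow r ^ j *\<^sub>R E1 - fast r ^ j *\<^sub>R E2))"
    by (simp add: divide_inverse mult_ac)
  also have "\<dots> = (norm \<eta> powr (s - 2 * \<delta>) / S r) *\<^sub>R ((t * slow r) ^ j *\<^sub>R E1 - (t * fast r) ^ j *\<^sub>R E2)"
    unfolding scal by (simp add: power_mult_distrib scaleR_diff_right)
  finally show ?thesis by (simp add: E1_def E2_def)
qed

text \<open>The two exponentials come from the slow and the fast mode. The constant bounds \<open>B - l A\<close> for every
  root \<open>l\<close> below the radius \<open>r\<^sub>0\<close>, doubled because \<open>S r \<ge> 1/2\<close>.\<close>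

definition dominator :: "real ^ 'n \<Rightarrow> complex" where
  "dominator \<eta> = complex_of_real (2 * (M + r\<^sub>0 powr (2 * \<delta>) * M) * (norm \<eta> powr (s - 2 * \<delta>) * exp (- (1 / 2) * norm \<eta> powr q)
     + norm \<eta> powr (s - 2 * \<delta>) * exp (- (3 / 8) * norm \<eta> powr (2 * \<delta>))))"

lemma square_integrable_dominator: "square_integrable dominator"
  unfolding dominator_def of_real_mult of_real_add distrib_left
  using delta_pos s_nonneg dim exponents
  by (intro square_integrable_add square_integrable_cmult square_integrable_norm_powr_exp[unfolded of_real_mult]) auto

text \<open>In the scaled variable the fast root times \<open>t\<close> is of order \<open>t\<^bsup>1-2\<delta>/q\<^esup>\<close>, and \<open>2\<delta> < q\<close>: the fast mode
  disappears as \<open>t\<close> grows.\<close>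

lemma fast_decay:
  assumes t: "t > 0" and eta: "\<eta> \<noteq> 0" "T t * norm \<eta> < r\<^sub>0"
  shows "\<bar>(t * fast (T t * norm \<eta>)) ^ j * exp (t * fast (T t * norm \<eta>))\<bar> \<le>
    exp (- (3 / 8) * (t powr (1 - 2 * \<delta> / q) * norm \<eta> powr (2 * \<delta>)))"
proof -
  define r where "r = T t * norm \<eta>"
  have T: "T t > 0" using T_props[OF t, of 0] by simp
  have r: "0 < r" "r < r\<^sub>0" using T eta by (auto simp: r_def)
  define x where "x = - (t * fast r)"
  have "t * r powr (2 * \<delta>) = t powr 1 * t powr (- (1 / q) * (2 * \<delta>)) * norm \<eta> powr (2 * \<delta>)"
    using t by (simp add: r_def powr_mult T_def powr_powr)
  also have "t powr 1 * t powr (- (1 / q) * (2 * \<delta>)) = t powr (1 - 2 * \<delta> / q)"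
    unfolding powr_add[symmetric] by simp
  finally have tr: "t * r powr (2 * \<delta>) = t powr (1 - 2 * \<delta> / q) * norm \<eta> powr (2 * \<delta>)" .
  have "x \<ge> 3 / 4 * (t * r powr (2 * \<delta>))"
    using mult_left_mono[OF roots(7)[OF r], of t] t by (simp add: x_def)
  then have x: "x \<ge> 3 / 4 * (t powr (1 - 2 * \<delta> / q) * norm \<eta> powr (2 * \<delta>))" unfolding tr .
  have "0 \<le> 3 / 4 * (t powr (1 - 2 * \<delta> / q) * norm \<eta> powr (2 * \<delta>))" by simp
  then have x0: "x \<ge> 0" using x by linarith
  have "\<bar>t * fast r\<bar> = x" using x0 unfolding x_def by linarith
  then have "\<bar>(t * fast r) ^ j\<bar> = x ^ j" by (simp only: power_abs)
  then have "\<bar>(t * fast r) ^ j * exp (t * fast r)\<bar> = x ^ j * exp (- x)"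
    by (simp add: abs_mult[of "(t * fast r) ^ j"] x_def)
  also have "\<dots> \<le> exp (- (x / 2))" by (rule power_exp_neg_le[OF x0 j])
  also have "\<dots> \<le> exp (- (3 / 8) * (t powr (1 - 2 * \<delta> / q) * norm \<eta> powr (2 * \<delta>)))"
    unfolding exp_le_cancel_iff using x by linarith
  finally show ?thesis unfolding r_def .
qed

lemma slow_scaled:
  assumes t: "t > 0" and eta: "\<eta> \<noteq> 0" "T t * norm \<eta> < r\<^sub>0"
  shows "t * slow (T t * norm \<eta>) = - (2 / (1 + S (T t * norm \<eta>))) * norm \<eta> powr q"
    and "\<bar>(t * slow (T t * norm \<eta>)) ^ j * exp (t * slow (T t * norm \<eta>))\<bar> \<le> exp (- (1 / 2) * norm \<eta> powr q)"
proof -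
  define r where "r = T t * norm \<eta>"
  have T: "T t > 0" "r powr q = norm \<eta> powr q / t" using T_props[OF t, of "norm \<eta>"] by (simp_all add: r_def)
  have r: "0 < r" "r < r\<^sub>0" using T eta by (auto simp: r_def)
  show eq: "t * slow (T t * norm \<eta>) = - (2 / (1 + S (T t * norm \<eta>))) * norm \<eta> powr q"
    unfolding r_def[symmetric] roots(5)[OF r] T(2) using t by simp
  define x where "x = - (t * slow r)"
  have "t * (r powr q) \<le> x"
    using mult_left_mono[OF roots(6)[OF r], of t] t by (simp add: x_def)
  then have x: "x \<ge> norm \<eta> powr q" unfolding T(2) using t by simp
  then have x0: "x \<ge> 0" using powr_ge_zero[of "norm \<eta>" q] by linarith
  have "\<bar>t * slow r\<bar> = x" using x0 unfolding x_def by linarith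
  then have "\<bar>(t * slow r) ^ j\<bar> = x ^ j" by (simp only: power_abs)
  then have "\<bar>(t * slow r) ^ j * exp (t * slow r)\<bar> = x ^ j * exp (- x)"
    by (simp add: abs_mult[of "(t * slow r) ^ j"] x_def)
  also have "\<dots> \<le> exp (- (x / 2))" by (rule power_exp_neg_le[OF x0 j])
  also have "\<dots> \<le> exp (- (1 / 2) * norm \<eta> powr q)" using x by simp
  finally show "\<bar>(t * slow (T t * norm \<eta>)) ^ j * exp (t * slow (T t * norm \<eta>))\<bar> \<le> exp (- (1 / 2) * norm \<eta> powr q)"
    unfolding r_def .
qed

lemma low_scaled_bound:
  assumes t: "t \<ge> 1" and eta: "\<eta> \<noteq> 0"
  shows "norm (complex_of_real (T t powr (2 * \<delta> - s) * t ^ j) * low t (T t *\<^sub>R \<eta>)) \<le> norm (dominator \<eta>)"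
proof (cases "T t * norm \<eta> < r\<^sub>0")
  case False
  have "T t > 0" using T_props[of t 0] t by simp
  then show ?thesis using False by (simp add: low_def)
next
  case True
  have t0: "t > 0" using t by simp
  define r where "r = T t * norm \<eta>"
  have T: "T t > 0" using T_props[OF t0, of 0] by simp
  have r: "0 < r" "r < r\<^sub>0" using T eta True by (auto simp: r_def)
  define M' where "M' = M + r\<^sub>0 powr (2 * \<delta>) * M"
  have M': "M' \<ge> 0" using M_nonneg by (simp add: M'_def)
  have r2: "r powr (2 * \<delta>) \<le> r\<^sub>0 powr (2 * \<delta>)" using r delta_pos by (intro powr_mono2) auto
  have data: "norm (B \<xi> - l *\<^sub>R A \<xi>) \<le> M'" if "\<bar>l\<bar> \<le> r powr (2 * \<delta>)" for \<xi> l
  proof -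
    have "norm (B \<xi> - l *\<^sub>R A \<xi>) \<le> norm (B \<xi>) + \<bar>l\<bar> * norm (A \<xi>)"
      using norm_triangle_ineq4[of "B \<xi>" "l *\<^sub>R A \<xi>"] by simp
    also have "\<dots> \<le> M + r\<^sub>0 powr (2 * \<delta>) * M"
      using that r2 bound_A[of \<xi>] bound_B[of \<xi>] by (intro add_mono mult_mono) auto
    finally show ?thesis by (simp add: M'_def)
  qed
  have one: "1 * norm \<eta> powr (2 * \<delta>) \<le> t powr (1 - 2 * \<delta> / q) * norm \<eta> powr (2 * \<delta>)"
  proof (rule mult_right_mono)
    have "0 \<le> 1 - 2 * \<delta> / q" using exponents by simp
    then show "1 \<le> t powr (1 - 2 * \<delta> / q)" using t by (rule ge_one_powr_ge_zero[rotated])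
  qed simp
  have slow: "norm (((t * slow r) ^ j * exp (t * slow r)) *\<^sub>R (B (T t *\<^sub>R \<eta>) - fast r *\<^sub>R A (T t *\<^sub>R \<eta>)))
      \<le> exp (- (1 / 2) * norm \<eta> powr q) * M'"
    unfolding norm_scaleR using slow_scaled(2)[OF t0 eta True] data[OF roots(9)[OF r]]
    by (intro mult_mono) (auto simp: r_def)
  have "\<bar>(t * fast r) ^ j * exp (t * fast r)\<bar> \<le> exp (- (3 / 8) * (t powr (1 - 2 * \<delta> / q) * norm \<eta> powr (2 * \<delta>)))"
    unfolding r_def by (rule fast_decay[OF t0 eta True])
  also have "\<dots> \<le> exp (- (3 / 8) * norm \<eta> powr (2 * \<delta>))" using one by simp
  finally have fast: "norm (((t * fast r) ^ j * exp (t * fast r)) *\<^sub>R (B (T t *\<^sub>R \<eta>) - slow r *\<^sub>R A (T t *\<^sub>R \<eta>)))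
      \<le> exp (- (3 / 8) * norm \<eta> powr (2 * \<delta>)) * M'"
    unfolding norm_scaleR using data[OF roots(8)[OF r]] by (intro mult_mono) auto
  have S: "1 / 2 \<le> S r" using S_bounds[OF r] by simp
  have "norm (complex_of_real (T t powr (2 * \<delta> - s) * t ^ j) * low t (T t *\<^sub>R \<eta>)) \<le>
      (norm \<eta> powr (s - 2 * \<delta>) / S r) * (exp (- (1 / 2) * norm \<eta> powr q) * M' + exp (- (3 / 8) * norm \<eta> powr (2 * \<delta>)) * M')"
    unfolding low_scaled[OF t0 eta True] r_def[symmetric] norm_scaleR
    using S norm_triangle_ineq4 slow fast
    by (intro mult_mono) (auto intro: order_trans[OF norm_triangle_ineq4 add_mono])
  also have "\<dots> \<le> (norm \<eta> powr (s - 2 * \<delta>) * 2) * (exp (- (1 / 2) * norm \<eta> powr q) * M' + exp (- (3 / 8) * norm \<eta> powr (2 * \<delta>)) * M')"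
  proof (rule mult_right_mono)
    have "1 / S r \<le> 2" using S by (simp add: field_simps)
    then have "norm \<eta> powr (s - 2 * \<delta>) * (1 / S r) \<le> norm \<eta> powr (s - 2 * \<delta>) * 2" by (intro mult_left_mono) auto
    then show "norm \<eta> powr (s - 2 * \<delta>) / S r \<le> norm \<eta> powr (s - 2 * \<delta>) * 2" by simp
  qed (use M' in simp)
  also have "\<dots> = 2 * M' * (norm \<eta> powr (s - 2 * \<delta>) * exp (- (1 / 2) * norm \<eta> powr q)
     + norm \<eta> powr (s - 2 * \<delta>) * exp (- (3 / 8) * norm \<eta> powr (2 * \<delta>)))"
    by (simp add: algebra_simps)
  also have "\<dots> \<le> norm (dominator \<eta>)"
    unfolding dominator_def M'_def norm_of_real by (rule abs_ge_self)
  finally show ?thesis .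
qed

lemma square_integrable_low:
  assumes t: "t \<ge> 1"
  shows "square_integrable (low t)"
proof -
  define a where "a = T t powr (2 * \<delta> - s) * t ^ j"
  have T: "T t > 0" using T_props[of t 0] t by simp
  then have a: "a > 0" using t by (simp add: a_def)
  have "AE \<eta>::real ^ 'n in lborel. \<eta> \<noteq> 0" by (rule AE_lborel_singleton)
  then have "AE \<eta> in lborel. norm (complex_of_real a * low t (T t *\<^sub>R \<eta>)) \<le> norm (dominator \<eta>)"
    by eventually_elim (use low_scaled_bound[OF t] in \<open>simp add: a_def\<close>)
  then have "square_integrable (\<lambda>\<eta>. complex_of_real a * low t (T t *\<^sub>R \<eta>))"
    by (rule square_integrable_bound[OF square_integrable_dominator, rotated]) measurable
  from square_integrable_affine[OF this, of "inverse (T t)" 0]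
  have "square_integrable (\<lambda>\<eta>. complex_of_real a * low t \<eta>)" using T by simp
  from square_integrable_cmult[OF this, of "complex_of_real (inverse a)"] show ?thesis
    using a by (simp add: mult.assoc[symmetric])
qed

text \<open>The slow mode alone survives. Its amplitude involves \<open>B - fast r A\<close>, in which the contribution of
  the initial position vanishes with \<open>r\<close>, and continuity of \<open>B\<close> leaves \<open>B 0\<close>.\<close>

lemma low_scaled_limit:
  assumes X: "filterlim X at_top sequentially" and X1: "\<And>k. X k \<ge> 1" and eta: "\<eta> \<noteq> 0"
  shows "(\<lambda>k. complex_of_real (T (X k) powr (2 * \<delta> - s) * X k ^ j) * low (X k) (T (X k) *\<^sub>R \<eta>)) \<longlonglongrightarrow> B 0 * prof 1 \<eta>"
proof -
  have X0: "X k > 0" for k using X1[of k] by simp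
  have Tp: "T (X k) > 0" for k using T_props[OF X0, of 0] by simp
  have T0: "(\<lambda>k. T (X k)) \<longlonglongrightarrow> 0"
    unfolding T_def using exponents by (intro tendsto_neg_powr X) auto
  define r where "r k = T (X k) * norm \<eta>" for k
  have r0: "r \<longlonglongrightarrow> 0" unfolding r_def using tendsto_mult_left_zero[OF T0] .
  have rpos: "r k > 0" for k using Tp eta by (simp add: r_def)
  have ev: "\<forall>\<^sub>F k in sequentially. r k < r\<^sub>0" using exponents by (intro order_tendstoD(2)[OF r0]) auto
  have powr0: "(\<lambda>k. r k powr e) \<longlonglongrightarrow> 0" if "e > 0" for e
    using that by (intro tendsto_zero_powrI[OF r0 tendsto_const]) (auto simp: less_imp_le rpos)
  have "(\<lambda>k. sqrt (1 - 4 * r k powr m)) \<longlonglongrightarrow> sqrt (1 - 4 * 0)"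
    using exponents by (intro tendsto_intros powr0)
  then have S1: "(\<lambda>k. S (r k)) \<longlonglongrightarrow> 1" by (simp add: S_def)
  have fast0: "(\<lambda>k. fast (r k)) \<longlonglongrightarrow> - 0 * (1 + 1) / 2"
    unfolding fast_def using delta_pos by (intro tendsto_intros powr0 S1) auto
  have A0: "(\<lambda>k. A (T (X k) *\<^sub>R \<eta>)) \<longlonglongrightarrow> A 0"
    by (rule continuous_on_tendsto_compose[OF cont_A]) (auto intro!: tendsto_eq_intros T0)
  have B0: "(\<lambda>k. B (T (X k) *\<^sub>R \<eta>)) \<longlonglongrightarrow> B 0"
    by (rule continuous_on_tendsto_compose[OF cont_B]) (auto intro!: tendsto_eq_intros T0)
  have "(\<lambda>k. - (2 / (1 + S (r k))) * norm \<eta> powr q) \<longlonglongrightarrow> - (2 / (1 + 1)) * norm \<eta> powr q"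
    by (intro tendsto_intros S1) auto
  then have "(\<lambda>k. - (2 / (1 + S (r k))) * norm \<eta> powr q) \<longlonglongrightarrow> - (norm \<eta> powr q)" by simp
  then have slow_lim: "(\<lambda>k. X k * slow (r k)) \<longlonglongrightarrow> - (norm \<eta> powr q)"
  proof (rule Lim_transform_eventually)
    show "\<forall>\<^sub>F k in sequentially. - (2 / (1 + S (r k))) * norm \<eta> powr q = X k * slow (r k)"
      using ev by eventually_elim (use slow_scaled(1)[OF X0 eta] in \<open>simp add: r_def\<close>)
  qed
  have p: "1 - 2 * \<delta> / q > 0" using exponents by simp
  have fast_lim: "(\<lambda>k. (X k * fast (r k)) ^ j * exp (X k * fast (r k))) \<longlonglongrightarrow> 0"
  proof (rule Lim_null_comparison)
    show "\<forall>\<^sub>F k in sequentially. norm ((X k * fast (r k)) ^ j * exp (X k * fast (r k))) \<le>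
        exp (- (3 / 8) * (X k powr (1 - 2 * \<delta> / q) * norm \<eta> powr (2 * \<delta>)))"
      using ev by eventually_elim (use fast_decay[OF X0 eta] in \<open>simp add: r_def\<close>)
    have "filterlim (\<lambda>k. X k powr (1 - 2 * \<delta> / q)) at_top sequentially"
      by (rule filterlim_compose[OF filterlim_powr_at_top[OF p] X])
    then have "filterlim (\<lambda>k. (3 / 8 * norm \<eta> powr (2 * \<delta>)) * X k powr (1 - 2 * \<delta> / q)) at_top sequentially"
      using eta by (intro filterlim_tendsto_pos_mult_at_top[OF tendsto_const]) auto
    then have "(\<lambda>k. exp (- ((3 / 8 * norm \<eta> powr (2 * \<delta>)) * X k powr (1 - 2 * \<delta> / q)))) \<longlonglongrightarrow> 0"
      by (intro filterlim_compose[OF exp_at_bot] filterlim_compose[OF filterlim_uminus_at_bot_at_top])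
    then show "(\<lambda>k. exp (- (3 / 8) * (X k powr (1 - 2 * \<delta> / q) * norm \<eta> powr (2 * \<delta>)))) \<longlonglongrightarrow> 0"
      by (simp add: mult_ac)
  qed
  have slow0: "(\<lambda>k. slow (r k)) \<longlonglongrightarrow> - 0 * (1 - 1) / 2"
    unfolding slow_def using delta_pos by (intro tendsto_intros powr0 S1) auto
  let ?f = "\<lambda>k. (norm \<eta> powr (s - 2 * \<delta>) / S (r k)) *\<^sub>R
      (((X k * slow (r k)) ^ j * exp (X k * slow (r k))) *\<^sub>R (B (T (X k) *\<^sub>R \<eta>) - fast (r k) *\<^sub>R A (T (X k) *\<^sub>R \<eta>))
     - ((X k * fast (r k)) ^ j * exp (X k * fast (r k))) *\<^sub>R (B (T (X k) *\<^sub>R \<eta>) - slow (r k) *\<^sub>R A (T (X k) *\<^sub>R \<eta>)))"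
  let ?l = "(norm \<eta> powr (s - 2 * \<delta>) / 1) *\<^sub>R
      (((- (norm \<eta> powr q)) ^ j * exp (- (norm \<eta> powr q))) *\<^sub>R (B 0 - (- 0 * (1 + 1) / 2) *\<^sub>R A 0)
     - 0 *\<^sub>R (B 0 - (- 0 * (1 - 1) / 2) *\<^sub>R A 0))"
  have "?f \<longlonglongrightarrow> ?l"
    by (intro tendsto_intros S1 slow_lim fast_lim fast0 slow0 A0 B0) simp
  also have "?l = B 0 * prof 1 \<eta>"
    by (simp add: prof_def scaleR_conv_of_real mult_ac)
  finally show ?thesis
  proof (rule Lim_transform_eventually)
    show "\<forall>\<^sub>F k in sequentially. ?f k
     = complex_of_real (T (X k) powr (2 * \<delta> - s) * X k ^ j) * low (X k) (T (X k) *\<^sub>R \<eta>)"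
      using ev
    proof eventually_elim
      case (elim k)
      then show ?case using low_scaled[OF X0 eta, of k] by (simp only: r_def)
    qed
  qed
qed

text \<open>In the parabolic variable \<open>\<eta> = \<xi> / T t\<close> the low-frequency part converges to the profile
  pointwise, and it is dominated uniformly in time.\<close>

theorem low_asymptotics:
  "((\<lambda>t. L2_norm (\<lambda>\<xi>. low t \<xi> - B 0 * prof t \<xi>) / t powr decay_exponent) \<longlongrightarrow> 0) at_top"
proof (rule tendsto_at_topI_sequentially)
  fix X :: "nat \<Rightarrow> real" assume X: "filterlim X at_top sequentially"
  then have "\<forall>\<^sub>F k in sequentially. X k \<ge> 1" by (simp add: filterlim_at_top)
  then obtain N where N: "\<And>k. k \<ge> N \<Longrightarrow> X k \<ge> 1" unfolding eventually_sequentially by blast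
  define Y where "Y k = X (k + N)" for k
  have Y: "filterlim Y at_top sequentially" "Y k \<ge> 1" for k
    using N filterlim_compose[OF X filterlim_add_const_nat_at_top[of N]] by (auto simp: Y_def[abs_def])
  have Y0: "Y k > 0" for k using Y(2)[of k] by simp
  define H where "H k \<eta> = complex_of_real (T (Y k) powr (2 * \<delta> - s) * Y k ^ j) * low (Y k) (T (Y k) *\<^sub>R \<eta>) - B 0 * prof 1 \<eta>" for k \<eta>
  have "L2_norm (\<lambda>\<xi>. low (Y k) \<xi> - B 0 * prof (Y k) \<xi>) / Y k powr decay_exponent = L2_norm (H k)" for k
  proof -
    have "complex_of_real (T (Y k) powr (2 * \<delta> - s) * Y k ^ j) * (low (Y k) (T (Y k) *\<^sub>R \<eta>) - B 0 * prof (Y k) (T (Y k) *\<^sub>R \<eta>)) = H k \<eta>" for \<eta>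
      unfolding H_def prof_scaled[OF Y0[of k], of \<eta>, symmetric] by (simp only: right_diff_distrib mult.left_commute)
    then show ?thesis
      using L2_norm_T[OF Y0[of k], of "\<lambda>\<xi>. low (Y k) \<xi> - B 0 * prof (Y k) \<xi>"] Y0[of k] by simp
  qed
  moreover have "(\<lambda>k. L2_norm (H k)) \<longlonglongrightarrow> 0"
  proof (rule L2_norm_dominated_convergence)
    define D where "D \<eta> = complex_of_real (norm (dominator \<eta>)) + complex_of_real (norm (B 0 * prof 1 \<eta>))" for \<eta>
    have n: "square_integrable (\<lambda>\<eta>. complex_of_real (norm (f \<eta>)))" if "square_integrable f" for f :: "real ^ 'n \<Rightarrow> complex"
    proof -
      note [measurable] = square_integrable_measurable[OF that]
      show ?thesis by (rule square_integrable_bound[OF that]) auto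
    qed
    show "square_integrable D"
      unfolding D_def by (intro square_integrable_add n square_integrable_dominator square_integrable_cmult square_integrable_prof) simp
    show "H k \<in> borel_measurable borel" for k
      unfolding H_def by measurable
    have nz: "AE \<eta>::real ^ 'n in lborel. \<eta> \<noteq> 0" by (rule AE_lborel_singleton)
    show "AE \<eta> in lborel. (\<lambda>k. H k \<eta>) \<longlonglongrightarrow> 0"
      using nz unfolding H_def by eventually_elim (intro LIM_zero low_scaled_limit Y)
    show "AE \<eta> in lborel. norm (H k \<eta>) \<le> norm (D \<eta>)" for k
      using nz
    proof eventually_elim
      case (elim \<eta>)
      have "norm (H k \<eta>) \<le> norm (dominator \<eta>) + norm (B 0 * prof 1 \<eta>)"
        unfolding H_def using low_scaled_bound[OF Y(2)[of k] elim] by (intro order_trans[OF norm_triangle_ineq4]) simp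
      also have "\<dots> = norm (D \<eta>)"
        unfolding D_def of_real_add[symmetric] norm_of_real by simp
      finally show ?case .
    qed
  qed
  ultimately have "(\<lambda>k. L2_norm (\<lambda>\<xi>. low (Y k) \<xi> - B 0 * prof (Y k) \<xi>) / Y k powr decay_exponent) \<longlonglongrightarrow> 0" by simp
  then show "(\<lambda>k. L2_norm (\<lambda>\<xi>. low (X k) \<xi> - B 0 * prof (X k) \<xi>) / X k powr decay_exponent) \<longlonglongrightarrow> 0"
    unfolding Y_def by (rule LIMSEQ_offset)
qed

end

section \<open>Solutions with Sobolev data\<close>

lemma powr_le_bessel_weight:
  fixes r e :: real
  assumes "r \<ge> 0" "e \<ge> 0"
  shows "r powr e \<le> (1 + r\<^sup>2) powr (e / 2)"
proof -
  have "r powr e = (r\<^sup>2) powr (e / 2)"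
    using assms by (cases "r = 0") (auto simp: powr_powr simp flip: powr_numeral)
  also have "\<dots> \<le> (1 + r\<^sup>2) powr (e / 2)" using assms by (intro powr_mono2) auto
  finally show ?thesis .
qed

lemma square_integrable_powr_weight:
  fixes f :: "real ^ 'n \<Rightarrow> complex"
  assumes f: "square_integrable (\<lambda>\<xi>. complex_of_real ((1 + (norm \<xi>)\<^sup>2) powr (e / 2)) * f \<xi>)" and "e \<ge> 0"
    and [measurable]: "f \<in> borel_measurable borel"
  shows "square_integrable (\<lambda>\<xi>. complex_of_real (norm \<xi> powr e) * f \<xi>)"
proof (rule square_integrable_bound[OF f])
  show "AE \<xi> in lborel. norm (complex_of_real (norm \<xi> powr e) * f \<xi>) \<le> norm (complex_of_real ((1 + (norm \<xi>)\<^sup>2) powr (e / 2)) * f \<xi>)"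
    using assms(2) by (intro AE_I2) (simp add: norm_mult mult_right_mono powr_le_bessel_weight)
qed measurable

lemma square_integrable_powr_weight_outside:
  fixes f :: "real ^ 'n \<Rightarrow> complex"
  assumes f: "square_integrable (\<lambda>\<xi>. complex_of_real ((1 + (norm \<xi>)\<^sup>2) powr (e / 2)) * f \<xi>)" and "e \<ge> 0"
    and [measurable]: "f \<in> borel_measurable borel" and "e' \<le> e" "\<rho> > 0"
  shows "square_integrable (\<lambda>\<xi>. complex_of_real (if norm \<xi> < \<rho> then 0 else norm \<xi> powr e') * f \<xi>)"
proof (rule square_integrable_bound[OF square_integrable_cmult[OF square_integrable_powr_weight[OF assms(1-3)], of "complex_of_real (\<rho> powr (e' - e))"]])
  have "norm \<xi> powr e' \<le> \<rho> powr (e' - e) * norm \<xi> powr e" if "\<not> norm \<xi> < \<rho>" for \<xi> :: "real ^ 'n"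
  proof -
    have "norm \<xi> powr (e' - e) * norm \<xi> powr e \<le> \<rho> powr (e' - e) * norm \<xi> powr e"
      using assms that by (intro mult_right_mono powr_mono2') auto
    then show ?thesis by (simp add: powr_add[symmetric])
  qed
  then show "AE \<xi> in lborel. norm (complex_of_real (if norm \<xi> < \<rho> then 0 else norm \<xi> powr e') * f \<xi>)
      \<le> norm (complex_of_real (\<rho> powr (e' - e)) * (complex_of_real (norm \<xi> powr e) * f \<xi>))"
    by (intro AE_I2) (auto simp: norm_mult mult.assoc[symmetric] intro!: mult_right_mono)
qed measurable

text \<open>The regularity assumptions are those of the Sobolev spaces of the data, read on the Fourier side;
  \<open>U\<close> and \<open>V\<close> are the transform of the solution and its velocity, which solve the oscillator at almost
  every frequency.\<close>

locale damped_wave = effective_damping \<sigma> \<delta> s j A B M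
  for \<sigma> \<delta> s j and A B :: "real ^ 'n \<Rightarrow> complex" and M +
  fixes u U V :: "real \<Rightarrow> real ^ 'n \<Rightarrow> complex"
  assumes reg_A: "square_integrable (\<lambda>\<xi>. complex_of_real ((1 + (norm \<xi>)\<^sup>2) powr ((s + real j * \<sigma>) / 2)) * A \<xi>)"
    and reg_B: "square_integrable (\<lambda>\<xi>. complex_of_real ((1 + (norm \<xi>)\<^sup>2) powr (max (s + (real j - 1) * \<sigma>) 0 / 2)) * B \<xi>)"
    and u: "\<And>t. t \<ge> 0 \<Longrightarrow> square_integrable (u t)"
    and U: "\<And>t. t \<ge> 0 \<Longrightarrow> AE \<xi> in lborel. U t \<xi> = fourier (u t) \<xi>"
    and sol: "AE \<xi> in lborel. U 0 \<xi> = A \<xi> \<and> V 0 \<xi> = B \<xi> \<and>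
      damped_oscillator (norm \<xi> powr (2 * \<delta>)) (norm \<xi> powr (2 * \<sigma>)) (\<lambda>t. U t \<xi>) (\<lambda>t. V t \<xi>)"
begin

definition Y :: "real \<Rightarrow> real ^ 'n \<Rightarrow> complex" where "Y t \<xi> = (if j = 0 then U t \<xi> else V t \<xi>)"

lemma sigma_pos: "\<sigma> > 0" using delta_pos delta_less by simp

lemma AE_nonzero: "AE \<xi>::real ^ 'n in lborel. \<xi> \<noteq> 0"
  by (rule AE_lborel_singleton)

lemma measurable_fourier_u: "t \<ge> 0 \<Longrightarrow> fourier (u t) \<in> borel_measurable borel"
  by (rule square_integrable_measurable[OF is_L2_fourier_square_integrable(2)[OF is_L2_fourier_fourier[OF u]]])

text \<open>The velocity is almost everywhere a limit of difference quotients of measurable functions.\<close>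

lemma measurable_version: "\<exists>g. g \<in> borel_measurable borel \<and> (AE \<xi> in lborel. g \<xi> = Y t \<xi>)" if t: "t \<ge> 0"
proof (cases "j = 0")
  case True
  then show ?thesis
    using measurable_fourier_u[OF t] U[OF t] unfolding Y_def
    by (intro exI[of _ "fourier (u t)"]) (auto elim: eventually_mono)
next
  case False
  define e where "e k = 1 / real (Suc k)" for k
  have e: "e k > 0" "e \<longlonglongrightarrow> 0" for k
    unfolding e_def using LIMSEQ_inverse_real_of_nat by (auto simp: inverse_eq_divide)
  define g where "g \<xi> = lim (\<lambda>k. (fourier (u (t + e k)) \<xi> - fourier (u t) \<xi>) /\<^sub>R e k)" for \<xi>
  have [measurable]: "fourier (u (t + e k)) \<in> borel_measurable borel" "fourier (u t) \<in> borel_measurable borel" for k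
    using t e(1)[of k] by (auto intro!: measurable_fourier_u)
  have "g \<in> borel_measurable borel" unfolding g_def by measurable
  moreover have "AE \<xi> in lborel. \<forall>k. U (t + e k) \<xi> = fourier (u (t + e k)) \<xi>"
    unfolding AE_all_countable using U e(1) t by (simp add: less_imp_le)
  then have "AE \<xi> in lborel. g \<xi> = Y t \<xi>"
    using U[OF t] sol
  proof eventually_elim
    case (elim \<xi>)
    then interpret damped_oscillator "norm \<xi> powr (2 * \<delta>)" "norm \<xi> powr (2 * \<sigma>)" "\<lambda>t. U t \<xi>" "\<lambda>t. V t \<xi>" by simp
    have "((\<lambda>y. norm ((U y \<xi> - U t \<xi>) - (y - t) *\<^sub>R V t \<xi>) / norm (y - t)) \<longlongrightarrow> 0) (at t within {0..})"
      using y[OF t] unfolding has_vector_derivative_def has_derivative_iff_norm by simp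
    moreover have "filterlim (\<lambda>k. t + e k) (at t within {0..}) sequentially"
      unfolding filterlim_at using e(1) t tendsto_add[OF tendsto_const[of t] e(2)]
      by (auto simp: less_imp_le less_imp_neq[symmetric] add_nonneg_nonneg)
    ultimately have "(\<lambda>k. norm ((U (t + e k) \<xi> - U t \<xi>) - (t + e k - t) *\<^sub>R V t \<xi>) / norm (t + e k - t)) \<longlonglongrightarrow> 0"
      by (rule filterlim_compose)
    moreover have "norm ((U (t + e k) \<xi> - U t \<xi>) - (t + e k - t) *\<^sub>R V t \<xi>) / norm (t + e k - t) =
        norm ((fourier (u (t + e k)) \<xi> - fourier (u t) \<xi>) /\<^sub>R e k - V t \<xi>)" for k
    proof -
      have "(fourier (u (t + e k)) \<xi> - fourier (u t) \<xi>) /\<^sub>R e k - V t \<xi> =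
          inverse (e k) *\<^sub>R ((U (t + e k) \<xi> - U t \<xi>) - (t + e k - t) *\<^sub>R V t \<xi>)"
        using elim(1,2) e(1)[of k] by (simp add: scaleR_diff_right)
      then show ?thesis by (simp add: divide_inverse mult.commute)
    qed
    ultimately have "(\<lambda>k. (fourier (u (t + e k)) \<xi> - fourier (u t) \<xi>) /\<^sub>R e k - V t \<xi>) \<longlonglongrightarrow> 0"
      by (simp add: tendsto_norm_zero_iff)
    then have "(\<lambda>k. (fourier (u (t + e k)) \<xi> - fourier (u t) \<xi>) /\<^sub>R e k) \<longlonglongrightarrow> V t \<xi>"
      by (rule LIM_zero_cancel)
    then show ?case using False unfolding g_def Y_def by (simp add: limI)
  qed
  ultimately show ?thesis by blast
qed

text \<open>A measurable version of \<open>Y t\<close>, so that norms of it are meaningful.\<close>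

definition rep :: "real \<Rightarrow> real ^ 'n \<Rightarrow> complex" where
  "rep t = (SOME g. g \<in> borel_measurable borel \<and> (AE \<xi> in lborel. g \<xi> = Y t \<xi>))"

lemma rep: "t \<ge> 0 \<Longrightarrow> rep t \<in> borel_measurable borel" "t \<ge> 0 \<Longrightarrow> AE \<xi> in lborel. rep t \<xi> = Y t \<xi>"
  using someI_ex[OF measurable_version, of t] by (auto simp: rep_def)

abbreviation wave :: "real \<Rightarrow> real ^ 'n \<Rightarrow> complex" where
  "wave t \<xi> \<equiv> complex_of_real (norm \<xi> powr s) * rep t \<xi>"

lemma low_rep:
  assumes t: "t \<ge> 0"
  shows "AE \<xi> in lborel. norm \<xi> < r\<^sub>0 \<longrightarrow> wave t \<xi> = low t \<xi>"
  using rep(2)[OF t] sol AE_nonzero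
proof eventually_elim
  case (elim \<xi>)
  then show ?case
    using explicit_W[of "norm \<xi>" "\<lambda>t. U t \<xi>" "\<lambda>t. V t \<xi>" t] t
    by (auto simp: low_def Y_def scaleR_conv_of_real)
qed

text \<open>Both squares in the energy are nonnegative, so an energy estimate bounds velocity and scaled
  displacement separately, and linearly in the data.\<close>

lemma energy_bound:
  assumes osc: "damped_oscillator (r powr (2 * \<delta>)) (r powr (2 * \<sigma>)) y v" and r: "r \<ge> 0" and t: "t \<ge> 0"
    and le: "(norm (v t))\<^sup>2 + r powr (2 * \<sigma>) * (norm (y t))\<^sup>2 \<le> C\<^sup>2 * ((norm (v 0))\<^sup>2 + r powr (2 * \<sigma>) * (norm (y 0))\<^sup>2)"
    and C: "C \<ge> 0"
  shows "norm (v t) \<le> C * (norm (v 0) + r powr \<sigma> * norm (y 0))"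
    and "r powr \<sigma> * norm (y t) \<le> C * (norm (v 0) + r powr \<sigma> * norm (y 0))"
proof -
  have b: "r powr (2 * \<sigma>) = (r powr \<sigma>)\<^sup>2" by (simp add: power2_eq_square powr_add[symmetric])
  define x z where "x = norm (v 0)" and "z = r powr \<sigma> * norm (y 0)"
  have xz: "x \<ge> 0" "z \<ge> 0" by (simp_all add: x_def z_def)
  have "(norm (v t))\<^sup>2 + (r powr \<sigma> * norm (y t))\<^sup>2 \<le> C\<^sup>2 * (x\<^sup>2 + z\<^sup>2)"
    using le unfolding b x_def z_def by (simp add: power_mult_distrib)
  also have "\<dots> \<le> C\<^sup>2 * (x + z)\<^sup>2"
    using xz by (intro mult_left_mono) (auto simp: power2_sum)
  finally have sq: "(norm (v t))\<^sup>2 + (r powr \<sigma> * norm (y t))\<^sup>2 \<le> (C * (x + z))\<^sup>2" by (simp add: power_mult_distrib)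
  have nonneg: "0 \<le> C * (x + z)" using C xz by simp
  have "(norm (v t))\<^sup>2 \<le> (C * (x + z))\<^sup>2"
    using sq zero_le_power2[of "r powr \<sigma> * norm (y t)"] by linarith
  then show "norm (v t) \<le> C * (norm (v 0) + r powr \<sigma> * norm (y 0))"
    using nonneg unfolding x_def z_def by (rule power2_le_imp_le)
  have "(r powr \<sigma> * norm (y t))\<^sup>2 \<le> (C * (x + z))\<^sup>2"
    using sq zero_le_power2[of "norm (v t)"] by linarith
  then show "r powr \<sigma> * norm (y t) \<le> C * (norm (v 0) + r powr \<sigma> * norm (y 0))"
    using nonneg unfolding x_def z_def by (rule power2_le_imp_le)
qed

lemma solution_bound:
  "AE \<xi> in lborel. \<forall>t\<ge>0. norm (V t \<xi>) \<le> norm (B \<xi>) + norm \<xi> powr \<sigma> * norm (A \<xi>) \<and>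
    norm \<xi> powr \<sigma> * norm (U t \<xi>) \<le> norm (B \<xi>) + norm \<xi> powr \<sigma> * norm (A \<xi>)"
  using sol
proof eventually_elim
  case (elim \<xi>)
  then interpret damped_oscillator "norm \<xi> powr (2 * \<delta>)" "norm \<xi> powr (2 * \<sigma>)" "\<lambda>t. U t \<xi>" "\<lambda>t. V t \<xi>" by simp
  show ?case
  proof (intro allI impI)
    fix t :: real assume t: "t \<ge> 0"
    from energy_bound[OF damped_oscillator_axioms norm_ge_zero t, of 1] energy_nonincreasing[OF powr_ge_zero t] elim
    show "norm (V t \<xi>) \<le> norm (B \<xi>) + norm \<xi> powr \<sigma> * norm (A \<xi>) \<and>
        norm \<xi> powr \<sigma> * norm (U t \<xi>) \<le> norm (B \<xi>) + norm \<xi> powr \<sigma> * norm (A \<xi>)" by simp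
  qed
qed

text \<open>Outside the ball of radius \<open>r\<^sub>0\<close> the squared damping is at most \<open>K = 16/3\<close> times the stiffness. The
  energy then decays at the rate \<open>r\<^sub>0\<^bsup>2\<delta>\<^esup> / (3 (1 + K)) = r\<^sub>0\<^bsup>2\<delta>\<^esup> / 19\<close>, and its square root at half this
  rate.\<close>

definition rate :: real where "rate = r\<^sub>0 powr (2 * \<delta>) / 38"

lemma rate_pos: "rate > 0"
  using exponents by (simp add: rate_def)

definition outer_data :: "real ^ 'n \<Rightarrow> complex" where
  "outer_data \<xi> = complex_of_real (if norm \<xi> < r\<^sub>0 then 0 else norm \<xi> powr (s + (real j - 1) * \<sigma>)) * complex_of_real (norm (B \<xi>))
    + complex_of_real (if norm \<xi> < r\<^sub>0 then 0 else norm \<xi> powr (s + real j * \<sigma>)) * complex_of_real (norm (A \<xi>))"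

lemma square_integrable_weighted_norm:
  assumes "square_integrable (\<lambda>\<xi>. complex_of_real (w \<xi>) * f \<xi>)" "f \<in> borel_measurable borel" "w \<in> borel_measurable borel"
  shows "square_integrable (\<lambda>\<xi>. complex_of_real (w \<xi>) * complex_of_real (norm (f \<xi>)))"
proof (rule square_integrable_bound[OF assms(1)])
  note [measurable] = assms(2,3)
  show "(\<lambda>\<xi>. complex_of_real (w \<xi>) * complex_of_real (norm (f \<xi>))) \<in> borel_measurable borel" by measurable
qed (simp add: norm_mult)

lemma square_integrable_outer_data: "square_integrable outer_data"
proof -
  have "square_integrable (\<lambda>\<xi>. complex_of_real (if norm \<xi> < r\<^sub>0 then 0 else norm \<xi> powr (s + (real j - 1) * \<sigma>)) * B \<xi>)"
    by (rule square_integrable_powr_weight_outside[OF reg_B]) (use exponents in auto)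
  moreover have "square_integrable (\<lambda>\<xi>. complex_of_real (if norm \<xi> < r\<^sub>0 then 0 else norm \<xi> powr (s + real j * \<sigma>)) * A \<xi>)"
    by (rule square_integrable_powr_weight_outside[OF reg_A]) (use exponents s_nonneg sigma_pos in auto)
  ultimately show ?thesis
    unfolding outer_data_def by (intro square_integrable_add square_integrable_weighted_norm) auto
qed

text \<open>The weights in \<open>outer_data\<close> reflect that the energy controls \<open>r\<^sup>\<sigma>\<close> times the displacement: for
  \<open>j = 0\<close> this gains \<open>\<sigma>\<close> derivatives on the initial velocity, for \<open>j = 1\<close> it costs \<open>\<sigma>\<close> derivatives on the
  initial position.\<close>

lemma high_decay:
  assumes t: "t \<ge> 0"
  shows "AE \<xi> in lborel. \<not> norm \<xi> < r\<^sub>0 \<longrightarrow>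
    norm (wave t \<xi>) \<le> norm (complex_of_real (2 * exp (- rate * t)) * outer_data \<xi>)"
  using rep(2)[OF t] sol
proof eventually_elim
  case (elim \<xi>)
  then interpret damped_oscillator "norm \<xi> powr (2 * \<delta>)" "norm \<xi> powr (2 * \<sigma>)" "\<lambda>t. U t \<xi>" "\<lambda>t. V t \<xi>" by simp
  define r where "r = norm \<xi>"
  show ?case
  proof
    assume "\<not> norm \<xi> < r\<^sub>0"
    then have r: "r \<ge> r\<^sub>0" "r > 0" using exponents by (auto simp: r_def)
    have K: "(r powr (2 * \<delta>))\<^sup>2 \<le> 16 / 3 * r powr (2 * \<sigma>)"
    proof -
      have "3 / 16 = r\<^sub>0 powr m" using exponents by (simp add: r\<^sub>0_def powr_powr)
      also have "\<dots> \<le> r powr m" using r exponents by (intro powr_mono2) auto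
      finally have "r powr (4 * \<delta>) * (3 / 16) \<le> r powr (4 * \<delta>) * r powr m" by (intro mult_left_mono) auto
      also have "\<dots> = r powr (2 * \<sigma>)" using exponents by (simp add: powr_add[symmetric])
      finally show ?thesis by (simp add: power2_eq_square powr_add[symmetric])
    qed
    have "3 * exp (- (r powr (2 * \<delta>) / (3 * (1 + 16 / 3))) * t) \<le> 4 * exp (- (2 * rate) * t)"
    proof (rule mult_mono)
      have "2 * rate \<le> r powr (2 * \<delta>) / 19"
        using powr_mono2[of "2 * \<delta>" r\<^sub>0 r] r delta_pos exponents by (simp add: rate_def)
      then have "2 * rate * t \<le> r powr (2 * \<delta>) / 19 * t" using t by (intro mult_right_mono)
      then show "exp (- (r powr (2 * \<delta>) / (3 * (1 + 16 / 3))) * t) \<le> exp (- (2 * rate) * t)" by simp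
    qed auto
    also have "\<dots> = (2 * exp (- rate * t))\<^sup>2" by (simp add: power2_eq_square exp_add[symmetric])
    finally have le: "3 * exp (- (r powr (2 * \<delta>) / (3 * (1 + 16 / 3))) * t) \<le> (2 * exp (- rate * t))\<^sup>2" .
    have "(norm (V t \<xi>))\<^sup>2 + r powr (2 * \<sigma>) * (norm (U t \<xi>))\<^sup>2 \<le>
        3 * exp (- (r powr (2 * \<delta>) / (3 * (1 + 16 / 3))) * t) * ((norm (V 0 \<xi>))\<^sup>2 + r powr (2 * \<sigma>) * (norm (U 0 \<xi>))\<^sup>2)"
      using energy_decay[of "16 / 3" t] K t r by (simp add: r_def)
    also have "\<dots> \<le> (2 * exp (- rate * t))\<^sup>2 * ((norm (V 0 \<xi>))\<^sup>2 + r powr (2 * \<sigma>) * (norm (U 0 \<xi>))\<^sup>2)"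
      by (intro mult_right_mono le) auto
    finally have E: "(norm (V t \<xi>))\<^sup>2 + r powr (2 * \<sigma>) * (norm (U t \<xi>))\<^sup>2 \<le>
        (2 * exp (- rate * t))\<^sup>2 * ((norm (V 0 \<xi>))\<^sup>2 + r powr (2 * \<sigma>) * (norm (U 0 \<xi>))\<^sup>2)" .
    note bounds = energy_bound[OF damped_oscillator_axioms norm_ge_zero t E[unfolded r_def]]
    have data: "U 0 \<xi> = A \<xi>" "V 0 \<xi> = B \<xi>" using elim by auto
    define X where "X = 2 * exp (- rate * t) * (norm (B \<xi>) + r powr \<sigma> * norm (A \<xi>))"
    have "r powr s * norm (Y t \<xi>) \<le> r powr (s + (real j - 1) * \<sigma>) * X"
    proof (cases "j = 0")
      case True
      have "r powr \<sigma> * norm (U t \<xi>) \<le> X" using bounds(2) by (simp add: X_def data r_def)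
      then have "r powr (s - \<sigma>) * (r powr \<sigma> * norm (U t \<xi>)) \<le> r powr (s - \<sigma>) * X" by (intro mult_left_mono) auto
      moreover have "r powr (s - \<sigma>) * (r powr \<sigma> * norm (U t \<xi>)) = r powr s * norm (U t \<xi>)"
        by (simp add: mult.assoc[symmetric] powr_add[symmetric])
      ultimately have "r powr s * norm (U t \<xi>) \<le> r powr (s - \<sigma>) * X" by simp
      moreover have "Y t \<xi> = U t \<xi>" "s + (real j - 1) * \<sigma> = s - \<sigma>" using True unfolding Y_def by simp_all
      ultimately show ?thesis by (simp only:)
    next
      case False
      have "norm (V t \<xi>) \<le> X" using bounds(1) by (simp add: X_def data r_def)
      then have "r powr s * norm (V t \<xi>) \<le> r powr s * X" by (intro mult_left_mono) auto
      moreover have "Y t \<xi> = V t \<xi>" "s + (real j - 1) * \<sigma> = s" using False j unfolding Y_def by (simp_all add: le_Suc_eq)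
      ultimately show ?thesis by (simp only:)
    qed
    also have "\<dots> = 2 * exp (- rate * t) * (r powr (s + (real j - 1) * \<sigma>) * norm (B \<xi>) + r powr (s + real j * \<sigma>) * norm (A \<xi>))"
    proof -
      have "r powr (s + (real j - 1) * \<sigma>) * r powr \<sigma> = r powr (s + real j * \<sigma>)"
        by (simp add: powr_add[symmetric] algebra_simps)
      then have "r powr (s + real j * \<sigma>) * norm (A \<xi>) = r powr (s + (real j - 1) * \<sigma>) * (r powr \<sigma> * norm (A \<xi>))"
        by (simp add: mult.assoc)
      then show ?thesis unfolding X_def by (simp only: distrib_left mult.left_commute)
    qed
    also have "\<dots> = norm (complex_of_real (2 * exp (- rate * t)) * outer_data \<xi>)"
      using \<open>\<not> norm \<xi> < r\<^sub>0\<close> unfolding outer_data_def norm_mult of_real_mult[symmetric] of_real_add[symmetric] norm_of_real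
      by (simp add: r_def)
    finally show "norm (wave t \<xi>) \<le> norm (complex_of_real (2 * exp (- rate * t)) * outer_data \<xi>)"
      using elim(1) by (simp add: norm_mult r_def)
  qed
qed

lemma near_low:
  assumes t: "t \<ge> 0"
  shows "AE \<xi> in lborel. norm (wave t \<xi> - low t \<xi>) \<le>
    norm (complex_of_real (2 * exp (- rate * t)) * outer_data \<xi>)"
  using low_rep[OF t] high_decay[OF t]
proof eventually_elim
  case (elim \<xi>)
  show ?case
  proof (cases "norm \<xi> < r\<^sub>0")
    case False
    then have "low t \<xi> = 0" by (simp add: low_def)
    then show ?thesis using elim(2) False by simp
  qed (use elim in simp)
qed

lemma square_integrable_rep_minus_low:
  assumes t: "t \<ge> 0"
  shows "square_integrable (\<lambda>\<xi>. wave t \<xi> - low t \<xi>)"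
proof (rule square_integrable_bound[OF square_integrable_cmult[OF square_integrable_outer_data] _ near_low[OF t]])
  note [measurable] = rep(1)[OF t]
  show "(\<lambda>\<xi>. wave t \<xi> - low t \<xi>) \<in> borel_measurable borel" by measurable
qed

lemma square_integrable_rep:
  assumes t: "t \<ge> 1"
  shows "square_integrable (\<lambda>\<xi>. wave t \<xi>)"
proof -
  have "square_integrable (\<lambda>\<xi>. (wave t \<xi> - low t \<xi>) + low t \<xi>)"
    using t by (intro square_integrable_add square_integrable_rep_minus_low square_integrable_low) auto
  then show ?thesis by simp
qed

lemma exp_negligible: "((\<lambda>t. exp (- rate * t) / t powr decay_exponent) \<longlongrightarrow> 0) at_top"
proof -
  obtain C where C: "C > 0" "\<And>t. t \<ge> 1 \<Longrightarrow> t powr (- decay_exponent) * exp (- rate * t powr 1) \<le> C * t powr (- 1)"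
    using powr_exp_bound[OF rate_pos, of 1] by (metis zero_less_one)
  show ?thesis
  proof (rule Lim_null_comparison)
    show "\<forall>\<^sub>F t in at_top. norm (exp (- rate * t) / t powr decay_exponent) \<le> C * t powr (- 1)"
      using eventually_ge_at_top[of 1]
      by eventually_elim (use C(2) in \<open>auto simp: powr_minus divide_inverse mult.commute\<close>)
    show "((\<lambda>t. C * t powr (- 1)) \<longlongrightarrow> 0) at_top"
      by (intro tendsto_mult_right_zero tendsto_neg_powr filterlim_ident) simp
  qed
qed

theorem frequency_asymptotics:
  "((\<lambda>t. L2_norm (\<lambda>\<xi>. wave t \<xi> - B 0 * prof t \<xi>) / t powr decay_exponent) \<longlongrightarrow> 0) at_top"
proof (rule Lim_null_comparison)
  show "\<forall>\<^sub>F t in at_top. norm (L2_norm (\<lambda>\<xi>. wave t \<xi> - B 0 * prof t \<xi>) / t powr decay_exponent) \<le>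
      2 * L2_norm outer_data * (exp (- rate * t) / t powr decay_exponent) + L2_norm (\<lambda>\<xi>. low t \<xi> - B 0 * prof t \<xi>) / t powr decay_exponent"
    using eventually_ge_at_top[of 1]
  proof eventually_elim
    case (elim t)
    then have t: "t \<ge> 0" "t > 0" by auto
    have "L2_norm (\<lambda>\<xi>. wave t \<xi> - B 0 * prof t \<xi>) \<le>
        L2_norm (\<lambda>\<xi>. wave t \<xi> - low t \<xi>) + L2_norm (\<lambda>\<xi>. low t \<xi> - B 0 * prof t \<xi>)"
      using elim t by (intro L2_norm_triangle_diff square_integrable_rep square_integrable_low square_integrable_cmult square_integrable_prof)
    also have "L2_norm (\<lambda>\<xi>. wave t \<xi> - low t \<xi>) \<le> L2_norm (\<lambda>\<xi>. complex_of_real (2 * exp (- rate * t)) * outer_data \<xi>)"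
      by (rule L2_norm_mono_AE[OF square_integrable_cmult[OF square_integrable_outer_data] near_low[OF t(1)]])
    also have "\<dots> = 2 * exp (- rate * t) * L2_norm outer_data"
      unfolding L2_norm_cmult by simp
    finally have "L2_norm (\<lambda>\<xi>. wave t \<xi> - B 0 * prof t \<xi>) \<le>
        2 * exp (- rate * t) * L2_norm outer_data + L2_norm (\<lambda>\<xi>. low t \<xi> - B 0 * prof t \<xi>)" by simp
    then have "L2_norm (\<lambda>\<xi>. wave t \<xi> - B 0 * prof t \<xi>) / t powr decay_exponent \<le>
        (2 * exp (- rate * t) * L2_norm outer_data + L2_norm (\<lambda>\<xi>. low t \<xi> - B 0 * prof t \<xi>)) / t powr decay_exponent"
      by (rule divide_right_mono) simp
    then show ?case by (simp add: add_divide_distrib L2_norm_nonneg mult_ac)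
  qed
  have "((\<lambda>t. 2 * L2_norm outer_data * (exp (- rate * t) / t powr decay_exponent) + L2_norm (\<lambda>\<xi>. low t \<xi> - B 0 * prof t \<xi>) / t powr decay_exponent) \<longlongrightarrow>
      2 * L2_norm outer_data * 0 + 0) at_top"
    by (intro tendsto_add tendsto_mult_left exp_negligible low_asymptotics)
  then show "((\<lambda>t. 2 * L2_norm outer_data * (exp (- rate * t) / t powr decay_exponent) + L2_norm (\<lambda>\<xi>. low t \<xi> - B 0 * prof t \<xi>) / t powr decay_exponent) \<longlongrightarrow> 0) at_top"
    by simp
qed

end

section \<open>Norms of the solution in physical space\<close>

context damped_wave
begin

definition symbol :: "real \<Rightarrow> real ^ 'n \<Rightarrow> complex" where
  "symbol t \<xi> = complex_of_real (exp (- t * norm \<xi> powr (2 * (\<sigma> - \<delta>))) / norm \<xi> powr (2 * \<delta>))"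

lemma symbol_powr: "symbol t \<xi> = complex_of_real (norm \<xi> powr (- 2 * \<delta>) * exp (- t * norm \<xi> powr q))"
  by (simp add: symbol_def q_def powr_minus divide_inverse mult.commute)

lemma is_L2_fourier_profile:
  assumes "t > 0"
  shows "is_L2_fourier (profile \<sigma> \<delta> t) (symbol t)"
proof -
  have "square_integrable (\<lambda>\<xi>::real ^ 'n. complex_of_real (norm \<xi> powr (- 2 * \<delta>) * exp (- t * norm \<xi> powr q)))"
    using assms exponents dim by (intro square_integrable_norm_powr_exp) auto
  then have "square_integrable (symbol t)" unfolding symbol_powr[abs_def] .
  then have "is_L2_fourier (inv_fourier (symbol t)) (symbol t)" by (rule is_L2_fourier_inv_fourier)
  then show ?thesis by (simp add: profile_def symbol_def[abs_def])
qed

lemma powr_symbol: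
  "complex_of_real (norm \<xi> powr s) * symbol t \<xi> = complex_of_real (norm \<xi> powr (s - 2 * \<delta>) * exp (- t * norm \<xi> powr q))"
  unfolding symbol_powr of_real_mult[symmetric] mult.assoc[symmetric] powr_add[symmetric] by simp

lemma square_integrable_powr_symbol:
  assumes "t > 0"
  shows "square_integrable (\<lambda>\<xi>. complex_of_real (norm \<xi> powr s) * symbol t \<xi>)"
  unfolding powr_symbol using assms exponents dim s_nonneg by (intro square_integrable_norm_powr_exp) auto

lemma symbol_derivative:
  "((\<lambda>t. complex_of_real (norm \<xi> powr s) * symbol t \<xi>) has_vector_derivative
     complex_of_real (norm \<xi> powr (s - 2 * \<delta>) * (- (norm \<xi> powr q)) * exp (- t * norm \<xi> powr q))) (at t)"
proof -
  have "((\<lambda>t. norm \<xi> powr (s - 2 * \<delta>) * exp (- t * norm \<xi> powr q)) has_real_derivative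
      norm \<xi> powr (s - 2 * \<delta>) * (- (norm \<xi> powr q)) * exp (- t * norm \<xi> powr q)) (at t)"
    by (auto intro!: derivative_eq_intros)
  then show ?thesis
    unfolding powr_symbol by (intro has_vector_derivative_of_real) (simp add: has_real_derivative_iff_has_vector_derivative)
qed

text \<open>For frequencies below \<open>1\<close> the weight is harmless; above \<open>1\<close> the energy, which does not increase,
  bounds the solution by the data.\<close>

lemma square_integrable_powr_fourier_u:
  assumes t: "t \<ge> 0"
  shows "square_integrable (\<lambda>\<xi>. complex_of_real (norm \<xi> powr s) * fourier (u t) \<xi>)"
proof -
  note F = is_L2_fourier_square_integrable(2)[OF is_L2_fourier_fourier[OF u[OF t]]]
  note [measurable] = measurable_fourier_u[OF t]
  define X where "X \<xi> = complex_of_real (if norm \<xi> < 1 then 0 else norm \<xi> powr (s - \<sigma>)) * complex_of_real (norm (B \<xi>))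
    + complex_of_real (if norm \<xi> < 1 then 0 else norm \<xi> powr s) * complex_of_real (norm (A \<xi>))" for \<xi>
  have "square_integrable (\<lambda>\<xi>. complex_of_real (if norm \<xi> < 1 then 0 else norm \<xi> powr (s - \<sigma>)) * B \<xi>)"
    by (rule square_integrable_powr_weight_outside[OF reg_B]) (use sigma_pos j in \<open>auto simp: le_Suc_eq\<close>)
  moreover have "square_integrable (\<lambda>\<xi>. complex_of_real (if norm \<xi> < 1 then 0 else norm \<xi> powr s) * A \<xi>)"
    by (rule square_integrable_powr_weight_outside[OF reg_A]) (use s_nonneg sigma_pos in auto)
  ultimately have X: "square_integrable X"
    unfolding X_def by (intro square_integrable_add square_integrable_weighted_norm) auto
  have Fn: "square_integrable (\<lambda>\<xi>. complex_of_real (norm (fourier (u t) \<xi>)))"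
    by (rule square_integrable_bound[OF F]) auto
  show ?thesis
  proof (rule square_integrable_bound[OF square_integrable_add[OF Fn X]])
    show "AE \<xi> in lborel. norm (complex_of_real (norm \<xi> powr s) * fourier (u t) \<xi>) \<le>
        norm (complex_of_real (norm (fourier (u t) \<xi>)) + X \<xi>)"
      using U[OF t] solution_bound sol
    proof eventually_elim
      case (elim \<xi>)
      have Xpos: "norm (complex_of_real (norm (fourier (u t) \<xi>)) + X \<xi>) = norm (fourier (u t) \<xi>) +
        ((if norm \<xi> < 1 then 0 else norm \<xi> powr (s - \<sigma>)) * norm (B \<xi>) + (if norm \<xi> < 1 then 0 else norm \<xi> powr s) * norm (A \<xi>))"
        unfolding X_def of_real_mult[symmetric] of_real_add[symmetric] norm_of_real by (rule abs_of_nonneg) auto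
      show ?case
      proof (cases "norm \<xi> < 1")
        case True
        then have "norm \<xi> powr s * norm (fourier (u t) \<xi>) \<le> 1 * norm (fourier (u t) \<xi>)"
          using s_nonneg by (intro mult_right_mono powr_le1) auto
        then show ?thesis unfolding Xpos using True by (simp add: norm_mult)
      next
        case False
        have "norm \<xi> powr (s - \<sigma>) * (norm \<xi> powr \<sigma> * norm (U t \<xi>)) \<le>
            norm \<xi> powr (s - \<sigma>) * (norm (B \<xi>) + norm \<xi> powr \<sigma> * norm (A \<xi>))"
          using elim(2) t by (intro mult_left_mono) auto
        moreover have "norm \<xi> powr (s - \<sigma>) * (norm \<xi> powr \<sigma> * x) = norm \<xi> powr s * x" for x
          by (simp add: mult.assoc[symmetric] powr_add[symmetric])
        ultimately have "norm \<xi> powr s * norm (U t \<xi>) \<le> norm \<xi> powr (s - \<sigma>) * norm (B \<xi>) + norm \<xi> powr s * norm (A \<xi>)"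
          by (simp add: distrib_left)
        then show ?thesis unfolding Xpos using False elim(1) by (simp add: norm_mult add_increasing)
      qed
    qed
  qed measurable
qed

text \<open>The error term is the case \<open>P = P\<^sub>1\<close> of the following, and the solution itself is the case
  \<open>P = 0\<close>.\<close>

context
  fixes P :: complex
begin

definition curve :: "real \<Rightarrow> real ^ 'n \<Rightarrow> complex" where
  "curve \<tau> = abs_D s (\<lambda>x. u \<tau> x - P * profile \<sigma> \<delta> \<tau> x)"

definition curve_hat :: "real \<Rightarrow> real ^ 'n \<Rightarrow> complex" where
  "curve_hat \<tau> \<xi> = complex_of_real (norm \<xi> powr s) * (fourier (u \<tau>) \<xi> - P * symbol \<tau> \<xi>)"

lemma is_L2_fourier_curve:
  assumes t: "t > 0"
  shows "is_L2_fourier (curve t) (curve_hat t)"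
  unfolding curve_def curve_hat_def
proof (rule is_L2_fourier_abs_D)
  show "is_L2_fourier (\<lambda>x. u t x - P * profile \<sigma> \<delta> t x) (\<lambda>\<xi>. fourier (u t) \<xi> - P * symbol t \<xi>)"
    using t by (intro is_L2_fourier_diff is_L2_fourier_cmult is_L2_fourier_profile is_L2_fourier_fourier u) auto
  have "square_integrable (\<lambda>\<xi>. complex_of_real (norm \<xi> powr s) * fourier (u t) \<xi> - P * (complex_of_real (norm \<xi> powr s) * symbol t \<xi>))"
    using t by (intro square_integrable_diff square_integrable_cmult square_integrable_powr_fourier_u square_integrable_powr_symbol) auto
  then show "square_integrable (\<lambda>\<xi>. complex_of_real (norm \<xi> powr s) * (fourier (u t) \<xi> - P * symbol t \<xi>))"
    by (simp add: right_diff_distrib mult.left_commute)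
qed

lemma L2_norm_curve_0:
  assumes t: "t > 0" and j0: "j = 0"
  shows "sqrt (2 * pi) ^ CARD('n) * L2_norm (curve t) = L2_norm (\<lambda>\<xi>. wave t \<xi> - P * prof t \<xi>)"
proof -
  note c = is_L2_fourier_curve[OF t]
  have t0: "t \<ge> 0" using t by simp
  note [measurable] = rep(1)[OF t0] square_integrable_measurable[OF is_L2_fourier_square_integrable(2)[OF c]]
  have prof: "prof t \<xi> = complex_of_real (norm \<xi> powr s) * symbol t \<xi>" for \<xi>
    unfolding powr_symbol prof_def using j0 by simp
  have "L2_norm (curve_hat t) = L2_norm (\<lambda>\<xi>. wave t \<xi> - P * prof t \<xi>)"
  proof (rule L2_norm_cong_AE)
    show "AE \<xi> in lborel. norm (curve_hat t \<xi>) = norm (wave t \<xi> - P * prof t \<xi>)"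
      using rep(2)[OF t0] U[OF t0]
    proof eventually_elim
      case (elim \<xi>)
      moreover have "Y t \<xi> = U t \<xi>" using j0 unfolding Y_def by simp
      ultimately have "rep t \<xi> = fourier (u t) \<xi>" by simp
      then show ?case unfolding curve_hat_def prof by (simp add: right_diff_distrib mult.left_commute)
    qed
  qed measurable
  then show ?thesis using is_L2_fourier_norm[OF c] by simp
qed

text \<open>The velocity is dominated by the energy of the data at all times. The time derivative of the profile
  is unbounded near time \<open>0\<close>, but after time \<open>1\<close> it is dominated by its value at time \<open>1\<close>.\<close>

lemma L2_norm_curve_1:
  assumes t: "t > 1" and j1: "j = 1"
  shows "sqrt (2 * pi) ^ CARD('n) * L2_norm (L2_time_deriv curve t) =
    L2_norm (\<lambda>\<xi>. wave t \<xi> - P * prof t \<xi>)"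
proof -
  have t0: "t \<ge> 0" using t by simp
  note [measurable] = rep(1)[OF t0]
  define g where "g \<xi> = wave t \<xi> - P * prof t \<xi>" for \<xi>
  define D where "D \<xi> = complex_of_real (norm \<xi> powr s) * complex_of_real (norm (B \<xi>)) +
    complex_of_real (norm \<xi> powr (s + \<sigma>)) * complex_of_real (norm (A \<xi>)) + complex_of_real (norm (P * prof 1 \<xi>))" for \<xi>
  have prof: "prof \<tau> \<xi> = complex_of_real (norm \<xi> powr (s - 2 * \<delta>) * (- (norm \<xi> powr q)) * exp (- \<tau> * norm \<xi> powr q))" for \<tau> \<xi>
    unfolding prof_def using j1 by simp
  have D: "square_integrable D"
  proof -
    have "square_integrable (\<lambda>\<xi>. complex_of_real (norm \<xi> powr s) * B \<xi>)"
      using square_integrable_powr_weight[of s B] reg_B j1 s_nonneg by (simp add: max_absorb1)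
    moreover have "square_integrable (\<lambda>\<xi>. complex_of_real (norm \<xi> powr (s + \<sigma>)) * A \<xi>)"
      using square_integrable_powr_weight[of "s + \<sigma>" A] reg_A j1 s_nonneg sigma_pos by simp
    moreover have "square_integrable (\<lambda>\<xi>. complex_of_real (norm (P * prof 1 \<xi>)))"
      by (rule square_integrable_bound[OF square_integrable_cmult[OF square_integrable_prof[of 1]]]) auto
    ultimately show ?thesis
      unfolding D_def by (intro square_integrable_add square_integrable_weighted_norm) auto
  qed
  have Dn: "norm (D \<xi>) = norm \<xi> powr s * (norm (B \<xi>) + norm \<xi> powr \<sigma> * norm (A \<xi>)) + norm (P * prof 1 \<xi>)" for \<xi>
    unfolding D_def of_real_mult[symmetric] of_real_add[symmetric] norm_of_real
    by (subst abs_of_nonneg) (auto simp: powr_add distrib_left mult.assoc)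
  have prof_le: "norm (prof \<tau> \<xi>) \<le> norm (prof 1 \<xi>)" if "\<tau> > 1" for \<tau> \<xi>
  proof -
    have "1 * norm \<xi> powr q \<le> \<tau> * norm \<xi> powr q" using that by (intro mult_right_mono) auto
    then have "exp (- \<tau> * norm \<xi> powr q) \<le> exp (- 1 * norm \<xi> powr q)" by simp
    then show ?thesis unfolding prof norm_of_real abs_mult by (intro mult_left_mono) auto
  qed
  have curve: "is_L2_fourier (curve \<tau>) (curve_hat \<tau>)" if "1 < \<tau>" for \<tau>
      using that by (intro is_L2_fourier_curve) simp
  have version: "AE \<xi> in lborel. curve_hat \<tau> \<xi> = complex_of_real (norm \<xi> powr s) * (U \<tau> \<xi> - P * symbol \<tau> \<xi>)" if "1 < \<tau>" for \<tau>
    proof -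
      have "\<tau> \<ge> 0" using that by simp
      from U[OF this] show ?thesis by eventually_elim (simp add: curve_hat_def)
    qed
  have deriv: "AE \<xi> in lborel. \<forall>\<tau>>1. ((\<lambda>\<tau>. complex_of_real (norm \<xi> powr s) * (U \<tau> \<xi> - P * symbol \<tau> \<xi>)) has_vector_derivative
        complex_of_real (norm \<xi> powr s) * V \<tau> \<xi> - P * prof \<tau> \<xi>) (at \<tau>) \<and>
        norm (complex_of_real (norm \<xi> powr s) * V \<tau> \<xi> - P * prof \<tau> \<xi>) \<le> norm (D \<xi>)"
      using sol solution_bound
    proof eventually_elim
      case (elim \<xi>)
      then interpret damped_oscillator "norm \<xi> powr (2 * \<delta>)" "norm \<xi> powr (2 * \<sigma>)" "\<lambda>t. U t \<xi>" "\<lambda>t. V t \<xi>" by simp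
      show ?case
      proof (intro allI impI conjI)
        fix \<tau> :: real assume \<tau>: "1 < \<tau>"
        have "at \<tau> within {0..} = at \<tau>"
          using \<tau> by (intro at_within_interior) (auto simp: interior_real_atLeast)
        then have "((\<lambda>t. U t \<xi>) has_vector_derivative V \<tau> \<xi>) (at \<tau>)" using y[of \<tau>] \<tau> by simp
        then have "((\<lambda>\<tau>. complex_of_real (norm \<xi> powr s) * U \<tau> \<xi> - P * (complex_of_real (norm \<xi> powr s) * symbol \<tau> \<xi>))
            has_vector_derivative complex_of_real (norm \<xi> powr s) * V \<tau> \<xi> - P * prof \<tau> \<xi>) (at \<tau>)"
          unfolding prof
          by (intro has_vector_derivative_diff bounded_linear.has_vector_derivative[OF bounded_linear_mult_right] symbol_derivative)
        then show "((\<lambda>\<tau>. complex_of_real (norm \<xi> powr s) * (U \<tau> \<xi> - P * symbol \<tau> \<xi>)) has_vector_derivative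
            complex_of_real (norm \<xi> powr s) * V \<tau> \<xi> - P * prof \<tau> \<xi>) (at \<tau>)"
          by (simp add: right_diff_distrib mult.left_commute)
        have "norm \<xi> powr s * norm (V \<tau> \<xi>) \<le> norm \<xi> powr s * (norm (B \<xi>) + norm \<xi> powr \<sigma> * norm (A \<xi>))"
          using elim(2) \<tau> by (intro mult_left_mono) auto
        moreover have "norm P * norm (prof \<tau> \<xi>) \<le> norm P * norm (prof 1 \<xi>)"
          by (intro mult_left_mono prof_le \<tau>) auto
        ultimately show "norm (complex_of_real (norm \<xi> powr s) * V \<tau> \<xi> - P * prof \<tau> \<xi>) \<le> norm (D \<xi>)"
          unfolding Dn using norm_triangle_ineq4[of "complex_of_real (norm \<xi> powr s) * V \<tau> \<xi>" "P * prof \<tau> \<xi>"]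
          by (simp add: norm_mult)
      qed
    qed
  have g_meas: "g \<in> borel_measurable borel" unfolding g_def by measurable
  have g_eq: "AE \<xi> in lborel. g \<xi> = complex_of_real (norm \<xi> powr s) * V t \<xi> - P * prof t \<xi>"
    using rep(2)[OF t0]
  proof eventually_elim
    case (elim \<xi>)
    moreover have "Y t \<xi> = V t \<xi>" using j1 unfolding Y_def by simp
    ultimately show ?case by (simp add: g_def)
  qed
  note g = has_L2_time_derivative_fourier[where a=1 and w=curve and F=curve_hat and D=D
      and G="\<lambda>\<tau> \<xi>. complex_of_real (norm \<xi> powr s) * (U \<tau> \<xi> - P * symbol \<tau> \<xi>)"
      and G'="\<lambda>\<tau> \<xi>. complex_of_real (norm \<xi> powr s) * V \<tau> \<xi> - P * prof \<tau> \<xi>",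
      OF t curve version deriv D g_meas g_eq]
  show ?thesis
    using is_L2_fourier_norm[OF is_L2_fourier_inv_fourier[OF g(1)]] L2_norm_time_deriv[OF g(2)]
    by (simp add: g_def[abs_def])
qed

lemma L2_norm_curve:
  assumes t: "t > 1"
  shows "sqrt (2 * pi) ^ CARD('n) * L2_norm ((L2_time_deriv ^^ j) (\<lambda>\<tau>. abs_D s (\<lambda>x. u \<tau> x - P * profile \<sigma> \<delta> \<tau> x)) t) =
    L2_norm (\<lambda>\<xi>. wave t \<xi> - P * prof t \<xi>)"
proof (cases "j = 0")
  case True
  then show ?thesis using L2_norm_curve_0 t by (simp add: curve_def[abs_def])
next
  case False
  then have j1: "j = 1" using j by simp
  have "(L2_time_deriv ^^ j) (\<lambda>\<tau>. abs_D s (\<lambda>x. u \<tau> x - P * profile \<sigma> \<delta> \<tau> x)) t = L2_time_deriv curve t"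
    unfolding curve_def[abs_def] j1 by simp
  then show ?thesis using L2_norm_curve_1[OF t j1] by (simp only:)
qed

end

theorem profile_asymptotics:
  "(\<lambda>t. L2_norm ((L2_time_deriv ^^ j) (\<lambda>\<tau>. abs_D s (\<lambda>x. u \<tau> x - B 0 * profile \<sigma> \<delta> \<tau> x)) t)) \<in> o[at_top](\<lambda>t. t powr decay_exponent)"
proof (rule smalloI_tendsto)
  define c where "c = sqrt (2 * pi) ^ CARD('n)"
  have c: "c > 0" by (simp add: c_def)
  have "((\<lambda>t. inverse c * (L2_norm (\<lambda>\<xi>. wave t \<xi> - B 0 * prof t \<xi>) / t powr decay_exponent)) \<longlongrightarrow> 0) at_top"
    by (intro tendsto_mult_right_zero frequency_asymptotics)
  then show "((\<lambda>t. L2_norm ((L2_time_deriv ^^ j) (\<lambda>\<tau>. abs_D s (\<lambda>x. u \<tau> x - B 0 * profile \<sigma> \<delta> \<tau> x)) t) / t powr decay_exponent) \<longlongrightarrow> 0) at_top"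
  proof (rule Lim_transform_eventually)
    show "\<forall>\<^sub>F t in at_top. inverse c * (L2_norm (\<lambda>\<xi>. wave t \<xi> - B 0 * prof t \<xi>) / t powr decay_exponent) =
        L2_norm ((L2_time_deriv ^^ j) (\<lambda>\<tau>. abs_D s (\<lambda>x. u \<tau> x - B 0 * profile \<sigma> \<delta> \<tau> x)) t) / t powr decay_exponent"
      using eventually_gt_at_top[of 1]
    proof eventually_elim
      case (elim t)
      show ?case unfolding L2_norm_curve[OF elim, symmetric] using c by (simp add: c_def[symmetric])
    qed
  qed
  show "\<forall>\<^sub>F t in at_top. t powr decay_exponent \<noteq> 0"
    using eventually_gt_at_top[of 0] by eventually_elim simp
qed

text \<open>Eventually the error is at most half the norm of the multiple \<open>B 0\<close> of the profile, which is an exact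
  power of \<open>t\<close>.\<close>

theorem two_sided_decay:
  assumes "B 0 \<noteq> 0"
  shows "\<exists>C\<^sub>1>0. \<exists>C\<^sub>2>0. \<forall>\<^sub>F t in at_top.
    C\<^sub>1 * t powr decay_exponent \<le> L2_norm ((L2_time_deriv ^^ j) (\<lambda>\<tau>. abs_D s (u \<tau>)) t) \<and>
    L2_norm ((L2_time_deriv ^^ j) (\<lambda>\<tau>. abs_D s (u \<tau>)) t) \<le> C\<^sub>2 * t powr decay_exponent"
proof -
  define c where "c = sqrt (2 * pi) ^ CARD('n)"
  have c: "c > 0" by (simp add: c_def)
  define L where "L = norm (B 0) * L2_norm (prof 1)"
  have L: "L > 0" using assms L2_norm_prof_pos by (simp add: L_def)
  have "\<forall>\<^sub>F t in at_top. L2_norm (\<lambda>\<xi>. wave t \<xi> - B 0 * prof t \<xi>) / t powr decay_exponent < L / 2"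
    using L by (intro order_tendstoD(2)[OF frequency_asymptotics]) simp
  then have "\<forall>\<^sub>F t in at_top. L / (2 * c) * t powr decay_exponent \<le> L2_norm ((L2_time_deriv ^^ j) (\<lambda>\<tau>. abs_D s (u \<tau>)) t) \<and>
    L2_norm ((L2_time_deriv ^^ j) (\<lambda>\<tau>. abs_D s (u \<tau>)) t) \<le> 2 * L / c * t powr decay_exponent"
    using eventually_gt_at_top[of 1]
  proof eventually_elim
    case (elim t)
    define R where "R = (\<lambda>\<xi>. wave t \<xi>)"
    define N where "N = L2_norm ((L2_time_deriv ^^ j) (\<lambda>\<tau>. abs_D s (u \<tau>)) t)"
    have t: "t > 0" "t \<ge> 1" using elim by auto
    have tk: "t powr decay_exponent > 0" using t by simp
    have N: "c * N = L2_norm R"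
      using L2_norm_curve[OF elim(2), of 0] by (simp add: c_def N_def R_def)
    have near: "L2_norm (\<lambda>\<xi>. R \<xi> - B 0 * prof t \<xi>) < L / 2 * t powr decay_exponent"
      using elim(1) tk by (simp add: R_def field_simps)
    have "L2_norm (\<lambda>\<xi>. B 0 * prof t \<xi>) = L * t powr decay_exponent"
      unfolding L2_norm_cmult L2_norm_prof[OF t(1)] by (simp add: L_def)
    moreover have "\<bar>L2_norm R - L2_norm (\<lambda>\<xi>. B 0 * prof t \<xi>)\<bar> \<le> L2_norm (\<lambda>\<xi>. R \<xi> - B 0 * prof t \<xi>)"
      using t unfolding R_def
      by (intro L2_norm_diff_bound square_integrable_rep square_integrable_cmult square_integrable_prof) auto
    ultimately have "L / 2 * t powr decay_exponent \<le> c * N" "c * N \<le> 2 * (L * t powr decay_exponent)"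
      using near mult_pos_pos[OF L tk] unfolding N by (auto simp: abs_le_iff)
    then have "L / (2 * c) * t powr decay_exponent \<le> N \<and> N \<le> 2 * L / c * t powr decay_exponent"
      using c by (simp add: field_simps)
    then show ?case by (simp only: N_def)
  qed
  then show ?thesis
    using L c by (intro exI[of _ "L / (2 * c)"] exI[of _ "2 * L / c"] conjI) auto
qed

end

theorem theorem1p1:
  fixes u\<^sub>0 u\<^sub>1 :: "real ^ 'n \<Rightarrow> complex"
    and u :: "real \<Rightarrow> real ^ 'n \<Rightarrow> complex"
    and \<sigma> \<delta>\<^sub>1 s :: real and j :: nat
  defines "P\<^sub>1 \<equiv> (\<integral>x. u\<^sub>1 x \<partial>lborel)"
    and "\<kappa> \<equiv> - real CARD('n) / (4 * (\<sigma> - \<delta>\<^sub>1)) - s / (2 * (\<sigma> - \<delta>\<^sub>1)) - real j + \<delta>\<^sub>1 / (\<sigma> - \<delta>\<^sub>1)"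
  assumes "\<sigma> \<ge> 1" and "0 < \<delta>\<^sub>1" and "\<delta>\<^sub>1 < \<sigma> / 2" and "j \<in> {0, 1}" and "s \<ge> 0"
    and "real CARD('n) > 4 * \<delta>\<^sub>1"
    and "integrable lborel u\<^sub>0" and "u\<^sub>0 \<in> sobolev_space (s + real j * \<sigma>)"
    and "integrable lborel u\<^sub>1" and "u\<^sub>1 \<in> sobolev_space (max (s + (real j - 1) * \<sigma>) 0)"
    and "sobolev_solution \<sigma> \<delta>\<^sub>1 u\<^sub>0 u\<^sub>1 u"
  shows "(\<lambda>t. L2_norm ((L2_time_deriv ^^ j)
             (\<lambda>\<tau>. abs_D s (\<lambda>x. u \<tau> x - P\<^sub>1 * profile \<sigma> \<delta>\<^sub>1 \<tau> x)) t))
           \<in> o[at_top](\<lambda>t. t powr \<kappa>)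
         \<and> (P\<^sub>1 \<noteq> 0 \<longrightarrow>
             (\<exists>C\<^sub>1>0. \<exists>C\<^sub>2>0. \<forall>\<^sub>F t in at_top.
                C\<^sub>1 * t powr \<kappa> \<le> L2_norm ((L2_time_deriv ^^ j) (\<lambda>\<tau>. abs_D s (u \<tau>)) t) \<and>
                L2_norm ((L2_time_deriv ^^ j) (\<lambda>\<tau>. abs_D s (u \<tau>)) t) \<le> C\<^sub>2 * t powr \<kappa>))"
proof -
  note data = assms(3-)
  have f0: "fourier u\<^sub>0 = fourier_integral u\<^sub>0" and f1: "fourier u\<^sub>1 = fourier_integral u\<^sub>1"
    using data by (simp_all add: fourier_def)
  define M where "M = max (\<integral>x. norm (u\<^sub>0 x) \<partial>lborel) (\<integral>x. norm (u\<^sub>1 x) \<partial>lborel)"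
  \<comment> \<open>The transform \<open>U\<close> with its velocity \<open>V\<close> is an instance of the oscillator at almost every frequency.\<close>
  obtain U V where u: "\<And>t. t \<ge> 0 \<Longrightarrow> square_integrable (u t)"
    and U: "\<And>t. t \<ge> 0 \<Longrightarrow> AE \<xi> in lborel. U t \<xi> = fourier (u t) \<xi>"
    and sol: "AE \<xi> in lborel.
           U 0 \<xi> = fourier u\<^sub>0 \<xi> \<and> V 0 \<xi> = fourier u\<^sub>1 \<xi> \<and>
           (\<forall>t\<ge>0.
              ((\<lambda>\<tau>. U \<tau> \<xi>) has_vector_derivative V t \<xi>) (at t within {0..}) \<and>
              (\<exists>A. ((\<lambda>\<tau>. V \<tau> \<xi>) has_vector_derivative A) (at t within {0..}) \<and>
                   A + complex_of_real (norm \<xi> powr (2 * \<delta>\<^sub>1)) * V t \<xi>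
                     + complex_of_real (norm \<xi> powr (2 * \<sigma>)) * U t \<xi> = 0))"
    using data(11) unfolding sobolev_solution_def by blast
  interpret damped_wave \<sigma> \<delta>\<^sub>1 s j "fourier_integral u\<^sub>0" "fourier_integral u\<^sub>1" M u U V
  proof
    show "AE \<xi> in lborel. U 0 \<xi> = fourier_integral u\<^sub>0 \<xi> \<and> V 0 \<xi> = fourier_integral u\<^sub>1 \<xi> \<and>
      damped_oscillator (norm \<xi> powr (2 * \<delta>\<^sub>1)) (norm \<xi> powr (2 * \<sigma>)) (\<lambda>t. U t \<xi>) (\<lambda>t. V t \<xi>)"
      using sol
    proof eventually_elim
      case (elim \<xi>)
      have "damped_oscillator (norm \<xi> powr (2 * \<delta>\<^sub>1)) (norm \<xi> powr (2 * \<sigma>)) (\<lambda>t. U t \<xi>) (\<lambda>t. V t \<xi>)"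
      proof
        fix t :: real assume t: "t \<ge> 0"
        show "((\<lambda>t. U t \<xi>) has_vector_derivative V t \<xi>) (at t within {0..})" using elim t by blast
        obtain A where A: "((\<lambda>\<tau>. V \<tau> \<xi>) has_vector_derivative A) (at t within {0..})"
          "A + complex_of_real (norm \<xi> powr (2 * \<delta>\<^sub>1)) * V t \<xi> + complex_of_real (norm \<xi> powr (2 * \<sigma>)) * U t \<xi> = 0"
          using elim t by blast
        have "A = - (norm \<xi> powr (2 * \<delta>\<^sub>1) *\<^sub>R V t \<xi>) - norm \<xi> powr (2 * \<sigma>) *\<^sub>R U t \<xi>"
          using A(2) by (simp add: scaleR_conv_of_real algebra_simps eq_neg_iff_add_eq_0)
        then show "((\<lambda>t. V t \<xi>) has_vector_derivative
            - (norm \<xi> powr (2 * \<delta>\<^sub>1) *\<^sub>R V t \<xi>) - norm \<xi> powr (2 * \<sigma>) *\<^sub>R U t \<xi>) (at t within {0..})"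
          using A(1) by simp
      qed
      then show ?case using elim f0 f1 by simp
    qed
    show "norm (fourier_integral u\<^sub>0 \<xi>) \<le> M" "norm (fourier_integral u\<^sub>1 \<xi>) \<le> M" for \<xi>
      using fourier_integral_bound[of u\<^sub>0 \<xi>] fourier_integral_bound[of u\<^sub>1 \<xi>] by (auto simp: M_def)
  qed (use data u U f0 f1 in \<open>auto simp: sobolev_space_def intro: continuous_on_fourier_integral\<close>)
  have P: "fourier_integral u\<^sub>1 0 = P\<^sub>1" by (simp add: fourier_integral_def P\<^sub>1_def)
  have "- (x / 2 + s - 2 * \<delta>\<^sub>1) / (2 * d) - real j = - x / (4 * d) - s / (2 * d) - real j + \<delta>\<^sub>1 / d"
    if "d \<noteq> 0" for x d :: real
    using that by (simp add: field_simps)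
  from this[of "\<sigma> - \<delta>\<^sub>1" "real CARD('n)"] have k: "decay_exponent = \<kappa>"
    using data(2,3) unfolding decay_exponent_def q_def \<kappa>_def by linarith
  show ?thesis
    using profile_asymptotics two_sided_decay unfolding P k by blast
qed

end
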